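(* Both $F_{\omega_1}$ and $F^{\mathrm{rel}}_{\omega_1}$ are Borel $3$-hypergraphable and strongly Borel $4$-hypergraphable.
   Context: $\omega_1^x$ is the least ordinal with no presentation computable from $x\in2^{\mathbb{N}}$. $F_{\omega_1}$ on $2^{\mathbb{N}}$: $x\,F_{\omega_1}\,y\iff\omega_1^x=\omega_1^y$. $F^{\mathrm{rel}}_{\omega_1}$ on $(2^{\mathbb{N}})^2$: $(x,y)\,F^{\mathrm{rel}}_{\omega_1}\,(x',y')\iff x=x'$ and $\omega_1^{x\oplus y}=\omega_1^{x\oplus y'}$. An analytic equivalence relation $E$ on $X$ is Borel $n$-hypergraphable if there is a Borel hypergraph $G$ on $X$ (a Borel set of hyperedges, each a set of at most $n$ points) such that each hyperedge lies in a single $E$-class, and whenever $x\,E\,y$ there are hyperedges $X_1,\dots,X_m$ with $x\in X_1$, $y\in X_m$ and $X_i\cap X_{i+1}\ne\emptyset$ for each $i$. It is strongly Borel $n$-hypergraphable if instead of the last condition, whenever $x\,E\,y$ some single hyperedge contains both $x$ and $y$. *)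

theory Defs
  imports "HOL-Analysis.Analysis"
begin

no_notation elt_set_eq (infix \<open>=o\<close> 50)
unbundle cardinal_syntax

section \<open>Countable ordinals\<close>

text \<open>
  Every countable ordinal is the order type of a (reflexive) well-order on a set of natural
  numbers, so the countable ordinals are the isomorphism classes of such well-orders.  The carrier
  of a well-order is its field; it may be any subset of \<open>\<nat>\<close>, so finite ordinals (including 0)
  are covered.
\<close>

quotient_type countable_ordinal = "nat rel" / partial: "\<lambda>r s. r =o s"
  morphisms rep_countable_ordinal order_type
proof (rule part_equivpI)
  show "\<exists>r :: nat rel. r =o r"
    by (rule exI[of _ "{}"]) (rule ordIso_reflexive, simp)
  show "symp (\<lambda>r s :: nat rel. r =o s)"
    by (rule sympI) (rule ordIso_symmetric)
  show "transp (\<lambda>r s :: nat rel. r =o s)"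
    by (rule transpI) (rule ordIso_transitive)
qed

lemma ordIso_refl_iff: "r =o r \<longleftrightarrow> Well_order r"
  using ordIso_reflexive by (auto simp: ordIso_def)

lemma order_type_eq_iff:
  "Well_order r \<Longrightarrow> Well_order s \<Longrightarrow> order_type r = order_type s \<longleftrightarrow> r =o s"
  using Quotient3_rel[OF Quotient3_countable_ordinal, of r s] by (simp add: ordIso_refl_iff)

lemma countable_ordinal_cases:
  obtains r where "Well_order r" "a = order_type r"
proof
  show "Well_order (rep_countable_ordinal a)"
    using Quotient3_rep_reflp[OF Quotient3_countable_ordinal, of a] by (simp add: ordIso_refl_iff)
  show "a = order_type (rep_countable_ordinal a)"
    by (simp add: Quotient3_abs_rep[OF Quotient3_countable_ordinal])
qed

instantiation countable_ordinal :: wellorder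
begin

lift_definition less_eq_countable_ordinal :: "countable_ordinal \<Rightarrow> countable_ordinal \<Rightarrow> bool"
  is "\<lambda>r s. r \<le>o s"
  by (meson ordIso_ordLeq_trans ordIso_symmetric ordLeq_ordIso_trans)

lift_definition less_countable_ordinal :: "countable_ordinal \<Rightarrow> countable_ordinal \<Rightarrow> bool"
  is "\<lambda>r s. r <o s"
  by (meson ordIso_ordLess_trans ordIso_symmetric ordLess_ordIso_trans)

lemma less_order_type_iff:
  "Well_order r \<Longrightarrow> Well_order s \<Longrightarrow> order_type r < order_type s \<longleftrightarrow> r <o s"
  by (simp add: less_countable_ordinal.abs_eq ordIso_refl_iff)

lemma less_eq_order_type_iff:
  "Well_order r \<Longrightarrow> Well_order s \<Longrightarrow> order_type r \<le> order_type s \<longleftrightarrow> r \<le>o s"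
  by (simp add: less_eq_countable_ordinal.abs_eq ordIso_refl_iff)

instance
proof
  fix a b c :: countable_ordinal
  obtain r s t where rst: "Well_order r" "Well_order s" "Well_order t"
    and abc: "a = order_type r" "b = order_type s" "c = order_type t"
    by (meson countable_ordinal_cases)
  note simps = abc rst order_type_eq_iff less_order_type_iff less_eq_order_type_iff
  show "a < b \<longleftrightarrow> a \<le> b \<and> \<not> b \<le> a"
    using not_ordLeq_iff_ordLess[OF rst(1,2)] ordLess_imp_ordLeq[of r s] by (auto simp: simps)
  show "a \<le> a"
    by (simp add: simps ordLeq_reflexive)
  show "a \<le> b \<Longrightarrow> b \<le> c \<Longrightarrow> a \<le> c"
    using ordLeq_transitive[of r s t] by (simp add: simps)
  show "a \<le> b \<Longrightarrow> b \<le> a \<Longrightarrow> a = b"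
    by (simp add: simps ordIso_iff_ordLeq)
  show "a \<le> b \<or> b \<le> a"
    using ordLeq_total[OF rst(1,2)] by (simp add: simps)
next
  fix P :: "countable_ordinal \<Rightarrow> bool" and a
  assume step: "\<And>a. (\<And>b. b < a \<Longrightarrow> P b) \<Longrightarrow> P a"
  have "Well_order r \<longrightarrow> P (order_type r)" for r
  proof (induction r rule: wf_induct_rule[OF wf_ordLess])
    case (1 r)
    show ?case
    proof
      assume r: "Well_order r"
      show "P (order_type r)"
      proof (rule step)
        fix b
        assume b: "b < order_type r"
        obtain s where s: "Well_order s" "b = order_type s"
          by (rule countable_ordinal_cases)
        then have "s <o r"
          using b r by (simp add: less_order_type_iff)
        with 1 s show "P b"
          by blast
      qed
    qed
  qed
  then show "P a"
    using countable_ordinal_cases[of a] by blast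
qed

end


section \<open>Computability relative to an oracle\<close>

type_synonym cantor = "nat \<Rightarrow> bool"

text \<open>
  Codes for partial recursive functions in an oracle: the constant 0, successor, oracle query,
  projections, composition, primitive recursion on the first argument, and minimisation over the
  first argument.
\<close>

datatype code =
    Zero
  | Succ
  | Query
  | Proj nat
  | Comp code "code list"
  | PrimRec code code
  | Mu code

instance code :: countable
  by countable_datatype

inductive eval :: "cantor \<Rightarrow> code \<Rightarrow> nat list \<Rightarrow> nat \<Rightarrow> bool" for x :: cantor where
  "eval x Zero ns 0"
| "eval x Succ [n] (Suc n)"
| "eval x Query [n] (of_bool (x n))"
| "i < length ns \<Longrightarrow> eval x (Proj i) ns (ns ! i)"
| "list_all2 (\<lambda>d v. eval x d ns v) ds vs \<Longrightarrow> eval x c vs w \<Longrightarrow> eval x (Comp c ds) ns w"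
| "eval x c ns v \<Longrightarrow> eval x (PrimRec c d) (0 # ns) v"
| "eval x (PrimRec c d) (n # ns) v \<Longrightarrow> eval x d (n # v # ns) w \<Longrightarrow>
     eval x (PrimRec c d) (Suc n # ns) w"
| "eval x c (n # ns) 0 \<Longrightarrow> (\<forall>m<n. \<exists>v>0. eval x c (m # ns) v) \<Longrightarrow> eval x (Mu c) ns n"

definition computable_rel_from :: "cantor \<Rightarrow> nat rel \<Rightarrow> bool" where
  "computable_rel_from x R \<longleftrightarrow> (\<exists>c. \<forall>m n. eval x c [m, n] (of_bool ((m, n) \<in> R)))"

definition has_computable_presentation :: "cantor \<Rightarrow> countable_ordinal \<Rightarrow> bool" where
  "has_computable_presentation x \<alpha> \<longleftrightarrow>
     (\<exists>R. Well_order R \<and> order_type R = \<alpha> \<and> computable_rel_from x R)"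

definition omega1 :: "cantor \<Rightarrow> countable_ordinal" where
  "omega1 x = (LEAST \<alpha>. \<not> has_computable_presentation x \<alpha>)"

lemma eval_deterministic: "eval x c ns v \<Longrightarrow> eval x c ns w \<Longrightarrow> v = w"
proof (induction arbitrary: w rule: eval.induct)
  case (1 ns)
  then show ?case by cases auto
next
  case (2 n)
  then show ?case by cases auto
next
  case (3 n)
  then show ?case by cases auto
next
  case (4 i ns)
  from 4(2) show ?case by cases auto
next
  case (5 ns ds vs c w')
  from 5(4) obtain us where us: "list_all2 (\<lambda>d v. eval x d ns v) ds us" "eval x c us w"
    by cases auto
  have "vs = us"
    using 5(1) us(1) by (auto simp: list_all2_conv_all_nth intro!: nth_equalityI)
  with 5 us show ?case by simp
next
  case (6 c ns v d)
  from 6(3) show ?case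
    by cases (use 6 in auto)
next
  case (7 c d n ns v w')
  from 7(5) show ?case
    by cases (use 7 in auto)
next
  case (8 c n ns)
  from 8(4) have "eval x c (w # ns) 0 \<and> (\<forall>m<w. \<exists>v>0. eval x c (m # ns) v)"
    by cases auto
  with 8(2,3) show ?case
    by (metis linorder_neqE_nat less_irrefl)
qed

lemma countable_computable_rel_from: "countable {R. computable_rel_from x R}"
proof -
  define f where "f c = {(m, n). eval x c [m, n] 1}" for c
  have "R \<in> range f" if R: "computable_rel_from x R" for R
  proof -
    obtain c where c: "\<And>m n. eval x c [m, n] (of_bool ((m, n) \<in> R))"
      using R by (auto simp: computable_rel_from_def)
    have "(m, n) \<in> R \<longleftrightarrow> eval x c [m, n] 1" for m n
      using c[of m n] eval_deterministic[of x c "[m, n]"] by (cases "(m, n) \<in> R") fastforce+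
    then have "R = f c"
      by (auto simp: f_def)
    then show ?thesis by blast
  qed
  then have "{R. computable_rel_from x R} \<subseteq> range f"
    by blast
  then show ?thesis
    by (rule countable_subset) simp
qed

lemma uncountable_countable_ordinal: "uncountable (UNIV :: countable_ordinal set)"
proof
  assume cnt: "countable (UNIV :: countable_ordinal set)"
  define W where "W = cardSuc natLeq"
  have card: "Card_order W"
    unfolding W_def by (rule cardSuc_Card_order[OF natLeq_Card_order])
  then have wo: "Well_order W"
    by (simp add: card_order_on_def)
  have seg: "\<exists>r :: nat rel. Well_order r \<and> Restr W (underS W a) =o r" if a: "a \<in> Field W" for a
  proof -
    have less: "Restr W (underS W a) <o W"
      using a by (intro underS_Restr_ordLess[OF wo]) blast
    then have wos: "Well_order (Restr W (underS W a))"
      by (simp add: ordLess_def)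
    have "|Field (Restr W (underS W a))| \<le>o Restr W (underS W a)"
      by (rule card_of_least) (simp add: wos)
    then have "|Field (Restr W (underS W a))| <o cardSuc natLeq"
      using less ordLeq_ordLess_trans unfolding W_def by blast
    then have "|Field (Restr W (underS W a))| \<le>o natLeq"
      using cardSuc_ordLeq_ordLess[OF natLeq_Card_order card_of_Card_order] by blast
    then have "|Field (Restr W (underS W a))| \<le>o |UNIV :: nat set|"
      using card_of_nat ordIso_symmetric ordLeq_ordIso_trans by blast
    then obtain f :: "_ \<Rightarrow> nat" where f: "inj_on f (Field (Restr W (underS W a)))"
      using card_of_ordLeq[of "Field (Restr W (underS W a))" "UNIV :: nat set"] by blast
    show ?thesis
      using dir_image_ordIso[OF wos f] by (metis ordIso_iff_ordLeq ordLeq_Well_order_simp)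
  qed
  then obtain g :: "nat set \<Rightarrow> nat rel" where
    g: "\<And>a. a \<in> Field W \<Longrightarrow> Well_order (g a) \<and> Restr W (underS W a) =o g a"
    by metis
  have "inj_on (\<lambda>a. order_type (g a)) (Field W)"
  proof (rule inj_onI)
    fix a b
    assume ab: "a \<in> Field W" "b \<in> Field W" "order_type (g a) = order_type (g b)"
    then have iso: "Restr W (underS W a) =o Restr W (underS W b)"
      using g order_type_eq_iff by (metis ordIso_symmetric ordIso_transitive)
    have wor: "wo_rel W"
      using wo by (simp add: wo_rel_def)
    have "underS W a = underS W b"
    proof (rule ccontr)
      assume "underS W a \<noteq> underS W b"
      moreover have fil: "wo_rel.ofilter W (underS W a)" "wo_rel.ofilter W (underS W b)"
        by (simp_all add: wo_rel.underS_ofilter[OF wor])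
      ultimately have "underS W a \<subset> underS W b \<or> underS W b \<subset> underS W a"
        using wo_rel.ofilter_linord[OF wor] by blast
      then have "Restr W (underS W a) <o Restr W (underS W b) \<or>
          Restr W (underS W b) <o Restr W (underS W a)"
        using ofilter_subset_ordLess[OF wo fil] ofilter_subset_ordLess[OF wo fil(2,1)] by blast
      then show False
        using not_ordLess_ordIso iso ordIso_symmetric[OF iso] by blast
    qed
    then show "a = b"
      using ab(1,2) by (metis wo_rel.suc_underS[OF wor])
  qed
  then have "countable (Field W)"
    using countable_image_inj_on[OF countable_subset[OF subset_UNIV cnt]] by blast
  then obtain h :: "_ \<Rightarrow> nat" where "inj_on h (Field W)"
    by (auto simp: countable_def)
  then have "|Field W| \<le>o |UNIV :: nat set|"
    using card_of_ordLeq[of "Field W" "UNIV :: nat set"] by blast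
  then have "W \<le>o natLeq"
    by (rule ordIso_ordLeq_trans[OF ordIso_symmetric[OF card_of_Field_ordIso[OF card]]
          ordLeq_ordIso_trans[OF _ card_of_nat]])
  then show False
    using not_ordLess_ordLeq[OF cardSuc_greater[OF natLeq_Card_order]] unfolding W_def by contradiction
qed

lemma ex_no_computable_presentation: "\<exists>\<alpha>. \<not> has_computable_presentation x \<alpha>"
proof (rule ccontr)
  assume all: "\<not> ?thesis"
  have "\<alpha> \<in> order_type ` {R. computable_rel_from x R}" for \<alpha>
  proof -
    have "has_computable_presentation x \<alpha>"
      using all by blast
    then obtain R where "order_type R = \<alpha>" "computable_rel_from x R"
      unfolding has_computable_presentation_def by blast
    then show ?thesis
      by blast
  qed
  then have "UNIV \<subseteq> order_type ` {R. computable_rel_from x R}"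
    by blast
  then have "countable (UNIV :: countable_ordinal set)"
    by (rule countable_subset) (rule countable_image[OF countable_computable_rel_from])
  then show False
    using uncountable_countable_ordinal by contradiction
qed

text \<open>Hence the least ordinal in the definition of \<open>omega1\<close> exists.\<close>

lemma omega1_not_presentable: "\<not> has_computable_presentation x (omega1 x)"
  unfolding omega1_def using ex_no_computable_presentation by (rule LeastI_ex)

lemma less_omega1_presentable: "\<alpha> < omega1 x \<Longrightarrow> has_computable_presentation x \<alpha>"
  unfolding omega1_def using not_less_Least by blast


section \<open>The equivalence relations\<close>

definition join :: "cantor \<Rightarrow> cantor \<Rightarrow> cantor" (infixl \<open>\<oplus>\<^sub>T\<close> 65) where
  "x \<oplus>\<^sub>T y = (\<lambda>n. if even n then x (n div 2) else y (n div 2))"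

definition F_omega1 :: "cantor rel" where
  "F_omega1 = {(x, y). omega1 x = omega1 y}"

definition F_omega1_rel :: "(cantor \<times> cantor) rel" where
  "F_omega1_rel = {((x, y), (x', y')). x = x' \<and> omega1 (x \<oplus>\<^sub>T y) = omega1 (x \<oplus>\<^sub>T y')}"


section \<open>Borel hypergraphs\<close>

text \<open>
  The notions below are meant for Polish spaces.  A set is analytic if it is the projection of a
  Borel subset of the product with the Baire space.
\<close>

definition analytic_set :: "'a::topological_space set \<Rightarrow> bool" where
  "analytic_set A \<longleftrightarrow> (\<exists>B \<in> sets (borel :: ('a \<times> (nat \<Rightarrow> nat)) measure). A = fst ` B)"

definition analytic_equivalence :: "'a::topological_space rel \<Rightarrow> bool" where
  "analytic_equivalence E \<longleftrightarrow> equiv UNIV E \<and> analytic_set E"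

text \<open>
  Hyperedges are sets of at most \<open>n\<close> points.  The Borel structure on the space of these sets is the
  quotient of that of \<open>X\<^sup>n\<close> under \<open>(x\<^sub>1, \<dots>, x\<^sub>n) \<mapsto> {x\<^sub>1, \<dots>, x\<^sub>n}\<close>; tuples may repeat entries, so
  hyperedges with fewer than \<open>n\<close> points are included.
\<close>

definition borel_hypergraph :: "nat \<Rightarrow> 'a::topological_space set set \<Rightarrow> bool" where
  "borel_hypergraph n G \<longleftrightarrow>
     (\<forall>e\<in>G. finite e \<and> card e \<le> n) \<and>
     {f \<in> {..<n} \<rightarrow>\<^sub>E UNIV. f ` {..<n} \<in> G} \<in> sets (\<Pi>\<^sub>M i\<in>{..<n}. (borel :: 'a measure))"

definition hyperedge_path :: "'a set set \<Rightarrow> 'a \<Rightarrow> 'a \<Rightarrow> 'a set list \<Rightarrow> bool" where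
  "hyperedge_path G x y es \<longleftrightarrow>
     es \<noteq> [] \<and> set es \<subseteq> G \<and> x \<in> hd es \<and> y \<in> last es \<and>
     (\<forall>i. Suc i < length es \<longrightarrow> es ! i \<inter> es ! Suc i \<noteq> {})"

definition borel_hypergraphable :: "nat \<Rightarrow> 'a::topological_space rel \<Rightarrow> bool" where
  "borel_hypergraphable n E \<longleftrightarrow> analytic_equivalence E \<and>
     (\<exists>G. borel_hypergraph n G \<and>
        (\<forall>e\<in>G. \<exists>C \<in> UNIV // E. e \<subseteq> C) \<and>
        (\<forall>x y. (x, y) \<in> E \<longrightarrow> (\<exists>es. hyperedge_path G x y es)))"

definition strongly_borel_hypergraphable :: "nat \<Rightarrow> 'a::topological_space rel \<Rightarrow> bool" where
  "strongly_borel_hypergraphable n E \<longleftrightarrow> analytic_equivalence E \<and>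
     (\<exists>G. borel_hypergraph n G \<and>
        (\<forall>e\<in>G. \<exists>C \<in> UNIV // E. e \<subseteq> C) \<and>
        (\<forall>x y. (x, y) \<in> E \<longrightarrow> (\<exists>e\<in>G. x \<in> e \<and> y \<in> e)))"

end

theory Submission
  imports Defs "HOL-Library.Nat_Bijection"
begin

text \<open>
  Given \<open>x\<close> and \<open>y\<close> with the same \<open>omega1\<close>, let \<open>z = x \<oplus> g\<close> and \<open>w = y \<oplus> h\<close>, where \<open>g\<close> and \<open>h\<close> are Cohen
  generic over \<open>x\<close> and \<open>y\<close>.  Genericity preserves \<open>omega1\<close>, but two Cohen reals can be chosen so that
  together they code an arbitrary real \<open>t\<close>; we let \<open>t\<close> witness that all four points have the same
  \<open>omega1\<close>.  Checking the witness is a Borel condition, so \<open>{x, z, w}\<close> and \<open>{y, z, w}\<close> are edges of a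
  Borel 3-hypergraph and \<open>{x, y, z, w}\<close> is an edge of a Borel 4-hypergraph.

  A witness for \<open>omega1 x \<le> omega1 y\<close> assigns to each linear order computable from \<open>x\<close> either a
  descending sequence or an isomorphism with a relation computable from \<open>y\<close>.  The witness for
  \<open>x \<oplus> g\<close> and \<open>x\<close> depends on \<open>g\<close>, but in a Borel way, hence on a comeager set continuously; so \<open>t\<close> can
  be fixed before \<open>g\<close> is chosen.

  That a generic \<open>g\<close> preserves \<open>omega1\<close> follows from a game whose strategies produce, below a condition
  \<open>p\<close>, a descending sequence in the order computed from \<open>x \<oplus> g\<close>.  The finite partial strategies form a
  tree computable from \<open>x\<close>.  An infinite path makes the order ill-founded for generic \<open>g\<close>; without one,
  the Kleene--Brouwer order of the tree is a well-order computable from \<open>x\<close> that bounds the order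
  computed from \<open>x \<oplus> g\<close>.
\<close>

section \<open>Functions computable from an oracle\<close>

text \<open>The equality of two values of \<open>omega1\<close> is checked through a real witness
  that the two points do not provide, so the further points of an edge have to store it. One generic
  point could not: if \<open>x \<oplus> g\<close> computed an arbitrary \<open>t\<close>, its
  \<open>omega1\<close> would be at least that of \<open>t\<close>. Split between \<open>g\<close>
  and \<open>h\<close>, the code is invisible to each alone, because the bits of \<open>t\<close>
  sit where the two coincide. One pair \<open>z\<close>, \<open>w\<close> serves both
  \<open>x\<close> and \<open>y\<close>, so two 3-point edges overlap, and all four points fit in
  one edge.

  Preservation of \<open>omega1\<close> needs a presentation computable from \<open>x\<close>.
  Whether a condition forces well-foundedness cannot be decided from \<open>x\<close>, whereas
  legality of a finite partial strategy can, and a tree of these without infinite path comes with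
  its own computable well-order. That order is fixed before \<open>g\<close>, so ranks in it, and
  with them the isomorphism, are Borel in \<open>g\<close>.

  Both relations are one relation over a parameter: a constant for the first, the common first
  coordinate for the second.\<close>

definition computable_fun :: "cantor \<Rightarrow> nat \<Rightarrow> (nat list \<Rightarrow> nat) \<Rightarrow> bool" where
  "computable_fun x k f \<longleftrightarrow> (\<exists>c. \<forall>ns. length ns = k \<longrightarrow> eval x c ns (f ns))"

definition decidable_pred :: "cantor \<Rightarrow> nat \<Rightarrow> (nat list \<Rightarrow> bool) \<Rightarrow> bool" where
  "decidable_pred x k P \<longleftrightarrow> computable_fun x k (\<lambda>ns. of_bool (P ns))"

lemma computable_fun_cong:
  "computable_fun x k f \<Longrightarrow> (\<And>ns. length ns = k \<Longrightarrow> f ns = g ns) \<Longrightarrow> computable_fun x k g"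
  unfolding computable_fun_def by metis

lemma computable_fun_zero: "computable_fun x k (\<lambda>ns. 0)"
  unfolding computable_fun_def by (rule exI[of _ Zero]) (auto intro: eval.intros)

lemma computable_fun_nth: "i < k \<Longrightarrow> computable_fun x k (\<lambda>ns. ns ! i)"
  unfolding computable_fun_def by (rule exI[of _ "Proj i"]) (auto intro: eval.intros)

lemma computable_fun_compose:
  assumes h: "computable_fun x m h" and fs: "\<forall>f\<in>set fs. computable_fun x k f"
    and m: "length fs = m"
  shows "computable_fun x k (\<lambda>ns. h (map (\<lambda>f. f ns) fs))"
proof -
  obtain c where c: "\<And>ns. length ns = m \<Longrightarrow> eval x c ns (h ns)"
    using h by (auto simp: computable_fun_def)
  obtain d where d: "\<And>f ns. f \<in> set fs \<Longrightarrow> length ns = k \<Longrightarrow> eval x (d f) ns (f ns)"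
    using fs unfolding computable_fun_def by metis
  have "eval x (Comp c (map d fs)) ns (h (map (\<lambda>f. f ns) fs))" if "length ns = k" for ns
    by (rule eval.intros(5)[where vs = "map (\<lambda>f. f ns) fs"])
      (auto simp: list_all2_conv_all_nth d c m that)
  then show ?thesis
    unfolding computable_fun_def by blast
qed

lemma computable_fun_lift1:
  assumes "computable_fun x 1 (\<lambda>ns. h (ns ! 0))" "computable_fun x k f"
  shows "computable_fun x k (\<lambda>ns. h (f ns))"
  using computable_fun_compose[OF assms(1), of "[f]" k] assms(2) by simp

lemma computable_fun_lift2:
  assumes "computable_fun x 2 (\<lambda>ns. h (ns ! 0) (ns ! 1))" "computable_fun x k f" "computable_fun x k g"
  shows "computable_fun x k (\<lambda>ns. h (f ns) (g ns))"
  using computable_fun_compose[OF assms(1), of "[f, g]" k] assms(2,3) by simp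

lemma computable_fun_lift3:
  assumes "computable_fun x 3 (\<lambda>ns. h (ns ! 0) (ns ! 1) (ns ! 2))"
    "computable_fun x k f" "computable_fun x k g" "computable_fun x k e"
  shows "computable_fun x k (\<lambda>ns. h (f ns) (g ns) (e ns))"
  using computable_fun_compose[OF assms(1), of "[f, g, e]" k] assms(2-4) by simp

lemma computable_fun_Suc: "computable_fun x k f \<Longrightarrow> computable_fun x k (\<lambda>ns. Suc (f ns))"
proof (rule computable_fun_lift1[where h = Suc])
  have "\<forall>ns. length ns = 1 \<longrightarrow> eval x Succ ns (Suc (ns ! 0))"
    by (auto simp: length_Suc_conv intro: eval.intros)
  then show "computable_fun x 1 (\<lambda>ns. Suc (ns ! 0))"
    unfolding computable_fun_def by blast
qed

lemma decidable_pred_oracle: "computable_fun x k f \<Longrightarrow> decidable_pred x k (\<lambda>ns. x (f ns))"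
  unfolding decidable_pred_def
proof (rule computable_fun_lift1[where h = "\<lambda>n. of_bool (x n)"])
  have "\<forall>ns. length ns = 1 \<longrightarrow> eval x Query ns (of_bool (x (ns ! 0)))"
    by (metis One_nat_def length_0_conv length_Suc_conv nth_Cons_0 eval.intros(3))
  then show "computable_fun x 1 (\<lambda>ns. of_bool (x (ns ! 0)))"
    unfolding computable_fun_def by blast
qed

lemma computable_fun_const: "computable_fun x k (\<lambda>ns. n)"
  by (induction n) (auto intro: computable_fun_zero computable_fun_Suc)

lemma computable_fun_rec:
  assumes a: "computable_fun x k a" and b: "computable_fun x k b"
    and s: "computable_fun x (Suc (Suc k)) (\<lambda>ns. s (ns ! 0) (ns ! 1) (drop 2 ns))"
  shows "computable_fun x k (\<lambda>ns. rec_nat (b ns) (\<lambda>i v. s i v ns) (a ns))"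
proof -
  obtain cb where cb: "\<And>ns. length ns = k \<Longrightarrow> eval x cb ns (b ns)"
    using b by (auto simp: computable_fun_def)
  obtain cs where cs: "\<And>ns. length ns = Suc (Suc k) \<Longrightarrow> eval x cs ns (s (ns ! 0) (ns ! 1) (drop 2 ns))"
    using s by (auto simp: computable_fun_def)
  have rec: "eval x (PrimRec cb cs) (n # ns) (rec_nat (b ns) (\<lambda>i v. s i v ns) n)"
    if ns: "length ns = k" for n ns
  proof (induction n)
    case 0
    show ?case using cb[OF ns] by (auto intro: eval.intros)
  next
    case (Suc n)
    show ?case
      using cs[of "n # rec_nat (b ns) (\<lambda>i v. s i v ns) n # ns"] ns Suc by (auto intro: eval.intros)
  qed
  let ?r = "\<lambda>ns. rec_nat (b (tl ns)) (\<lambda>i v. s i v (tl ns)) (hd ns)"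
  have "computable_fun x (Suc k) ?r"
    unfolding computable_fun_def
  proof (intro exI[of _ "PrimRec cb cs"] allI impI)
    fix ns :: "nat list"
    assume "length ns = Suc k"
    then show "eval x (PrimRec cb cs) ns (?r ns)"
      by (cases ns) (simp_all add: rec)
  qed
  \<comment> \<open>The projections rebuild the parameter list behind the recursion argument
    \<open>a ns\<close>, since composition works argument by argument.\<close>
  moreover let ?fs = "a # map (\<lambda>i ns. ns ! i) [0..<k]"
  have "\<forall>f\<in>set ?fs. computable_fun x k f"
    using a by (auto intro: computable_fun_nth)
  ultimately have "computable_fun x k (\<lambda>ns. ?r (map (\<lambda>f. f ns) ?fs))"
    by (intro computable_fun_compose) auto
  then show ?thesis
  proof (rule computable_fun_cong)
    fix ns :: "nat list"
    assume "length ns = k"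
    then have "map (\<lambda>f. f ns) (map (\<lambda>i ns. ns ! i) [0..<k]) = ns"
      by (intro nth_equalityI) auto
    then show "?r (map (\<lambda>f. f ns) ?fs) = rec_nat (b ns) (\<lambda>i v. s i v ns) (a ns)"
      by (simp only: list.map list.sel)
  qed
qed

section \<open>Arithmetic, decidable predicates and bounded search\<close>

lemma computable_fun_pred:
  "computable_fun x k f \<Longrightarrow> computable_fun x k (\<lambda>ns. f ns - 1)"
proof (rule computable_fun_lift1[where h = "\<lambda>n. n - 1"])
  have "computable_fun x 1 (\<lambda>ns. rec_nat 0 (\<lambda>i v. i) (ns ! 0))"
    by (intro computable_fun_rec computable_fun_nth computable_fun_zero) auto
  moreover have "rec_nat 0 (\<lambda>i v. i) n = n - 1" for n :: nat
    by (cases n) auto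
  ultimately show "computable_fun x 1 (\<lambda>ns. ns ! 0 - 1)"
    by simp
qed

lemma computable_fun_plus:
  "computable_fun x k f \<Longrightarrow> computable_fun x k g \<Longrightarrow> computable_fun x k (\<lambda>ns. f ns + g ns)"
proof (rule computable_fun_lift2[where h = "\<lambda>m n. m + n"])
  have "computable_fun x 2 (\<lambda>ns. rec_nat (ns ! 0) (\<lambda>i v. Suc v) (ns ! 1))"
    by (intro computable_fun_rec computable_fun_nth computable_fun_Suc) auto
  moreover have "rec_nat m (\<lambda>i v. Suc v) n = m + n" for m n
    by (induction n) auto
  ultimately show "computable_fun x 2 (\<lambda>ns. ns ! 0 + ns ! 1)"
    by simp
qed

lemma computable_fun_minus:
  "computable_fun x k f \<Longrightarrow> computable_fun x k g \<Longrightarrow> computable_fun x k (\<lambda>ns. f ns - g ns)"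
proof (rule computable_fun_lift2[where h = "\<lambda>m n. m - n"])
  have "computable_fun x 2 (\<lambda>ns. rec_nat (ns ! 0) (\<lambda>i v. v - 1) (ns ! 1))"
    by (intro computable_fun_rec computable_fun_nth computable_fun_pred) auto
  moreover have "rec_nat m (\<lambda>i v. v - 1) n = m - n" for m n :: nat
    by (induction n) auto
  ultimately show "computable_fun x 2 (\<lambda>ns. ns ! 0 - ns ! 1)"
    by simp
qed

lemma computable_fun_times:
  "computable_fun x k f \<Longrightarrow> computable_fun x k g \<Longrightarrow> computable_fun x k (\<lambda>ns. f ns * g ns)"
proof (rule computable_fun_lift2[where h = "\<lambda>m n. m * n"])
  have "computable_fun x 2 (\<lambda>ns. rec_nat 0 (\<lambda>i v. v + ns ! 0) (ns ! 1))"
  proof (rule computable_fun_rec)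
    have "computable_fun x (Suc (Suc 2)) (\<lambda>ns. ns ! 1 + ns ! 2)"
      by (intro computable_fun_plus computable_fun_nth) auto
    then show "computable_fun x (Suc (Suc 2)) (\<lambda>ns. ns ! 1 + drop 2 ns ! 0)"
      by (rule computable_fun_cong) simp
  qed (auto intro: computable_fun_nth computable_fun_zero)
  moreover have "rec_nat 0 (\<lambda>i v. v + m) n = m * n" for m n :: nat
    by (induction n) auto
  ultimately show "computable_fun x 2 (\<lambda>ns. ns ! 0 * ns ! 1)"
    by simp
qed

lemma computable_fun_power2:
  "computable_fun x k f \<Longrightarrow> computable_fun x k (\<lambda>ns. 2 ^ f ns)"
proof (rule computable_fun_lift1[where h = "\<lambda>n. 2 ^ n"])
  have "computable_fun x 1 (\<lambda>ns. rec_nat 1 (\<lambda>i v. v + v) (ns ! 0))"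
    by (intro computable_fun_rec computable_fun_nth computable_fun_const computable_fun_plus) auto
  moreover have "rec_nat 1 (\<lambda>i v. v + v) n = (2::nat) ^ n" for n
    by (induction n) auto
  ultimately show "computable_fun x 1 (\<lambda>ns. 2 ^ (ns ! 0))"
    by simp
qed

lemma computable_fun_of_bool:
  "decidable_pred x k P \<Longrightarrow> computable_fun x k (\<lambda>ns. of_bool (P ns))"
  by (simp add: decidable_pred_def)

lemma decidable_pred_cong:
  "decidable_pred x k P \<Longrightarrow> (\<And>ns. length ns = k \<Longrightarrow> P ns = Q ns) \<Longrightarrow> decidable_pred x k Q"
  unfolding decidable_pred_def by (erule computable_fun_cong) auto

lemma decidable_pred_not:
  assumes "decidable_pred x k P"
  shows "decidable_pred x k (\<lambda>ns. \<not> P ns)"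
proof -
  have "computable_fun x k (\<lambda>ns. 1 - of_bool (P ns))"
    using assms unfolding decidable_pred_def by (intro computable_fun_minus computable_fun_const)
  then show ?thesis
    unfolding decidable_pred_def by (rule computable_fun_cong) simp
qed

lemma decidable_pred_conj:
  assumes "decidable_pred x k P" "decidable_pred x k Q"
  shows "decidable_pred x k (\<lambda>ns. P ns \<and> Q ns)"
proof -
  have "computable_fun x k (\<lambda>ns. of_bool (P ns) * of_bool (Q ns))"
    using assms unfolding decidable_pred_def by (intro computable_fun_times)
  then show ?thesis
    unfolding decidable_pred_def by (rule computable_fun_cong) simp
qed

lemma decidable_pred_disj:
  assumes "decidable_pred x k P" "decidable_pred x k Q"
  shows "decidable_pred x k (\<lambda>ns. P ns \<or> Q ns)"
  using decidable_pred_not[OF decidable_pred_conj[OF assms[THEN decidable_pred_not]]] by simp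

lemma decidable_pred_imp:
  assumes "decidable_pred x k P" "decidable_pred x k Q"
  shows "decidable_pred x k (\<lambda>ns. P ns \<longrightarrow> Q ns)"
  using decidable_pred_disj[OF decidable_pred_not[OF assms(1)] assms(2)] by simp

lemma computable_fun_if:
  assumes "decidable_pred x k P" "computable_fun x k f" "computable_fun x k g"
  shows "computable_fun x k (\<lambda>ns. if P ns then f ns else g ns)"
proof -
  have "computable_fun x k (\<lambda>ns. of_bool (P ns) * f ns + of_bool (\<not> P ns) * g ns)"
    using assms by (intro computable_fun_plus computable_fun_times computable_fun_of_bool
      decidable_pred_not)
  then show ?thesis
    by (rule computable_fun_cong) auto
qed

lemma decidable_pred_eq0:
  assumes "computable_fun x k f"
  shows "decidable_pred x k (\<lambda>ns. f ns = 0)"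
proof -
  have "computable_fun x k (\<lambda>ns. 1 - f ns)"
    using assms by (intro computable_fun_minus computable_fun_const)
  then show ?thesis
    unfolding decidable_pred_def by (rule computable_fun_cong) simp
qed

lemma decidable_pred_le:
  "computable_fun x k f \<Longrightarrow> computable_fun x k g \<Longrightarrow> decidable_pred x k (\<lambda>ns. f ns \<le> g ns)"
  using decidable_pred_eq0[OF computable_fun_minus, of x k f g] by simp

lemma decidable_pred_less:
  assumes "computable_fun x k f" "computable_fun x k g"
  shows "decidable_pred x k (\<lambda>ns. f ns < g ns)"
  using decidable_pred_not[OF decidable_pred_le[OF assms(2,1)]] by (simp add: not_le)

lemma decidable_pred_eq:
  assumes "computable_fun x k f" "computable_fun x k g"
  shows "decidable_pred x k (\<lambda>ns. f ns = g ns)"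
  using decidable_pred_conj[OF decidable_pred_le[OF assms] decidable_pred_le[OF assms(2,1)]]
  by (simp add: eq_iff)

lemma decidable_pred_iff:
  assumes "decidable_pred x k P" "decidable_pred x k Q"
  shows "decidable_pred x k (\<lambda>ns. P ns = Q ns)"
  using decidable_pred_conj[OF decidable_pred_imp[OF assms] decidable_pred_imp[OF assms(2,1)]]
  by (simp add: iff_conv_conj_imp)

text \<open>A bounded quantifier is a product of truth values, computed by recursion on the bound.
  The bound variable is prepended to the arguments and \<open>drop 1\<close> recovers the outer
  ones, so nested quantifiers appear as nested drops.\<close>

lemma decidable_pred_all_less:
  assumes b: "computable_fun x k b"
    and P: "decidable_pred x (Suc k) (\<lambda>ns. P (ns ! 0) (drop 1 ns))"
  shows "decidable_pred x k (\<lambda>ns. \<forall>i<b ns. P i ns)"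
proof -
  have "computable_fun x k (\<lambda>ns. rec_nat 1 (\<lambda>i v. v * of_bool (P i ns)) (b ns))"
  proof (rule computable_fun_rec[OF b computable_fun_const])
    let ?f = "\<lambda>ns. of_bool (P (ns ! 0) (drop 1 ns))"
    \<comment> \<open>Leaves out position 1, which holds the value of the recursion.\<close>
    let ?fs = "(\<lambda>ns. ns ! 0) # map (\<lambda>i ns. ns ! Suc (Suc i)) [0..<k]"
    have "computable_fun x (Suc (Suc k)) (\<lambda>ns. ns ! 1 * ?f (map (\<lambda>f. f ns) ?fs))"
      by (intro computable_fun_times computable_fun_nth
          computable_fun_compose[OF P[unfolded decidable_pred_def]]) (auto intro: computable_fun_nth)
    then show "computable_fun x (Suc (Suc k)) (\<lambda>ns. ns ! 1 * of_bool (P (ns ! 0) (drop 2 ns)))"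
    proof (rule computable_fun_cong)
      fix ns :: "nat list"
      assume "length ns = Suc (Suc k)"
      then have "map (\<lambda>f. f ns) ?fs = ns ! 0 # drop 2 ns"
        by (auto simp: nth_Cons' intro!: nth_equalityI)
      then show "ns ! 1 * ?f (map (\<lambda>f. f ns) ?fs) = ns ! 1 * of_bool (P (ns ! 0) (drop 2 ns))"
        by (metis drop0 drop_Suc_Cons nth_Cons_0 One_nat_def)
    qed
  qed
  moreover have "rec_nat 1 (\<lambda>i v. v * of_bool (P i ns)) n = (of_bool (\<forall>i<n. P i ns) :: nat)" for n ns
    by (induction n) (auto simp: less_Suc_eq)
  ultimately show ?thesis
    by (simp add: decidable_pred_def)
qed

lemma decidable_pred_ex_less:
  assumes b: "computable_fun x k b"
    and P: "decidable_pred x (Suc k) (\<lambda>ns. P (ns ! 0) (drop 1 ns))"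
  shows "decidable_pred x k (\<lambda>ns. \<exists>i<b ns. P i ns)"
  using decidable_pred_not[OF decidable_pred_all_less[OF b decidable_pred_not[OF P]]] by simp

text \<open>The disjunct \<open>i = b\<close> makes \<open>b\<close> the answer of a failed
  search.\<close>

definition bounded_least :: "nat \<Rightarrow> (nat \<Rightarrow> bool) \<Rightarrow> nat" where
  "bounded_least b P = (LEAST i. i = b \<or> P i)"

text \<open>Every \<open>i\<close> before the first success contributes one to the count, so the
  search becomes a sum that primitive recursion can compute.\<close>

lemma bounded_least_eq_card: "bounded_least b P = card {i. i < b \<and> (\<forall>j\<le>i. \<not> P j)}"
proof -
  let ?l = "LEAST i. i = b \<or> P i"
  have l: "?l = b \<or> P ?l" "?l \<le> b"
    using LeastI[of "\<lambda>i. i = b \<or> P i" b] by (auto intro: Least_le)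
  have "{i. i < b \<and> (\<forall>j\<le>i. \<not> P j)} = {..<?l}"
  proof (intro set_eqI iffI)
    fix i
    assume i: "i \<in> {i. i < b \<and> (\<forall>j\<le>i. \<not> P j)}"
    show "i \<in> {..<?l}"
    proof (rule ccontr)
      assume "i \<notin> {..<?l}"
      then show False
        using i l(1) by auto
    qed
  next
    fix i
    assume i: "i \<in> {..<?l}"
    then have "\<not> (j = b \<or> P j)" if "j \<le> i" for j
      by (intro not_less_Least) (use that in simp)
    moreover have "i < b"
      using i l(2) by simp
    ultimately show "i \<in> {i. i < b \<and> (\<forall>j\<le>i. \<not> P j)}"
      by simp
  qed
  then show ?thesis
    by (simp add: bounded_least_def)
qed

lemma computable_fun_bounded_least:
  assumes b: "computable_fun x k b"
    and P: "decidable_pred x (Suc k) (\<lambda>ns. P (ns ! 0) (drop 1 ns))"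
  shows "computable_fun x k (\<lambda>ns. bounded_least (b ns) (\<lambda>i. P i ns))"
proof -
  have Q: "decidable_pred x (Suc k) (\<lambda>ns. \<forall>j<Suc (ns ! 0). \<not> P j (drop 1 ns))"
  proof (rule decidable_pred_all_less)
    let ?f = "\<lambda>ns. of_bool (P (ns ! 0) (drop 1 ns))"
    let ?fs = "(\<lambda>ns. ns ! 0) # map (\<lambda>i ns. ns ! Suc (Suc i)) [0..<k]"
    have "decidable_pred x (Suc (Suc k)) (\<lambda>ns. ?f (map (\<lambda>f. f ns) ?fs) = (0::nat))"
      by (intro decidable_pred_eq0
          computable_fun_compose[OF P[unfolded decidable_pred_def]]) (auto intro: computable_fun_nth)
    then show "decidable_pred x (Suc (Suc k)) (\<lambda>ns. \<not> P (ns ! 0) (drop 1 (drop 1 ns)))"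
    proof (rule decidable_pred_cong)
      fix ns :: "nat list"
      assume "length ns = Suc (Suc k)"
      then have "map (\<lambda>f. f ns) ?fs = ns ! 0 # drop 1 (drop 1 ns)"
        by (auto simp: nth_Cons' intro!: nth_equalityI)
      then have "P (map (\<lambda>f. f ns) ?fs ! 0) (drop 1 (map (\<lambda>f. f ns) ?fs)) = P (ns ! 0) (drop 1 (drop 1 ns))"
        by (metis drop0 drop_Suc_Cons nth_Cons_0 One_nat_def)
      then show "(?f (map (\<lambda>f. f ns) ?fs) = (0::nat)) = (\<not> P (ns ! 0) (drop 1 (drop 1 ns)))"
        by simp
    qed
  qed (auto intro: computable_fun_nth computable_fun_Suc)
  have "computable_fun x k (\<lambda>ns. rec_nat 0 (\<lambda>i v. v + of_bool (\<forall>j<Suc i. \<not> P j ns)) (b ns))"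
  proof (rule computable_fun_rec[OF b computable_fun_const])
    let ?f = "\<lambda>ns. of_bool (\<forall>j<Suc (ns ! 0). \<not> P j (drop 1 ns))"
    let ?fs = "(\<lambda>ns. ns ! 0) # map (\<lambda>i ns. ns ! Suc (Suc i)) [0..<k]"
    have "computable_fun x (Suc (Suc k)) (\<lambda>ns. ns ! 1 + ?f (map (\<lambda>f. f ns) ?fs))"
      by (intro computable_fun_plus computable_fun_nth
          computable_fun_compose[OF Q[unfolded decidable_pred_def]]) (auto intro: computable_fun_nth)
    then show "computable_fun x (Suc (Suc k))
        (\<lambda>ns. ns ! 1 + of_bool (\<forall>j<Suc (ns ! 0). \<not> P j (drop 2 ns)))"
    proof (rule computable_fun_cong)
      fix ns :: "nat list"
      assume "length ns = Suc (Suc k)"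
      then have "map (\<lambda>f. f ns) ?fs = ns ! 0 # drop 2 ns"
        by (auto simp: nth_Cons' intro!: nth_equalityI)
      then show "ns ! 1 + ?f (map (\<lambda>f. f ns) ?fs) =
          ns ! 1 + of_bool (\<forall>j<Suc (ns ! 0). \<not> P j (drop 2 ns))"
        by (metis drop0 drop_Suc_Cons nth_Cons_0 One_nat_def)
    qed
  qed
  moreover have "rec_nat 0 (\<lambda>i v. v + of_bool (\<forall>j<Suc i. \<not> P j ns)) n =
      bounded_least n (\<lambda>i. P i ns)" for n ns
  proof (induction n)
    case 0
    show ?case by (simp add: bounded_least_eq_card)
  next
    case (Suc n)
    have "{i. i < Suc n \<and> (\<forall>j\<le>i. \<not> P j ns)} =
        {i. i < n \<and> (\<forall>j\<le>i. \<not> P j ns)} \<union> (if \<forall>j\<le>n. \<not> P j ns then {n} else {})"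
      by (auto simp: less_Suc_eq)
    then have "card {i. i < Suc n \<and> (\<forall>j\<le>i. \<not> P j ns)} =
        card {i. i < n \<and> (\<forall>j\<le>i. \<not> P j ns)} + of_bool (\<forall>j\<le>n. \<not> P j ns)"
      by (auto simp: card_insert_if)
    with Suc show ?case
      by (simp add: bounded_least_eq_card less_Suc_eq_le)
  qed
  ultimately show ?thesis
    by simp
qed

lemmas computability_intros =
  computable_fun_const computable_fun_nth computable_fun_Suc computable_fun_plus
  computable_fun_minus computable_fun_times computable_fun_power2 computable_fun_of_bool
  computable_fun_if decidable_pred_oracle decidable_pred_not decidable_pred_conj
  decidable_pred_disj decidable_pred_imp decidable_pred_iff decidable_pred_le
  decidable_pred_less decidable_pred_eq decidable_pred_all_less decidable_pred_ex_less
  computable_fun_bounded_least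

lemma computable_fun_drop_nth: "i + j < k \<Longrightarrow> computable_fun x k (\<lambda>ns. drop j ns ! i)"
  by (rule computable_fun_cong[OF computable_fun_nth[of "j + i"]]) auto

lemma computable_fun_drop_drop_nth:
  "l + (i + j) < k \<Longrightarrow> computable_fun x k (\<lambda>ns. drop l (drop j ns) ! i)"
  by (rule computable_fun_cong[OF computable_fun_drop_nth[of i "l + j"]]) auto

lemmas computability_leaf_intros = computable_fun_drop_nth computable_fun_drop_drop_nth

lemma decidable_pred_lift1:
  assumes "decidable_pred x 1 (\<lambda>ns. h (ns ! 0))" "computable_fun x k f"
  shows "decidable_pred x k (\<lambda>ns. h (f ns))"
  using computable_fun_lift1[of x "\<lambda>a. of_bool (h a)"] assms unfolding decidable_pred_def by simp

lemma decidable_pred_lift2: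
  assumes "decidable_pred x 2 (\<lambda>ns. h (ns ! 0) (ns ! 1))" "computable_fun x k f" "computable_fun x k g"
  shows "decidable_pred x k (\<lambda>ns. h (f ns) (g ns))"
  using computable_fun_lift2[of x "\<lambda>a b. of_bool (h a b)"] assms unfolding decidable_pred_def by simp

lemma decidable_pred_lift3:
  assumes "decidable_pred x 3 (\<lambda>ns. h (ns ! 0) (ns ! 1) (ns ! 2))"
    "computable_fun x k f" "computable_fun x k g" "computable_fun x k e"
  shows "decidable_pred x k (\<lambda>ns. h (f ns) (g ns) (e ns))"
  using computable_fun_lift3[of x "\<lambda>a b c. of_bool (h a b c)"] assms
  unfolding decidable_pred_def by simp

lemma bounded_least_eqI:
  "P n \<Longrightarrow> (\<And>i. i < n \<Longrightarrow> \<not> P i) \<Longrightarrow> n \<le> b \<Longrightarrow> bounded_least b P = n"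
  unfolding bounded_least_def by (rule Least_equality) (auto intro: leI)

lemma computable_fun_div:
  "computable_fun x k f \<Longrightarrow> computable_fun x k g \<Longrightarrow> computable_fun x k (\<lambda>ns. f ns div g ns)"
proof (rule computable_fun_lift2[where h = "\<lambda>m n. m div n"])
  \<comment> \<open>The quotient is the first \<open>i\<close> with \<open>m < Suc i * n\<close>; it
    is at most \<open>m\<close>, which bounds the search. Division by zero has the value 0.\<close>
  have "computable_fun x 2
      (\<lambda>ns. if ns ! 1 = 0 then 0 else bounded_least (ns ! 0) (\<lambda>i. ns ! 0 < Suc i * (ns ! 1)))"
    by (intro computability_intros computability_leaf_intros) auto
  moreover have "(if n = 0 then 0 else bounded_least m (\<lambda>i. m < Suc i * n)) = m div n" for m n
  proof (cases "n = 0")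
    case False
    have "m < Suc (m div n) * n"
      using False dividend_less_div_times[of n m] by simp
    moreover have "\<not> m < Suc i * n" if "i < m div n" for i
      using that by (metis Suc_leI div_times_less_eq_dividend mult_le_mono1 not_le order.trans)
    ultimately show ?thesis
      using False by (simp add: bounded_least_eqI)
  qed simp
  ultimately show "computable_fun x 2 (\<lambda>ns. ns ! 0 div ns ! 1)"
    by (simp only:)
qed

lemma computable_fun_mod:
  assumes "computable_fun x k f" "computable_fun x k g"
  shows "computable_fun x k (\<lambda>ns. f ns mod g ns)"
  unfolding modulo_nat_def using assms by (intro computability_intros computable_fun_div)

lemma decidable_pred_even:
  "computable_fun x k f \<Longrightarrow> decidable_pred x k (\<lambda>ns. even (f ns))"
  unfolding even_iff_mod_2_eq_zero by (intro computability_intros computable_fun_mod)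

section \<open>Pairs and finite sequences of numbers\<close>

lemma computable_fun_prod_encode:
  "computable_fun x k f \<Longrightarrow> computable_fun x k g \<Longrightarrow> computable_fun x k (\<lambda>ns. prod_encode (f ns, g ns))"
  unfolding prod_encode_def triangle_def by simp (intro computability_intros computable_fun_div)

definition pfst :: "nat \<Rightarrow> nat" where "pfst n = fst (prod_decode n)"
definition psnd :: "nat \<Rightarrow> nat" where "psnd n = snd (prod_decode n)"

lemma pfst_encode [simp]: "pfst (prod_encode (m, n)) = m"
  and psnd_encode [simp]: "psnd (prod_encode (m, n)) = n"
  by (simp_all add: pfst_def psnd_def)

lemma encode_pfst_psnd [simp]: "prod_encode (pfst n, psnd n) = n"
  by (simp add: pfst_def psnd_def)

lemma pfst_le: "pfst n \<le> n" and psnd_le: "psnd n \<le> n"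
  by (metis encode_pfst_psnd le_prod_encode_1, metis encode_pfst_psnd le_prod_encode_2)

text \<open>Both components are at most the code, so inverting the pairing is a bounded
  search.\<close>

lemma computable_fun_pfst: "computable_fun x k f \<Longrightarrow> computable_fun x k (\<lambda>ns. pfst (f ns))"
proof (rule computable_fun_lift1[where h = pfst])
  have "computable_fun x 1
      (\<lambda>ns. bounded_least (ns ! 0) (\<lambda>m. \<exists>n<Suc (ns ! 0). prod_encode (m, n) = ns ! 0))"
    by (intro computability_intros computability_leaf_intros computable_fun_prod_encode) auto
  moreover have "bounded_least a (\<lambda>m. \<exists>n<Suc a. prod_encode (m, n) = a) = pfst a" for a
  proof (rule bounded_least_eqI)
    show "\<exists>n<Suc a. prod_encode (pfst a, n) = a"
      by (rule exI[of _ "psnd a"]) (simp add: psnd_le less_Suc_eq_le)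
    show "\<not> (\<exists>n<Suc a. prod_encode (i, n) = a)" if "i < pfst a" for i
      using that by auto
  qed (rule pfst_le)
  ultimately show "computable_fun x 1 (\<lambda>ns. pfst (ns ! 0))"
    by simp
qed

lemma computable_fun_psnd: "computable_fun x k f \<Longrightarrow> computable_fun x k (\<lambda>ns. psnd (f ns))"
proof (rule computable_fun_lift1[where h = psnd])
  have "computable_fun x 1
      (\<lambda>ns. bounded_least (ns ! 0) (\<lambda>n. prod_encode (pfst (ns ! 0), n) = ns ! 0))"
    by (intro computability_intros computability_leaf_intros computable_fun_prod_encode
      computable_fun_pfst) auto
  moreover have "bounded_least a (\<lambda>n. prod_encode (pfst a, n) = a) = psnd a" for a
  proof (rule bounded_least_eqI)
    show "\<not> (prod_encode (pfst a, i) = a)" if "i < psnd a" for i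
      using that by (metis nat_neq_iff psnd_encode)
  qed (simp_all add: psnd_le)
  ultimately show "computable_fun x 1 (\<lambda>ns. psnd (ns ! 0))"
    by simp
qed

definition seq_tl :: "nat \<Rightarrow> nat" where "seq_tl n = list_encode (tl (list_decode n))"
definition seq_len :: "nat \<Rightarrow> nat" where "seq_len n = length (list_decode n)"

text \<open>Beyond the end \<open>nth\<close> is unspecified, and a computable function needs a
  definite value there.\<close>

definition seq_nth :: "nat \<Rightarrow> nat \<Rightarrow> nat" where
  "seq_nth n i = (if i < seq_len n then list_decode n ! i else 0)"

lemma seq_tl_eq: "seq_tl n = (if n = 0 then 0 else psnd (n - 1))"
  by (cases n) (auto simp: seq_tl_def psnd_def split: prod.split)

lemma computable_fun_seq_tl: "computable_fun x k f \<Longrightarrow> computable_fun x k (\<lambda>ns. seq_tl (f ns))"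
  unfolding seq_tl_eq by (intro computability_intros computable_fun_psnd)

definition seq_drop :: "nat \<Rightarrow> nat \<Rightarrow> nat" where
  "seq_drop n i = rec_nat n (\<lambda>_ v. seq_tl v) i"

lemma seq_drop: "list_decode (seq_drop n i) = drop i (list_decode n)"
  by (induction i) (auto simp: seq_drop_def seq_tl_def drop_Suc tl_drop)

lemma computable_fun_seq_drop:
  "computable_fun x k f \<Longrightarrow> computable_fun x k g \<Longrightarrow> computable_fun x k (\<lambda>ns. seq_drop (f ns) (g ns))"
  unfolding seq_drop_def
  by (intro computable_fun_rec computable_fun_seq_tl computable_fun_nth) auto

lemma list_decode_eq_Nil: "list_decode n = [] \<longleftrightarrow> n = 0"
  by (metis list_decode.simps(1) list_decode_inverse)

lemma length_list_decode_le: "length (list_decode n) \<le> n"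
proof (induction n rule: list_decode.induct)
  case (2 n)
  then show ?case
    using psnd_le[of n] by (force simp: psnd_def split: prod.split)
qed simp

lemma computable_fun_seq_len: "computable_fun x k f \<Longrightarrow> computable_fun x k (\<lambda>ns. seq_len (f ns))"
proof (rule computable_fun_lift1[where h = seq_len])
  \<comment> \<open>Code 0 is the empty list, so the length is the first number of drops that leads
    to 0; it never exceeds the code itself.\<close>
  have "computable_fun x 1 (\<lambda>ns. bounded_least (ns ! 0) (\<lambda>i. seq_drop (ns ! 0) i = 0))"
    by (intro computability_intros computability_leaf_intros computable_fun_seq_drop) auto
  moreover have "bounded_least a (\<lambda>i. seq_drop a i = 0) = seq_len a" for a
    by (rule bounded_least_eqI)
      (auto simp: seq_len_def seq_drop length_list_decode_le simp flip: list_decode_eq_Nil)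
  ultimately show "computable_fun x 1 (\<lambda>ns. seq_len (ns ! 0))"
    by simp
qed

lemma seq_nth_eq:
  "seq_nth n i = (if i < seq_len n then pfst (seq_drop n i - 1) else 0)"
proof (cases "i < seq_len n")
  case True
  then have "hd (list_decode (seq_drop n i)) = list_decode n ! i"
    by (simp add: seq_drop seq_len_def hd_drop_conv_nth)
  moreover have "seq_drop n i \<noteq> 0"
    using True by (metis drop_eq_Nil leD list_decode_eq_Nil seq_drop seq_len_def)
  then obtain m where m: "seq_drop n i = Suc m"
    using not0_implies_Suc by blast
  ultimately show ?thesis
    using True by (auto simp: seq_nth_def pfst_def split: prod.splits)
qed (simp add: seq_nth_def)

lemma computable_fun_seq_nth:
  "computable_fun x k f \<Longrightarrow> computable_fun x k g \<Longrightarrow> computable_fun x k (\<lambda>ns. seq_nth (f ns) (g ns))"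
  unfolding seq_nth_eq
  by (intro computability_intros computable_fun_pfst computable_fun_seq_len computable_fun_seq_drop)

section \<open>Turing reducibility\<close>

primrec subst_query :: "code \<Rightarrow> code \<Rightarrow> code" where
  "subst_query q Zero = Zero"
| "subst_query q Succ = Succ"
| "subst_query q Query = q"
| "subst_query q (Proj i) = Proj i"
| "subst_query q (Comp c ds) = Comp (subst_query q c) (map (subst_query q) ds)"
| "subst_query q (PrimRec c d) = PrimRec (subst_query q c) (subst_query q d)"
| "subst_query q (Mu c) = Mu (subst_query q c)"

lemma eval_subst_query:
  assumes q: "\<And>n. eval x q [n] (of_bool (y n))"
  shows "eval y c ns v \<Longrightarrow> eval x (subst_query q c) ns v"
proof (induction rule: eval.induct)
  case (5 ns ds vs c w)
  then show ?case
    by (auto intro!: eval.intros(5)[where vs = vs] simp: list_all2_conv_all_nth)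
next
  case (8 c n ns)
  then show ?case
    by (auto intro!: eval.intros(8))
next
  case (3 n)
  then show ?case
    using q[of n] by simp
qed (auto intro: eval.intros)

definition turing_le :: "cantor \<Rightarrow> cantor \<Rightarrow> bool" where
  "turing_le y x \<longleftrightarrow> decidable_pred x 1 (\<lambda>ns. y (ns ! 0))"

lemma computable_rel_from_turing:
  assumes yx: "turing_le y x" and R: "computable_rel_from y R"
  shows "computable_rel_from x R"
proof -
  obtain q where "\<And>ns. length ns = 1 \<Longrightarrow> eval x q ns (of_bool (y (ns ! 0)))"
    using yx by (auto simp: turing_le_def decidable_pred_def computable_fun_def)
  from this[of "[_]"] have q: "eval x q [n] (of_bool (y n))" for n
    by simp
  obtain c where "\<And>m n. eval y c [m, n] (of_bool ((m, n) \<in> R))"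
    using R by (auto simp: computable_rel_from_def)
  then show ?thesis
    unfolding computable_rel_from_def using eval_subst_query[OF q] by blast
qed

lemma computable_rel_from_iff:
  "computable_rel_from x R \<longleftrightarrow> decidable_pred x 2 (\<lambda>ns. (ns ! 0, ns ! 1) \<in> R)" (is "?l \<longleftrightarrow> ?r")
proof
  assume ?l
  then obtain c where c: "\<And>m n. eval x c [m, n] (of_bool ((m, n) \<in> R))"
    by (auto simp: computable_rel_from_def)
  have "eval x c ns (of_bool ((ns ! 0, ns ! 1) \<in> R))" if ns: "length ns = 2" for ns
  proof -
    obtain m n where "ns = [m, n]"
      using ns by (cases ns rule: remdups_adj.cases) auto
    then show ?thesis
      using c[of m n] by simp
  qed
  then show ?r
    unfolding decidable_pred_def computable_fun_def by blast
next
  assume ?r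
  then obtain c where "\<And>ns. length ns = 2 \<Longrightarrow> eval x c ns (of_bool ((ns ! 0, ns ! 1) \<in> R))"
    by (auto simp: decidable_pred_def computable_fun_def)
  from this[of "[_, _]"] have "eval x c [m, n] (of_bool ((m, n) \<in> R))" for m n
    by simp
  then show ?l
    unfolding computable_rel_from_def by blast
qed

lemma computable_rel_from_underS:
  assumes "computable_rel_from x R"
  shows "computable_rel_from x (Restr R (underS R a))"
proof -
  have R: "decidable_pred x k (\<lambda>ns. (f ns, g ns) \<in> R)"
    if "computable_fun x k f" "computable_fun x k g" for k f g
    using decidable_pred_lift2[of x "\<lambda>m n. (m, n) \<in> R"] assms that by (simp add: computable_rel_from_iff)
  show ?thesis
    unfolding computable_rel_from_iff underS_def Int_iff mem_Sigma_iff mem_Collect_eq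
    by (intro computability_intros R) auto
qed

text \<open>A smaller ordinal is the type of the part of \<open>R\<close> strictly below one point,
  and a program may contain that point as a constant.\<close>

lemma has_computable_presentation_less:
  assumes \<alpha>: "has_computable_presentation x \<alpha>" and less: "\<beta> < \<alpha>"
  shows "has_computable_presentation x \<beta>"
proof -
  obtain R where R: "Well_order R" "order_type R = \<alpha>" "computable_rel_from x R"
    using \<alpha> by (auto simp: has_computable_presentation_def)
  obtain S where S: "Well_order S" "\<beta> = order_type S"
    by (rule countable_ordinal_cases)
  have "S <o R"
    using less R S by (simp add: less_order_type_iff[symmetric])
  then obtain a where a: "a \<in> Field R" "S =o Restr R (underS R a)"
    using ordLess_iff_ordIso_Restr[OF R(1) S(1)] by blast
  then have W: "Well_order (Restr R (underS R a))"
    using R(1) by (simp add: Well_order_Restr)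
  then have "order_type (Restr R (underS R a)) = \<beta>"
    using a S by (simp add: order_type_eq_iff ordIso_symmetric)
  then show ?thesis
    unfolding has_computable_presentation_def using W computable_rel_from_underS[OF R(3)] by blast
qed

section \<open>\<open>omega1\<close> as the bound of the presentable ordinals, and its behaviour
  under joins\<close>

lemma has_computable_presentation_iff: "has_computable_presentation x \<alpha> \<longleftrightarrow> \<alpha> < omega1 x"
  using has_computable_presentation_less[of x \<alpha> "omega1 x"] omega1_not_presentable[of x]
    less_omega1_presentable[of \<alpha> x] by (cases \<alpha> "omega1 x" rule: linorder_cases) auto

text \<open>The presentable ordinals form an initial segment, so comparing the least missing
  ordinals amounts to comparing the segments.\<close>

lemma omega1_le_iff:
  "omega1 x \<le> omega1 y \<longleftrightarrow>
    (\<forall>\<alpha>. has_computable_presentation x \<alpha> \<longrightarrow> has_computable_presentation y \<alpha>)"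
  unfolding has_computable_presentation_iff
  by (metis less_irrefl linorder_not_le order.strict_trans2)

lemma omega1_turing_mono: "turing_le y x \<Longrightarrow> omega1 y \<le> omega1 x"
  unfolding omega1_le_iff has_computable_presentation_def using computable_rel_from_turing by blast

lemma omega1_le_join: "omega1 x \<le> omega1 (x \<oplus>\<^sub>T y)" "omega1 y \<le> omega1 (x \<oplus>\<^sub>T y)"
proof -
  have "decidable_pred (x \<oplus>\<^sub>T y) 1 (\<lambda>ns. (x \<oplus>\<^sub>T y) (2 * ns ! 0))"
    "decidable_pred (x \<oplus>\<^sub>T y) 1 (\<lambda>ns. (x \<oplus>\<^sub>T y) (Suc (2 * ns ! 0)))"
    by (intro computability_intros; simp)+
  moreover have "(x \<oplus>\<^sub>T y) (2 * n) = x n" "(x \<oplus>\<^sub>T y) (Suc (2 * n)) = y n" for n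
    by (simp_all add: join_def)
  ultimately show "omega1 x \<le> omega1 (x \<oplus>\<^sub>T y)" "omega1 y \<le> omega1 (x \<oplus>\<^sub>T y)"
    by (auto intro!: omega1_turing_mono simp: turing_le_def)
qed

text \<open>With this identity the relation without a parameter becomes the relative one over a
  constant.\<close>

lemma omega1_join_False: "omega1 ((\<lambda>_. False) \<oplus>\<^sub>T x) = omega1 x"
proof (rule antisym)
  have "decidable_pred x 1 (\<lambda>ns. \<not> even (ns ! 0) \<and> x (ns ! 0 div 2))"
    by (intro computability_intros decidable_pred_even computable_fun_div) auto
  then have "turing_le ((\<lambda>_. False) \<oplus>\<^sub>T x) x"
    unfolding turing_le_def by (rule decidable_pred_cong) (simp add: join_def)
  then show "omega1 ((\<lambda>_. False) \<oplus>\<^sub>T x) \<le> omega1 x"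
    by (rule omega1_turing_mono)
qed (rule omega1_le_join)

text \<open>Bit \<open>k\<close> of \<open>x\<close>, \<open>y\<close>, \<open>z\<close> is at
  places \<open>2k\<close>, \<open>4k + 1\<close>, \<open>4k + 3\<close> of the left join and at
  \<open>4k\<close>, \<open>4k + 2\<close>, \<open>2k + 1\<close> of the right one, so the residue
  of an address modulo 4 decides how a query is translated. The lemma lets the generic half of a
  point be regarded as generic over the parameter joined with the other half.\<close>

lemma omega1_join_assoc: "omega1 (x \<oplus>\<^sub>T (y \<oplus>\<^sub>T z)) = omega1 ((x \<oplus>\<^sub>T y) \<oplus>\<^sub>T z)"
proof (rule antisym; rule omega1_turing_mono)
  let ?l = "x \<oplus>\<^sub>T (y \<oplus>\<^sub>T z)" and ?r = "(x \<oplus>\<^sub>T y) \<oplus>\<^sub>T z"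
  have "decidable_pred ?r 1 (\<lambda>ns. (even (ns ! 0) \<and> ?r (2 * ns ! 0)) \<or>
      (\<not> even (ns ! 0) \<and> even (ns ! 0 div 2) \<and> ?r (Suc (ns ! 0))) \<or>
      (\<not> even (ns ! 0) \<and> \<not> even (ns ! 0 div 2) \<and> ?r (ns ! 0 div 2)))"
    by (intro computability_intros decidable_pred_even computable_fun_div) auto
  then show "turing_le ?l ?r"
    unfolding turing_le_def
  proof (rule decidable_pred_cong)
    have "((even n \<and> ?r (2 * n)) \<or> (\<not> even n \<and> even (n div 2) \<and> ?r (Suc n)) \<or>
        (\<not> even n \<and> \<not> even (n div 2) \<and> ?r (n div 2))) = ?l n" for n
    proof -
      have "n = 4 * (n div 4) \<or> n = 4 * (n div 4) + 1 \<or> n = 4 * (n div 4) + 2 \<or> n = 4 * (n div 4) + 3"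
        by presburger
      then obtain k where "n = 4 * k \<or> n = 4 * k + 1 \<or> n = 4 * k + 2 \<or> n = 4 * k + 3"
        by blast
      moreover have "(4 * k + 2) div 2 = Suc (2 * k)" "(4 * k + 3) div 2 = Suc (2 * k)"
        "(7 + 8 * k) div 2 = Suc (2 * Suc (2 * k))"
        by simp_all
      ultimately show ?thesis
        by (elim disjE) (simp_all add: join_def)
    qed
    then show "((even (ns ! 0) \<and> ?r (2 * ns ! 0)) \<or>
      (\<not> even (ns ! 0) \<and> even (ns ! 0 div 2) \<and> ?r (Suc (ns ! 0))) \<or>
      (\<not> even (ns ! 0) \<and> \<not> even (ns ! 0 div 2) \<and> ?r (ns ! 0 div 2))) = ?l (ns ! 0)" for ns
      by blast
  qed
  have "decidable_pred ?l 1 (\<lambda>ns. (even (ns ! 0) \<and> even (ns ! 0 div 2) \<and> ?l (ns ! 0 div 2)) \<or>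
      (even (ns ! 0) \<and> \<not> even (ns ! 0 div 2) \<and> ?l (ns ! 0 - 1)) \<or>
      (\<not> even (ns ! 0) \<and> ?l (Suc (2 * ns ! 0))))"
    by (intro computability_intros decidable_pred_even computable_fun_div) auto
  then show "turing_le ?r ?l"
    unfolding turing_le_def
  proof (rule decidable_pred_cong)
    have "((even n \<and> even (n div 2) \<and> ?l (n div 2)) \<or> (even n \<and> \<not> even (n div 2) \<and> ?l (n - 1)) \<or>
        (\<not> even n \<and> ?l (Suc (2 * n)))) = ?r n" for n
    proof -
      have "n = 4 * (n div 4) \<or> n = 4 * (n div 4) + 1 \<or> n = 4 * (n div 4) + 2 \<or> n = 4 * (n div 4) + 3"
        by presburger
      then obtain k where "n = 4 * k \<or> n = 4 * k + 1 \<or> n = 4 * k + 2 \<or> n = 4 * k + 3"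
        by blast
      moreover have "(4 * k + 2) div 2 = Suc (2 * k)" "(4 * k + 3) div 2 = Suc (2 * k)"
        "(7 + 8 * k) div 2 = Suc (2 * Suc (2 * k))"
        by simp_all
      ultimately show ?thesis
        by (elim disjE) (simp_all add: join_def)
    qed
    then show "((even (ns ! 0) \<and> even (ns ! 0 div 2) \<and> ?l (ns ! 0 div 2)) \<or>
      (even (ns ! 0) \<and> \<not> even (ns ! 0 div 2) \<and> ?l (ns ! 0 - 1)) \<or>
      (\<not> even (ns ! 0) \<and> ?l (Suc (2 * ns ! 0)))) = ?r (ns ! 0)" for ns
      by blast
  qed
qed

section \<open>Finite conditions and the use principle\<close>

text \<open>
  A natural number \<open>q\<close> is read as a Cohen condition: \<open>prod_encode (k, N)\<close> prescribes the binary
  digits of \<open>N\<close> as the values on \<open>{..<k}\<close>.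
\<close>

definition clen :: "nat \<Rightarrow> nat" where "clen q = pfst q"
definition cbit :: "nat \<Rightarrow> nat \<Rightarrow> bool" where "cbit q i \<longleftrightarrow> odd (psnd q div 2 ^ i)"

text \<open>The first argument is the stronger condition. This is only a preorder: digits beyond the
  stated length are ignored, so one condition has many codes.\<close>

definition cext :: "nat \<Rightarrow> nat \<Rightarrow> bool" where
  "cext q' q \<longleftrightarrow> clen q \<le> clen q' \<and> (\<forall>i<clen q. cbit q' i = cbit q i)"

definition cmatch :: "nat \<Rightarrow> cantor \<Rightarrow> bool" where
  "cmatch q g \<longleftrightarrow> (\<forall>i<clen q. g i = cbit q i)"

lemma ex_condition: "\<exists>q. clen q = k \<and> (\<forall>i<k. cbit q i = b i)"
proof -
  have "\<exists>N::nat. \<forall>i<k. odd (N div 2 ^ i) = b i" for k and b :: cantor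
  proof (induction k arbitrary: b)
    case (Suc k)
    obtain N :: nat where N: "\<forall>i<k. odd (N div 2 ^ i) = b (Suc i)"
      using Suc[of "\<lambda>i. b (Suc i)"] by blast
    have "odd ((of_bool (b 0) + 2 * N) div 2 ^ i) = b i" if "i < Suc k" for i
    proof (cases i)
      case 0
      then show ?thesis by simp
    next
      case (Suc j)
      have "(of_bool (b 0) + 2 * N) div 2 ^ Suc j = (of_bool (b 0) + 2 * N) div 2 div 2 ^ j"
        unfolding power_Suc by (rule div_mult2_eq)
      also have "(of_bool (b 0) + 2 * N) div 2 = N"
        by simp
      finally show ?thesis
        using N that Suc by simp
    qed
    then show ?case by blast
  qed simp
  then obtain N :: nat where "\<forall>i<k. odd (N div 2 ^ i) = b i"
    by blast
  then show ?thesis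
    by (intro exI[of _ "prod_encode (k, N)"]) (simp add: clen_def cbit_def)
qed

lemma cext_refl [simp]: "cext q q"
  by (simp add: cext_def)

lemma cext_trans: "cext r q \<Longrightarrow> cext q p \<Longrightarrow> cext r p"
  by (auto simp: cext_def)

lemma cmatch_cext: "cmatch q g \<Longrightarrow> cext q p \<Longrightarrow> cmatch p g"
  by (auto simp: cext_def cmatch_def)

lemma cext_if_cmatch: "cmatch q g \<Longrightarrow> cmatch p g \<Longrightarrow> clen p \<le> clen q \<Longrightarrow> cext q p"
  by (auto simp: cext_def cmatch_def)

lemma ex_cmatch: "\<exists>q. cmatch q g \<and> clen q = k"
  using ex_condition[of k g] by (metis cmatch_def)

lemma common_cmatch:
  assumes "cmatch q g" "cmatch p g"
  obtains r where "cmatch r g" "cext r q" "cext r p"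
  using assms cext_if_cmatch by (metis cext_refl nle_le)

lemma ex_cmatch_long:
  assumes "cmatch q g"
  obtains r where "cmatch r g" "cext r q" "k \<le> clen r"
  using ex_cmatch[of g k] common_cmatch[OF assms] by (metis cext_def)

text \<open>Conditions matching the same point are ordered by length, so finitely many persistent
  facts can be gathered in a single one. It serves the argument lists of compositions and the stages
  of a search.\<close>

lemma common_cmatch_finite:
  assumes "finite S" and "\<And>s. s \<in> S \<Longrightarrow> \<exists>q. cmatch q g \<and> P s q"
    and mono: "\<And>s q r. s \<in> S \<Longrightarrow> P s q \<Longrightarrow> cext r q \<Longrightarrow> P s r"
  shows "\<exists>q. cmatch q g \<and> (\<forall>s\<in>S. P s q)"
  using assms
proof (induction S rule: finite_induct)
  case empty
  then show ?case
    using ex_cmatch by auto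
next
  case (insert a S)
  have "\<exists>q. cmatch q g \<and> (\<forall>s\<in>S. P s q)"
    by (rule insert.IH) (use insert.prems in \<open>blast+\<close>)
  then obtain q where q: "cmatch q g" "\<forall>s\<in>S. P s q"
    by blast
  obtain p where p: "cmatch p g" "P a p"
    using insert.prems(1) by auto
  obtain r where r: "cmatch r g" "cext r q" "cext r p"
    using common_cmatch[OF q(1) p(1)] .
  have "P s r" if "s \<in> insert a S" for s
    using that p(2) q(2) r(2,3) insert.prems(2) by blast
  with r(1) show ?case by blast
qed

lemma computable_fun_clen: "computable_fun x k f \<Longrightarrow> computable_fun x k (\<lambda>ns. clen (f ns))"
  unfolding clen_def by (rule computable_fun_pfst)

lemma decidable_pred_cbit:
  "computable_fun x k f \<Longrightarrow> computable_fun x k g \<Longrightarrow> decidable_pred x k (\<lambda>ns. cbit (f ns) (g ns))"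
  unfolding cbit_def
  by (intro computability_intros decidable_pred_even computable_fun_div computable_fun_psnd)

lemma decidable_pred_cext:
  "computable_fun x k f \<Longrightarrow> computable_fun x k g \<Longrightarrow> decidable_pred x k (\<lambda>ns. cext (f ns) (g ns))"
proof (rule decidable_pred_lift2[where h = cext])
  show "decidable_pred x 2 (\<lambda>ns. cext (ns ! 0) (ns ! 1))"
    unfolding cext_def
    by (intro computability_intros computable_fun_clen decidable_pred_cbit computability_leaf_intros)
      auto
qed

section \<open>The use principle, by recursion on codes\<close>

lemma computable_fun_compose':
  assumes "computable_fun x m h" "\<forall>f\<in>set fs. computable_fun x k f" "length fs = m"
    and "\<And>ns. length ns = k \<Longrightarrow> map (\<lambda>f. f ns) fs = F ns"
  shows "computable_fun x k (\<lambda>ns. h (F ns))"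
  using computable_fun_compose[OF assms(1-3)] by (rule computable_fun_cong) (simp add: assms(4))

text \<open>
  \<open>A q ns = Suc v\<close> means that \<open>q\<close> suffices to see, within \<open>clen q\<close> steps of every unbounded search,
  that the computation with oracle \<open>x \<oplus>\<^sub>T g\<close> returns \<open>v\<close>; \<open>A q ns = 0\<close> means undecided.
\<close>

definition approximates ::
  "cantor \<Rightarrow> nat \<Rightarrow> code \<Rightarrow> (nat \<Rightarrow> nat list \<Rightarrow> nat) \<Rightarrow> bool" where
  "approximates x k c A \<longleftrightarrow>
     computable_fun x (Suc k) (\<lambda>ns. A (ns ! 0) (drop 1 ns)) \<and>
     (\<forall>q q' ns v. length ns = k \<longrightarrow> cext q' q \<longrightarrow> A q ns = Suc v \<longrightarrow> A q' ns = Suc v) \<and>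
     (\<forall>g ns v. length ns = k \<longrightarrow> eval (x \<oplus>\<^sub>T g) c ns v \<longleftrightarrow> (\<exists>q. cmatch q g \<and> A q ns = Suc v))"

lemma approximatesD:
  assumes "approximates x k c A"
  shows "computable_fun x (Suc k) (\<lambda>ns. A (ns ! 0) (drop 1 ns))"
    and "length ns = k \<Longrightarrow> cext q' q \<Longrightarrow> A q ns = Suc v \<Longrightarrow> A q' ns = Suc v"
    and "length ns = k \<Longrightarrow> eval (x \<oplus>\<^sub>T g) c ns v \<longleftrightarrow> (\<exists>q. cmatch q g \<and> A q ns = Suc v)"
  using assms unfolding approximates_def by blast+

inductive_cases eval_ZeroE: "eval x Zero ns v"
inductive_cases eval_SuccE: "eval x Succ ns v"
inductive_cases eval_QueryE: "eval x Query ns v"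
inductive_cases eval_ProjE: "eval x (Proj i) ns v"
inductive_cases eval_CompE: "eval x (Comp c ds) ns v"
inductive_cases eval_PrimRecE: "eval x (PrimRec c d) ns v"
inductive_cases eval_PrimRec0E: "eval x (PrimRec c d) (0 # ns) v"
inductive_cases eval_PrimRecSucE: "eval x (PrimRec c d) (Suc n # ns) v"
inductive_cases eval_MuE: "eval x (Mu c) ns v"

text \<open>Covers codes applied to the wrong number of arguments, which have no value for any
  oracle.\<close>

lemma approximates_never:
  assumes "\<And>g ns v. length ns = k \<Longrightarrow> \<not> eval (x \<oplus>\<^sub>T g) c ns v"
  shows "approximates x k c (\<lambda>q ns. 0)"
  unfolding approximates_def using assms by (auto intro: computable_fun_const)

lemma approximates_Zero: "approximates x k Zero (\<lambda>q ns. 1)"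
  unfolding approximates_def using ex_cmatch
  by (auto intro: computable_fun_const eval.intros elim: eval_ZeroE)

lemma approximates_Proj:
  assumes "i < k"
  shows "approximates x k (Proj i) (\<lambda>q ns. Suc (ns ! i))"
proof -
  have "computable_fun x (Suc k) (\<lambda>ns. Suc (drop 1 ns ! i))"
    using assms by (intro computability_intros computability_leaf_intros) auto
  then show ?thesis
    unfolding approximates_def using assms ex_cmatch
    by (auto intro: eval.intros elim: eval_ProjE)
qed

lemma approximates_Succ: "approximates x 1 Succ (\<lambda>q ns. Suc (Suc (ns ! 0)))"
proof -
  have "computable_fun x (Suc 1) (\<lambda>ns. Suc (Suc (drop 1 ns ! 0)))"
    by (intro computability_intros computability_leaf_intros) auto
  then show ?thesis
    unfolding approximates_def using ex_cmatch
    by (auto simp: length_Suc_conv intro: eval.intros elim: eval_SuccE)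
qed

text \<open>Even places of the join belong to \<open>x\<close>, which the approximation may query in
  full; odd places belong to \<open>g\<close>, known only below \<open>clen q\<close>.\<close>

lemma approximates_Query:
  "approximates x 1 Query (\<lambda>q ns. if even (ns ! 0) then Suc (of_bool (x (ns ! 0 div 2)))
     else if ns ! 0 div 2 < clen q then Suc (of_bool (cbit q (ns ! 0 div 2))) else 0)"
    (is "approximates x 1 Query ?A")
  unfolding approximates_def
proof (intro conjI allI impI)
  show "computable_fun x (Suc 1) (\<lambda>ns. ?A (ns ! 0) (drop 1 ns))"
    by (intro computability_intros computability_leaf_intros decidable_pred_even computable_fun_div
        computable_fun_clen decidable_pred_cbit) auto
next
  fix q q' v and ns :: "nat list"
  assume "length ns = 1" "cext q' q" "?A q ns = Suc v"
  then show "?A q' ns = Suc v"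
    by (auto simp: cext_def split: if_splits)
next
  fix g v and ns :: "nat list"
  assume "length ns = 1"
  then obtain n where ns: "ns = [n]"
    by (auto simp: length_Suc_conv)
  have "eval (x \<oplus>\<^sub>T g) Query [n] v \<longleftrightarrow> v = of_bool ((x \<oplus>\<^sub>T g) n)"
    using eval.intros(3)[of "x \<oplus>\<^sub>T g" n] by (blast elim: eval_QueryE)
  also have "\<dots> \<longleftrightarrow> (\<exists>q. cmatch q g \<and> ?A q [n] = Suc v)"
    \<comment> \<open>The length \<open>Suc (n div 2)\<close> just includes the queried
      place.\<close>
    using ex_cmatch[of g "Suc (n div 2)"] by (auto simp: join_def cmatch_def split: if_splits)
  finally show "eval (x \<oplus>\<^sub>T g) Query ns v \<longleftrightarrow> (\<exists>q. cmatch q g \<and> ?A q ns = Suc v)"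
    by (simp only: ns)
qed

lemma decidable_pred_Ball_list:
  "(\<And>d. d \<in> set ds \<Longrightarrow> decidable_pred x k (P d)) \<Longrightarrow> decidable_pred x k (\<lambda>ns. \<forall>d\<in>set ds. P d ns)"
proof (induction ds)
  case Nil
  have "decidable_pred x k (\<lambda>ns. 0 = (0::nat))"
    by (intro computability_intros)
  then show ?case by simp
next
  case (Cons d ds)
  have "decidable_pred x k (\<lambda>ns. P d ns \<and> (\<forall>d\<in>set ds. P d ns))"
    using Cons by (intro computability_intros) auto
  then show ?case by simp
qed

lemma approximates_Comp:
  assumes c: "approximates x (length ds) c C" and ds: "\<And>d. d \<in> set ds \<Longrightarrow> approximates x k d (D d)"
  shows "approximates x k (Comp c ds)
     (\<lambda>q ns. if \<forall>d\<in>set ds. D d q ns \<noteq> 0 then C q (map (\<lambda>d. D d q ns - 1) ds) else 0)"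
    (is "approximates x k _ ?A")
  unfolding approximates_def
proof (intro conjI allI impI)
  have D: "computable_fun x (Suc k) (\<lambda>ns. D d (ns ! 0) (drop 1 ns))" if "d \<in> set ds" for d
    using approximatesD(1)[OF ds[OF that]] .
  let ?fs = "(\<lambda>ns. ns ! 0) # map (\<lambda>d ns. D d (ns ! 0) (drop 1 ns) - 1) ds"
  have fs: "\<forall>f\<in>set ?fs. computable_fun x (Suc k) f"
    by (auto intro!: computability_intros D[unfolded One_nat_def])
  have "computable_fun x (Suc k)
      (\<lambda>ns. if \<forall>d\<in>set ds. D d (ns ! 0) (drop 1 ns) \<noteq> 0
        then C (map (\<lambda>f. f ns) ?fs ! 0) (drop 1 (map (\<lambda>f. f ns) ?fs)) else 0)"
    by (intro computable_fun_if decidable_pred_Ball_list computability_intros D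
        computable_fun_compose[OF approximatesD(1)[OF c] fs]) auto
  then show "computable_fun x (Suc k) (\<lambda>ns. ?A (ns ! 0) (drop 1 ns))"
    by (rule computable_fun_cong) (auto simp: comp_def)
next
  fix q q' v and ns :: "nat list"
  assume ns: "length ns = k" and q: "cext q' q" and A: "?A q ns = Suc v"
  \<comment> \<open>Values already decided never change, so the argument list handed to
    \<open>C\<close> stays the same.\<close>
  have *: "D d q' ns = D d q ns" if "d \<in> set ds" for d
    using approximatesD(2)[OF ds[OF that] ns q, of "D d q ns - 1"] A that by (auto split: if_splits)
  then have "map (\<lambda>d. D d q' ns - 1) ds = map (\<lambda>d. D d q ns - 1) ds"
    by simp
  then show "?A q' ns = Suc v"
    using A * approximatesD(2)[OF c _ q, of "map (\<lambda>d. D d q ns - 1) ds" v]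
    by (auto split: if_splits cong: map_cong)
next
  fix g v and ns :: "nat list"
  assume ns: "length ns = k"
  show "eval (x \<oplus>\<^sub>T g) (Comp c ds) ns v \<longleftrightarrow> (\<exists>q. cmatch q g \<and> ?A q ns = Suc v)"
  proof
    assume "eval (x \<oplus>\<^sub>T g) (Comp c ds) ns v"
    then obtain vs where vs: "list_all2 (\<lambda>d. eval (x \<oplus>\<^sub>T g) d ns) ds vs" and v: "eval (x \<oplus>\<^sub>T g) c vs v"
      by (rule eval_CompE)
    from vs have len: "length ds = length vs"
      by (simp add: list_all2_lengthD)
    have "\<exists>q. cmatch q g \<and> (\<forall>i\<in>{..<length ds}. D (ds ! i) q ns = Suc (vs ! i))"
    proof (rule common_cmatch_finite)
      fix i
      assume i: "i \<in> {..<length ds}"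
      then have "eval (x \<oplus>\<^sub>T g) (ds ! i) ns (vs ! i)"
        using vs by (auto simp: list_all2_conv_all_nth)
      then show "\<exists>q. cmatch q g \<and> D (ds ! i) q ns = Suc (vs ! i)"
        using i approximatesD(3)[OF ds[of "ds ! i"] ns] by simp
    next
      fix i q r
      assume "i \<in> {..<length ds}" "D (ds ! i) q ns = Suc (vs ! i)" "cext r q"
      then show "D (ds ! i) r ns = Suc (vs ! i)"
        using approximatesD(2)[OF ds[of "ds ! i"] ns] by simp
    qed simp
    then obtain q where q: "cmatch q g" "\<forall>i<length ds. D (ds ! i) q ns = Suc (vs ! i)"
      by auto
    obtain p where p: "cmatch p g" "C p vs = Suc v"
      using v approximatesD(3)[OF c] len by auto
    obtain r where r: "cmatch r g" "cext r q" "cext r p"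
      using common_cmatch[OF q(1) p(1)] by blast
    have D: "\<forall>i<length ds. D (ds ! i) r ns = Suc (vs ! i)"
      using q(2) r(2) approximatesD(2)[OF ds ns] by (meson nth_mem)
    then have "map (\<lambda>d. D d r ns - 1) ds = vs"
      using len by (intro nth_equalityI) auto
    moreover have "\<forall>d\<in>set ds. D d r ns \<noteq> 0"
      using D by (metis in_set_conv_nth nat.distinct(1))
    moreover have "C r vs = Suc v"
      using approximatesD(2)[OF c _ r(3) p(2)] len by simp
    ultimately show "\<exists>q. cmatch q g \<and> ?A q ns = Suc v"
      using r(1) by (intro exI[of _ r]) simp
  next
    assume "\<exists>q. cmatch q g \<and> ?A q ns = Suc v"
    then obtain q where q: "cmatch q g" "\<forall>d\<in>set ds. D d q ns \<noteq> 0"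
      "C q (map (\<lambda>d. D d q ns - 1) ds) = Suc v"
      by (auto split: if_splits)
    have "eval (x \<oplus>\<^sub>T g) d ns (D d q ns - 1)" if "d \<in> set ds" for d
      using approximatesD(3)[OF ds[OF that] ns] q that by force
    then have "list_all2 (\<lambda>d. eval (x \<oplus>\<^sub>T g) d ns) ds (map (\<lambda>d. D d q ns - 1) ds)"
      by (simp add: list_all2_conv_all_nth)
    moreover have "eval (x \<oplus>\<^sub>T g) c (map (\<lambda>d. D d q ns - 1) ds) v"
      using approximatesD(3)[OF c] q by auto
    ultimately show "eval (x \<oplus>\<^sub>T g) (Comp c ds) ns v"
      by (rule eval.intros)
  qed
qed

text \<open>The recursion runs on shifted values: 0 means undecided and is passed on by every later
  step, and \<open>v - 1\<close> is the decided value. The number of steps is an argument, so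
  \<open>q\<close> need not bound it.\<close>

lemma approximates_PrimRec:
  assumes c: "approximates x k c C" and d: "approximates x (Suc (Suc k)) d D"
  shows "approximates x (Suc k) (PrimRec c d)
     (\<lambda>q ns. rec_nat (C q (drop 1 ns)) (\<lambda>i v. if v = 0 then 0 else D q (i # (v - 1) # drop 1 ns)) (ns ! 0))"
    (is "approximates x _ _ ?A")
proof -
  define A where "A q n ns = rec_nat (C q ns) (\<lambda>i v. if v = 0 then 0 else D q (i # (v - 1) # ns)) n"
    for q n ns
  have A0: "A q 0 ns = C q ns" for q ns
    by (simp add: A_def)
  have ASuc: "A q (Suc n) ns = (if A q n ns = 0 then 0 else D q (n # (A q n ns - 1) # ns))" for q n ns
    by (simp add: A_def)
  have mono: "A q' n ns = Suc v" if "length ns = k" "cext q' q" "A q n ns = Suc v" for q q' n ns v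
    using that
  proof (induction n arbitrary: v)
    case 0
    then show ?case
      using approximatesD(2)[OF c] by (simp add: A0)
  next
    case (Suc n)
    then obtain w where "A q n ns = Suc w" "D q (n # w # ns) = Suc v"
      by (cases "A q n ns") (auto simp: ASuc)
    then show ?case
      using Suc approximatesD(2)[OF d, of "n # w # ns" q' q v] by (auto simp: ASuc)
  qed
  have ev: "eval (x \<oplus>\<^sub>T g) (PrimRec c d) (n # ns) v \<longleftrightarrow> (\<exists>q. cmatch q g \<and> A q n ns = Suc v)"
    if ns: "length ns = k" for g n ns v
  proof (induction n arbitrary: v)
    case 0
    have "eval (x \<oplus>\<^sub>T g) (PrimRec c d) (0 # ns) v \<longleftrightarrow> eval (x \<oplus>\<^sub>T g) c ns v"
      by (auto intro: eval.intros elim: eval_PrimRec0E)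
    then show ?case
      using approximatesD(3)[OF c ns] by (simp add: A0)
  next
    case (Suc n)
    have "eval (x \<oplus>\<^sub>T g) (PrimRec c d) (Suc n # ns) v \<longleftrightarrow>
        (\<exists>w. eval (x \<oplus>\<^sub>T g) (PrimRec c d) (n # ns) w \<and> eval (x \<oplus>\<^sub>T g) d (n # w # ns) v)"
      by (auto intro: eval.intros elim: eval_PrimRecSucE)
    also have "\<dots> \<longleftrightarrow> (\<exists>w. (\<exists>q. cmatch q g \<and> A q n ns = Suc w) \<and>
        (\<exists>q. cmatch q g \<and> D q (n # w # ns) = Suc v))"
      using Suc approximatesD(3)[OF d] ns by simp
    also have "\<dots> \<longleftrightarrow> (\<exists>w q. cmatch q g \<and> A q n ns = Suc w \<and> D q (n # w # ns) = Suc v)"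
      (is "?l \<longleftrightarrow> ?r")
    proof
      assume ?l
      then obtain w q p where w: "cmatch q g" "cmatch p g" "A q n ns = Suc w" "D p (n # w # ns) = Suc v"
        by blast
      obtain r where r: "cmatch r g" "cext r q" "cext r p"
        using common_cmatch[OF w(1,2)] .
      have "A r n ns = Suc w" "D r (n # w # ns) = Suc v"
        using mono[OF ns r(2) w(3)] approximatesD(2)[OF d _ r(3) w(4)] ns by auto
      with r(1) show ?r
        by blast
    qed blast
    also have "\<dots> \<longleftrightarrow> (\<exists>q. cmatch q g \<and> A q (Suc n) ns = Suc v)"
    proof -
      have "A q (Suc n) ns = Suc v \<longleftrightarrow> (\<exists>w. A q n ns = Suc w \<and> D q (n # w # ns) = Suc v)" for q
        by (cases "A q n ns") (auto simp: ASuc)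
      then show ?thesis by blast
    qed
    finally show ?case .
  qed
  have comp: "computable_fun x (Suc (Suc k)) (\<lambda>ns. A (ns ! 0) (ns ! 1) (drop 2 ns))"
    unfolding A_def
  proof (rule computable_fun_rec)
    let ?fs = "(\<lambda>ns. ns ! 0) # map (\<lambda>i ns. ns ! Suc (Suc i)) [0..<k]"
    have "computable_fun x (Suc (Suc k)) (\<lambda>ns. (\<lambda>ns. C (ns ! 0) (drop 1 ns)) (ns ! 0 # drop 2 ns))"
      by (rule computable_fun_compose'[OF approximatesD(1)[OF c], of ?fs])
        (auto intro!: computable_fun_nth nth_equalityI simp: nth_Cons')
    then show "computable_fun x (Suc (Suc k)) (\<lambda>ns. C (ns ! 0) (drop 2 ns))"
      by simp
    let ?fs = "(\<lambda>ns. ns ! 2) # (\<lambda>ns. ns ! 0) # (\<lambda>ns. ns ! 1 - 1) # map (\<lambda>i ns. ns ! (4 + i)) [0..<k]"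
    have "computable_fun x (Suc (Suc (Suc (Suc k))))
        (\<lambda>ns. (\<lambda>ns. D (ns ! 0) (drop 1 ns)) (ns ! 2 # ns ! 0 # (ns ! 1 - 1) # drop 4 ns))"
      by (rule computable_fun_compose'[OF approximatesD(1)[OF d], of ?fs])
        (auto intro!: computability_intros nth_equalityI simp: nth_Cons' simp del: One_nat_def)
    then have "computable_fun x (Suc (Suc (Suc (Suc k))))
        (\<lambda>ns. D (ns ! 2) (ns ! 0 # (ns ! 1 - 1) # drop 4 ns))"
      by simp
    then have "computable_fun x (Suc (Suc (Suc (Suc k))))
        (\<lambda>ns. if ns ! 1 = 0 then 0 else D (ns ! 2) (ns ! 0 # (ns ! 1 - 1) # drop 4 ns))"
      by (intro computability_intros) simp_all
    then show "computable_fun x (Suc (Suc (Suc (Suc k))))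
        (\<lambda>ns. if ns ! 1 = 0 then 0 else D (drop 2 ns ! 0) (ns ! 0 # (ns ! 1 - 1) # drop 2 (drop 2 ns)))"
      by (rule computable_fun_cong) simp
  qed (auto intro!: computable_fun_nth)
  show ?thesis
    unfolding approximates_def A_def[symmetric]
  proof (intro conjI allI impI)
    show "computable_fun x (Suc (Suc k)) (\<lambda>ns. A (ns ! 0) (drop 1 ns ! 0) (drop 1 (drop 1 ns)))"
      using comp by (rule computable_fun_cong) (simp add: numeral_2_eq_2)
  next
    fix q q' v and ns :: "nat list"
    assume "length ns = Suc k" "cext q' q" "A q (ns ! 0) (drop 1 ns) = Suc v"
    then show "A q' (ns ! 0) (drop 1 ns) = Suc v"
      using mono by (metis Suc_eq_plus1 add_diff_cancel_right' length_drop)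
  next
    fix g v and ns :: "nat list"
    assume "length ns = Suc k"
    then obtain n ms where "ns = n # ms" "length ms = k"
      by (auto simp: length_Suc_conv)
    then show "eval (x \<oplus>\<^sub>T g) (PrimRec c d) ns v \<longleftrightarrow> (\<exists>q. cmatch q g \<and> A q (ns ! 0) (drop 1 ns) = Suc v)"
      using ev by simp
  qed
qed

text \<open>With the shift, 1 is the value zero, larger numbers are positive values, and 0 is
  undecided. The search stops at the first value that is at most 1 and succeeds only if it is 1,
  since an undecided value may still turn out to be zero or never appear.\<close>

lemma approximates_Mu:
  assumes c: "approximates x (Suc k) c C"
  shows "approximates x k (Mu c)
     (\<lambda>q ns. if bounded_least (clen q) (\<lambda>n. C q (n # ns) \<le> 1) < clen q \<and>
          C q (bounded_least (clen q) (\<lambda>n. C q (n # ns) \<le> 1) # ns) = 1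
        then Suc (bounded_least (clen q) (\<lambda>n. C q (n # ns) \<le> 1)) else 0)"
    (is "approximates x _ _ ?A")
proof -
  have A: "?A q ns = Suc n \<longleftrightarrow> n < clen q \<and> C q (n # ns) = 1 \<and> (\<forall>m<n. 1 < C q (m # ns))"
    (is "?l \<longleftrightarrow> ?r") for q ns n
  proof
    let ?b = "bounded_least (clen q) (\<lambda>n. C q (n # ns) \<le> 1)"
    assume ?l
    then have n: "n = ?b" "n < clen q" "C q (n # ns) = 1"
      by (auto split: if_splits)
    have "1 < C q (m # ns)" if "m < n" for m
      using not_less_Least[of m "\<lambda>n. n = clen q \<or> C q (n # ns) \<le> 1"] that n(1)
      unfolding bounded_least_def by simp
    with n show ?r
      by simp
  next
    assume r: ?r
    then have "bounded_least (clen q) (\<lambda>n. C q (n # ns) \<le> 1) = n"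
      by (intro bounded_least_eqI) auto
    with r show ?l
      by simp
  qed
  show ?thesis
    unfolding approximates_def
  proof (intro conjI allI impI)
    let ?fs = "(\<lambda>ns. ns ! 1) # (\<lambda>ns. ns ! 0) # map (\<lambda>i ns. ns ! (2 + i)) [0..<k]"
    have "computable_fun x (Suc (Suc k))
        (\<lambda>ns. (\<lambda>ns. C (ns ! 0) (drop 1 ns)) (ns ! 1 # ns ! 0 # drop 2 ns))"
      by (rule computable_fun_compose'[OF approximatesD(1)[OF c], of ?fs])
        (auto intro!: computability_intros nth_equalityI simp: nth_Cons')
    then have C1: "computable_fun x (Suc (Suc k)) (\<lambda>ns. C (drop 1 ns ! 0) (ns ! 0 # drop 1 (drop 1 ns)))"
      by (rule computable_fun_cong) (simp add: numeral_2_eq_2)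
    have b: "computable_fun x (Suc k)
        (\<lambda>ns. bounded_least (clen (ns ! 0)) (\<lambda>n. C (ns ! 0) (n # drop 1 ns) \<le> 1))"
      by (intro computable_fun_bounded_least computable_fun_clen decidable_pred_le C1
          computable_fun_const computable_fun_nth) simp
    have C2: "computable_fun x (Suc k) (\<lambda>ns. C (ns ! 0) (f ns # drop 1 ns))"
      if f: "computable_fun x (Suc k) f" for f
    proof -
      let ?fs = "(\<lambda>ns. ns ! 0) # f # map (\<lambda>i ns. ns ! Suc i) [0..<k]"
      have "computable_fun x (Suc k)
          (\<lambda>ns. (\<lambda>ns. C (ns ! 0) (drop 1 ns)) (ns ! 0 # f ns # drop 1 ns))"
        using f by (intro computable_fun_compose'[OF approximatesD(1)[OF c], of ?fs])
          (auto intro!: computability_intros nth_equalityI simp: nth_Cons')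
      then show ?thesis by simp
    qed
    show "computable_fun x (Suc k) (\<lambda>ns. ?A (ns ! 0) (drop 1 ns))"
      by (intro computability_intros b computable_fun_clen C2) auto
  next
    fix q q' v and ns :: "nat list"
    assume ns: "length ns = k" and q: "cext q' q" and "?A q ns = Suc v"
    then have v: "v < clen q \<and> C q (v # ns) = 1 \<and> (\<forall>m<v. 1 < C q (m # ns))"
      by (intro iffD1[OF A])
    have "C q' (m # ns) = C q (m # ns)" if "m \<le> v" for m
      using approximatesD(2)[OF c _ q, of "m # ns" "C q (m # ns) - 1"] ns v that
      by (cases "m = v") (auto simp: le_less)
    then show "?A q' ns = Suc v"
      unfolding A using v q by (auto simp: cext_def)
  next
    fix g v and ns :: "nat list"
    assume ns: "length ns = k"
    have "eval (x \<oplus>\<^sub>T g) (Mu c) ns v \<longleftrightarrow>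
        (\<forall>m\<in>{..v}. \<exists>w. eval (x \<oplus>\<^sub>T g) c (m # ns) w \<and> (if m = v then w = 0 else 0 < w))"
      (is "_ \<longleftrightarrow> ?r")
    proof
      assume "eval (x \<oplus>\<^sub>T g) (Mu c) ns v"
      then show ?r
        by (rule eval_MuE) (auto simp: le_less, blast)
    next
      assume r: ?r
      show "eval (x \<oplus>\<^sub>T g) (Mu c) ns v"
      proof (rule eval.intros(8))
        show "eval (x \<oplus>\<^sub>T g) c (v # ns) 0"
          using r[rule_format, of v] by simp
        show "\<forall>m<v. \<exists>w>0. eval (x \<oplus>\<^sub>T g) c (m # ns) w"
        proof (intro allI impI)
          fix m
          assume "m < v"
          then show "\<exists>w>0. eval (x \<oplus>\<^sub>T g) c (m # ns) w"
            using r[rule_format, of m] by auto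
        qed
      qed
    qed
    also have "\<dots> \<longleftrightarrow>
        (\<forall>m\<in>{..v}. \<exists>q. cmatch q g \<and> (if m = v then C q (m # ns) = 1 else 1 < C q (m # ns)))"
    proof (intro ball_cong refl)
      fix m
      have eq: "eval (x \<oplus>\<^sub>T g) c (m # ns) w \<longleftrightarrow> (\<exists>q. cmatch q g \<and> C q (m # ns) = Suc w)" for w
        using approximatesD(3)[OF c, of "m # ns"] ns by simp
      have "(\<exists>w. eval (x \<oplus>\<^sub>T g) c (m # ns) w \<and> 0 < w) \<longleftrightarrow> (\<exists>q. cmatch q g \<and> 1 < C q (m # ns))"
        unfolding eq
      proof
        assume "\<exists>q. cmatch q g \<and> 1 < C q (m # ns)"
        then obtain q where "cmatch q g" "1 < C q (m # ns)"
          by blast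
        then show "\<exists>w. (\<exists>q. cmatch q g \<and> C q (m # ns) = Suc w) \<and> 0 < w"
          by (intro exI[of _ "C q (m # ns) - 1"]) auto
      qed auto
      then show "(\<exists>w. eval (x \<oplus>\<^sub>T g) c (m # ns) w \<and> (if m = v then w = 0 else 0 < w)) \<longleftrightarrow>
          (\<exists>q. cmatch q g \<and> (if m = v then C q (m # ns) = 1 else 1 < C q (m # ns)))"
        using eq[of 0] by (cases "m = v") simp_all
    qed
    also have "\<dots> \<longleftrightarrow> (\<exists>q. cmatch q g \<and> ?A q ns = Suc v)"
    proof
      assume l: "\<forall>m\<in>{..v}. \<exists>q. cmatch q g \<and> (if m = v then C q (m # ns) = 1 else 1 < C q (m # ns))"
      have "\<exists>q. cmatch q g \<and> (\<forall>m\<in>{..v}. if m = v then C q (m # ns) = 1 else 1 < C q (m # ns))"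
      proof (rule common_cmatch_finite)
        fix m q r
        assume "if m = v then C q (m # ns) = 1 else 1 < C q (m # ns)" and "cext r q"
        then show "if m = v then C r (m # ns) = 1 else 1 < C r (m # ns)"
          using approximatesD(2)[OF c, of "m # ns" r q "C q (m # ns) - 1"] ns by (auto split: if_splits)
      qed (use l in auto)
      then obtain q where q: "cmatch q g"
        "\<And>m. m \<le> v \<Longrightarrow> if m = v then C q (m # ns) = 1 else 1 < C q (m # ns)"
        by auto
      \<comment> \<open>Besides deciding the values, the condition must be longer than
        \<open>v\<close>, because \<open>clen\<close> bounds the search.\<close>
      obtain r where r: "cmatch r g" "cext r q" "Suc v \<le> clen r"
        using ex_cmatch_long[OF q(1)] by blast
      have "C r (m # ns) = C q (m # ns)" if "m \<le> v" for m
        using approximatesD(2)[OF c _ r(2), of "m # ns" "C q (m # ns) - 1"] ns q(2)[OF that]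
        by (auto split: if_splits)
      then show "\<exists>q. cmatch q g \<and> ?A q ns = Suc v"
        unfolding A using r q(2) by (intro exI[of _ r]) (metis less_imp_le_nat less_irrefl order_refl Suc_le_eq)
    next
      assume "\<exists>q. cmatch q g \<and> ?A q ns = Suc v"
      then show "\<forall>m\<in>{..v}. \<exists>q. cmatch q g \<and> (if m = v then C q (m # ns) = 1 else 1 < C q (m # ns))"
        unfolding A by (auto simp: le_less)
    qed
    finally show "eval (x \<oplus>\<^sub>T g) (Mu c) ns v \<longleftrightarrow> (\<exists>q. cmatch q g \<and> ?A q ns = Suc v)" .
  qed
qed

lemma ex_approximates: "\<exists>A. approximates x k c A"
proof (induction c arbitrary: k)
  case Zero
  show ?case using approximates_Zero by blast
next
  case Succ
  show ?case
  proof (cases "k = 1")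
    case True
    then show ?thesis using approximates_Succ by blast
  next
    case False
    then have "approximates x k Succ (\<lambda>q ns. 0)"
      by (intro approximates_never) (auto elim: eval_SuccE)
    then show ?thesis by blast
  qed
next
  case Query
  show ?case
  proof (cases "k = 1")
    case True
    then show ?thesis using approximates_Query by blast
  next
    case False
    then have "approximates x k Query (\<lambda>q ns. 0)"
      by (intro approximates_never) (auto elim: eval_QueryE)
    then show ?thesis by blast
  qed
next
  case (Proj i)
  show ?case
  proof (cases "i < k")
    case True
    then show ?thesis using approximates_Proj by blast
  next
    case False
    then have "approximates x k (Proj i) (\<lambda>q ns. 0)"
      by (intro approximates_never) (auto elim: eval_ProjE)
    then show ?thesis by blast
  qed
next
  case (Comp c ds)
  obtain C where "approximates x (length ds) c C"
    using Comp(1) by blast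
  moreover have "\<forall>d\<in>set ds. \<exists>A. approximates x k d A"
    using Comp(2) by blast
  then obtain D where "\<And>d. d \<in> set ds \<Longrightarrow> approximates x k d (D d)"
    by (meson bchoice)
  ultimately show ?case
    using approximates_Comp by blast
next
  case (PrimRec c d)
  show ?case
  proof (cases k)
    case 0
    then have "approximates x k (PrimRec c d) (\<lambda>q ns. 0)"
      by (intro approximates_never) (auto elim: eval_PrimRecE)
    then show ?thesis by blast
  next
    case (Suc j)
    then show ?thesis
      using PrimRec approximates_PrimRec by blast
  qed
next
  case (Mu c)
  then show ?case
    using approximates_Mu by blast
qed

text \<open>A decidable form of forcing a pair into the relation computed by \<open>c\<close>: it
  holds as soon as the finite information is sufficient. The diagonal is removed because descending
  sequences and ranks concern the strict part.\<close>

lemma ex_forcing_relation: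
  fixes c :: code
  obtains F where "decidable_pred x 3 (\<lambda>ns. F (ns ! 0) (ns ! 1) (ns ! 2))"
    and "\<And>q r m n. F q m n \<Longrightarrow> cext r q \<Longrightarrow> F r m n"
    and "\<And>g m n. eval (x \<oplus>\<^sub>T g) c [m, n] 1 \<and> m \<noteq> n \<longleftrightarrow> (\<exists>q. cmatch q g \<and> F q m n)"
proof -
  obtain A where A: "approximates x 2 c A"
    using ex_approximates by blast
  \<comment> \<open>The value 2 is the decided output 1.\<close>
  define F where "F q m n \<longleftrightarrow> A q [m, n] = 2 \<and> m \<noteq> n" for q m n
  show ?thesis
  proof (rule that[of F])
    have "computable_fun x 3 (\<lambda>ns. (\<lambda>ns. A (ns ! 0) (drop 1 ns)) [ns ! 0, ns ! 1, ns ! 2])"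
      by (rule computable_fun_compose'[of _ 3 _ "[\<lambda>ns. ns ! 0, \<lambda>ns. ns ! 1, \<lambda>ns. ns ! 2]"])
        (use approximatesD(1)[OF A] in \<open>auto intro!: computable_fun_nth simp: numeral_3_eq_3 numeral_2_eq_2\<close>)
    then have "computable_fun x 3 (\<lambda>ns. A (ns ! 0) [ns ! 1, ns ! 2])"
      by simp
    then show "decidable_pred x 3 (\<lambda>ns. F (ns ! 0) (ns ! 1) (ns ! 2))"
      unfolding F_def by (intro computability_intros) auto
    show "F r m n" if "F q m n" "cext r q" for q r m n
      using that approximatesD(2)[OF A, of "[m, n]" r q 1] by (auto simp: F_def)
    show "eval (x \<oplus>\<^sub>T g) c [m, n] 1 \<and> m \<noteq> n \<longleftrightarrow> (\<exists>q. cmatch q g \<and> F q m n)" for g m n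
      using approximatesD(3)[OF A, of "[m, n]" g 1] by (auto simp: F_def numeral_2_eq_2)
  qed
qed

section \<open>The Kleene--Brouwer order\<close>

fun kb_le :: "nat list \<Rightarrow> nat list \<Rightarrow> bool" where
  "kb_le s [] = True"
| "kb_le [] (b # t) = False"
| "kb_le (a # s) (b # t) = (a < b \<or> a = b \<and> kb_le s t)"

lemma kb_le_refl: "kb_le s s"
  by (induction s) auto

lemma kb_le_antisym: "kb_le s t \<Longrightarrow> kb_le t s \<Longrightarrow> s = t"
proof (induction s t rule: kb_le.induct)
  case (1 s)
  then show ?case by (cases s) auto
qed auto

lemma kb_le_trans: "kb_le s t \<Longrightarrow> kb_le t u \<Longrightarrow> kb_le s u"
proof (induction s t arbitrary: u rule: kb_le.induct)
  case (1 s)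
  then show ?case by (cases u) auto
next
  case (3 a s b t)
  then show ?case by (cases u) auto
qed auto

lemma kb_le_total: "kb_le s t \<or> kb_le t s"
  by (induction s t rule: kb_le.induct) auto

lemma kb_le_append [simp]: "kb_le (u @ s) (u @ t) = kb_le s t"
  by (induction u) auto

lemma kb_le_append1: "kb_le (s @ u) s"
  using kb_le_append[of s u "[]"] by simp

text \<open>All quantifiers are bounded by lengths, the shape from which decidability is read
  off.\<close>

lemma kb_le_iff_nth:
  "kb_le s t \<longleftrightarrow> (length t \<le> length s \<and> (\<forall>i<length t. s ! i = t ! i)) \<or>
     (\<exists>i<length s. i < length t \<and> (\<forall>j<i. s ! j = t ! j) \<and> s ! i < t ! i)"
proof (induction s t rule: kb_le.induct)
  case (3 a s b t)
  show ?case
    by (simp add: 3 Ex_less_Suc2 All_less_Suc2) auto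
qed auto

definition tree_has_path :: "(nat list \<Rightarrow> bool) \<Rightarrow> bool" where
  "tree_has_path T \<longleftrightarrow> (\<exists>f. \<forall>n. T (map f [0..<n]))"

text \<open>Along an infinite chain the nodes extend one another, so together they form a path. The
  chain may start above the root, so prefixes of its nodes have to lie in the tree as well.\<close>

lemma wf_tree_children:
  assumes closed: "\<And>s u. T (s @ u) \<Longrightarrow> T s" and no_path: "\<not> tree_has_path T"
  shows "wf {(s @ [v], s) | s v. T (s @ [v])}"
  unfolding wf_iff_no_infinite_down_chain
proof
  assume "\<exists>S. \<forall>i. (S (Suc i), S i) \<in> {(s @ [v], s) | s v. T (s @ [v])}"
  then obtain S where "\<forall>i. (S (Suc i), S i) \<in> {(s @ [v], s) | s v. T (s @ [v])}" ..
  then have S: "\<exists>v. S (Suc i) = S i @ [v] \<and> T (S (Suc i))" for i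
    by (auto dest!: spec[of _ i])
  have len: "length (S i) = length (S 0) + i" for i
  proof (induction i)
    case (Suc i)
    then show ?case using S[of i] by auto
  qed simp
  have ext: "\<exists>u. S (i + k) = S i @ u" for i k
  proof (induction k)
    case (Suc k)
    then show ?case using S[of "i + k"] by auto
  qed simp
  \<comment> \<open>Whatever the first node is, \<open>S (Suc j)\<close> has more than
    \<open>j\<close> entries.\<close>
  define f where "f j = S (Suc j) ! j" for j
  have "T (map f [0..<n])" for n
  proof -
    have "map f [0..<n] = take n (S (Suc n))"
    proof (rule nth_equalityI)
      fix j
      assume "j < length (map f [0..<n])"
      then have j: "j < n" by simp
      then obtain u where "S (Suc n) = S (Suc j) @ u"
        using ext[of "Suc j" "n - j"] by auto
      then show "map f [0..<n] ! j = take n (S (Suc n)) ! j"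
        using j len[of "Suc j"] by (simp add: f_def nth_append)
    qed (simp add: len[of "Suc n"])
    moreover have "T (S (Suc n))"
      using S by blast
    ultimately show ?thesis
      using closed by (metis append_take_drop_id)
  qed
  with no_path show False
    by (auto simp: tree_has_path_def)
qed

text \<open>Induction along the tree, for sets of nodes extending a fixed \<open>s\<close>. Those
  passing through the leftmost child of \<open>s\<close> that is met come first, and
  \<open>s\<close> itself comes last, since extensions precede their prefixes.\<close>

lemma kb_minimum:
  assumes closed: "\<And>s u. T (s @ u) \<Longrightarrow> T s" and no_path: "\<not> tree_has_path T"
    and Q: "Q \<noteq> {}" "\<And>t. t \<in> Q \<Longrightarrow> T t"
  shows "\<exists>m\<in>Q. \<forall>t\<in>Q. kb_le m t"
proof -
  have wf: "wf {(s @ [v], s) | s v. T (s @ [v])}"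
    using closed no_path by (rule wf_tree_children)
  have "Q \<noteq> {} \<Longrightarrow> (\<And>t. t \<in> Q \<Longrightarrow> T t \<and> (\<exists>u. t = s @ u)) \<Longrightarrow> \<exists>m\<in>Q. \<forall>t\<in>Q. kb_le m t" for s Q
  proof (induction s arbitrary: Q rule: wf_induct_rule[OF wf])
    case (1 s)
    show ?case
    proof (cases "Q = {s}")
      case True
      then show ?thesis by (simp add: kb_le_refl)
    next
      case False
      then obtain t where "t \<in> Q" "t \<noteq> s"
        using 1(2) by blast
      then obtain v u where "s @ v # u \<in> Q"
        using 1(3) by (metis append_Nil2 list.exhaust)
      then have ex: "\<exists>v u. s @ v # u \<in> Q"
        by blast
      define v where "v = (LEAST v. \<exists>u. s @ v # u \<in> Q)"
      obtain u0 where u0: "s @ v # u0 \<in> Q"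
        unfolding v_def using LeastI_ex[OF ex] by blast
      have least: "v \<le> w" if "s @ w # u \<in> Q" for w u
        unfolding v_def using that by (blast intro: Least_le)
      let ?Q = "{t \<in> Q. \<exists>u. t = s @ v # u}"
      have "T (s @ [v])"
        using 1(3)[OF u0] closed[of "s @ [v]" u0] by simp
      then have "\<exists>m\<in>?Q. \<forall>t\<in>?Q. kb_le m t"
        using u0 1(3) by (intro 1(1)[of "s @ [v]"]) auto
      then obtain m where m: "m \<in> ?Q" "\<forall>t\<in>?Q. kb_le m t"
        by blast
      have "kb_le m t" if t: "t \<in> Q" for t
      proof -
        obtain u where u: "t = s @ u"
          using 1(3)[OF t] by blast
        show ?thesis
        proof (cases u)
          case Nil
          then show ?thesis using u m(1) by (auto simp: kb_le_append1)
        next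
          case (Cons w u')
          then show ?thesis
            using u m t least[of w u'] by (cases "w = v") auto
        qed
      qed
      with m(1) show ?thesis by blast
    qed
  qed
  from this[of Q "[]"] Q show ?thesis
    by auto
qed

definition kb_rel :: "(nat list \<Rightarrow> bool) \<Rightarrow> nat rel" where
  "kb_rel T = {(a, b). T (list_decode a) \<and> T (list_decode b) \<and> kb_le (list_decode a) (list_decode b)}"

lemma Field_kb_rel: "Field (kb_rel T) = {a. T (list_decode a)}"
  by (auto simp: kb_rel_def Field_def kb_le_refl)

lemma Well_order_kb_rel:
  assumes closed: "\<And>s u. T (s @ u) \<Longrightarrow> T s" and no_path: "\<not> tree_has_path T"
  shows "Well_order (kb_rel T)"
proof -
  have lin: "Linear_order (kb_rel T)"
    unfolding linear_order_on_def partial_order_on_def preorder_on_def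
  proof (intro conjI)
    show "refl_on (Field (kb_rel T)) (kb_rel T)"
      unfolding Field_kb_rel by (auto simp: refl_on_def kb_rel_def kb_le_refl)
    show "trans (kb_rel T)"
      by (auto simp: trans_def kb_rel_def intro: kb_le_trans)
    show "antisym (kb_rel T)"
    proof (rule antisymI)
      fix a b
      assume "(a, b) \<in> kb_rel T" "(b, a) \<in> kb_rel T"
      then have "list_decode a = list_decode b"
        by (auto simp: kb_rel_def intro: kb_le_antisym)
      then show "a = b"
        by (rule injD[OF inj_list_decode])
    qed
    show "total_on (Field (kb_rel T)) (kb_rel T)"
      unfolding Field_kb_rel using kb_le_total by (auto simp: total_on_def kb_rel_def)
  qed (auto simp: Field_def)
  have "wf (kb_rel T - Id)"
  proof (rule wfI_min)
    fix x and Q :: "nat set"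
    assume x: "x \<in> Q"
    show "\<exists>z\<in>Q. \<forall>y. (y, z) \<in> kb_rel T - Id \<longrightarrow> y \<notin> Q"
    proof (cases "\<exists>a\<in>Q. T (list_decode a)")
      case False
      then show ?thesis using x by (auto simp: kb_rel_def)
    next
      case True
      let ?Q = "list_decode ` {a \<in> Q. T (list_decode a)}"
      have "\<exists>m\<in>?Q. \<forall>t\<in>?Q. kb_le m t"
        using True by (intro kb_minimum[of T, OF closed no_path]) auto
      then obtain a where a: "a \<in> Q" "T (list_decode a)"
        "\<And>b. b \<in> Q \<Longrightarrow> T (list_decode b) \<Longrightarrow> kb_le (list_decode a) (list_decode b)"
        by blast
      have "b \<notin> Q" if "(b, a) \<in> kb_rel T - Id" for b
      proof
        assume "b \<in> Q"
        then have "list_decode a = list_decode b"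
          using that a by (auto simp: kb_rel_def intro: kb_le_antisym)
        then have "a = b"
          by (rule injD[OF inj_list_decode])
        with that show False by simp
      qed
      with a(1) show ?thesis by blast
    qed
  qed
  with lin show ?thesis
    by (simp add: well_order_on_def)
qed

lemma decidable_pred_kb_le:
  assumes "computable_fun x k f" "computable_fun x k g"
  shows "decidable_pred x k (\<lambda>ns. kb_le (list_decode (f ns)) (list_decode (g ns)))"
  using assms
proof (rule decidable_pred_lift2[rotated])
  have "decidable_pred x 2 (\<lambda>ns.
      (seq_len (ns ! 1) \<le> seq_len (ns ! 0) \<and> (\<forall>i<seq_len (ns ! 1). seq_nth (ns ! 0) i = seq_nth (ns ! 1) i)) \<or>
      (\<exists>i<seq_len (ns ! 0). i < seq_len (ns ! 1) \<and> (\<forall>j<i. seq_nth (ns ! 0) j = seq_nth (ns ! 1) j) \<and>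
        seq_nth (ns ! 0) i < seq_nth (ns ! 1) i))"
    by (intro computability_intros computability_leaf_intros computable_fun_seq_len
        computable_fun_seq_nth) auto
  then show "decidable_pred x 2 (\<lambda>ns. kb_le (list_decode (ns ! 0)) (list_decode (ns ! 1)))"
  proof (rule decidable_pred_cong)
    have "(seq_len n \<le> seq_len m \<and> (\<forall>i<seq_len n. seq_nth m i = seq_nth n i)) \<or>
      (\<exists>i<seq_len m. i < seq_len n \<and> (\<forall>j<i. seq_nth m j = seq_nth n j) \<and> seq_nth m i < seq_nth n i)
      \<longleftrightarrow> kb_le (list_decode m) (list_decode n)" for m n
      unfolding kb_le_iff_nth seq_nth_def seq_len_def by (auto; fastforce?)
    then show "((seq_len (ns ! 1) \<le> seq_len (ns ! 0) \<and> (\<forall>i<seq_len (ns ! 1). seq_nth (ns ! 0) i = seq_nth (ns ! 1) i)) \<or>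
      (\<exists>i<seq_len (ns ! 0). i < seq_len (ns ! 1) \<and> (\<forall>j<i. seq_nth (ns ! 0) j = seq_nth (ns ! 1) j) \<and>
        seq_nth (ns ! 0) i < seq_nth (ns ! 1) i)) = kb_le (list_decode (ns ! 0)) (list_decode (ns ! 1))" for ns
      by blast
  qed
qed

lemma computable_rel_from_kb_rel:
  assumes "decidable_pred x 1 (\<lambda>ns. T (list_decode (ns ! 0)))"
  shows "computable_rel_from x (kb_rel T)"
  unfolding computable_rel_from_iff kb_rel_def mem_Collect_eq case_prod_conv
  by (intro decidable_pred_conj decidable_pred_kb_le decidable_pred_lift1[OF assms] computable_fun_nth)
    auto

section \<open>Strategies forcing a descending sequence\<close>

text \<open>
  A strategy is a function \<open>f\<close> on positions of a Banach--Mazur game; \<open>f j\<close> codes a condition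
  together with a number.  Position \<open>0\<close> is the opening move, and \<open>Suc (prod_encode (i, e))\<close> is the
  position where the opponent answers position \<open>i\<close> by the condition \<open>e\<close>: there the strategy has to
  extend \<open>e\<close> and to force its new number below that of position \<open>i\<close>.
\<close>

definition strategy_ok :: "(nat \<Rightarrow> nat \<Rightarrow> nat \<Rightarrow> bool) \<Rightarrow> nat \<Rightarrow> (nat \<Rightarrow> nat) \<Rightarrow> nat \<Rightarrow> bool" where
  "strategy_ok F p f j \<longleftrightarrow>
     (j = 0 \<longrightarrow> cext (pfst (f 0)) p) \<and>
     (j \<noteq> 0 \<longrightarrow> cext (psnd (j - 1)) (pfst (f (pfst (j - 1)))) \<longrightarrow>
        cext (pfst (f j)) (psnd (j - 1)) \<and>
        F (pfst (f j)) (psnd (f j)) (psnd (f (pfst (j - 1)))))"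

definition strategy_tree :: "(nat \<Rightarrow> nat \<Rightarrow> nat \<Rightarrow> bool) \<Rightarrow> nat \<Rightarrow> nat list \<Rightarrow> bool" where
  "strategy_tree F p s \<longleftrightarrow> (\<forall>j<length s. strategy_ok F p (nth s) j)"

text \<open>A position other than the opening refers only to itself and to the smaller position
  \<open>pfst (j - 1)\<close>, so legality is visible on finite initial parts of a strategy.\<close>

lemma strategy_ok_cong:
  "(\<And>i. i \<le> j \<Longrightarrow> f i = g i) \<Longrightarrow> strategy_ok F p f j = strategy_ok F p g j"
  using pfst_le[of "j - 1"] by (auto simp: strategy_ok_def)

lemma strategy_tree_append:
  "strategy_tree F p (s @ [v]) \<longleftrightarrow> strategy_tree F p s \<and> strategy_ok F p (nth (s @ [v])) (length s)"
proof -
  have "strategy_ok F p (nth (s @ [v])) j = strategy_ok F p (nth s) j" if "j < length s" for j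
    using that by (intro strategy_ok_cong) (simp add: nth_append)
  then show ?thesis
    by (auto simp: strategy_tree_def less_Suc_eq)
qed

lemma strategy_tree_closed: "strategy_tree F p (s @ u) \<Longrightarrow> strategy_tree F p s"
  by (induction u rule: rev_induct) (auto simp: strategy_tree_append simp flip: append_assoc)

lemma strategy_tree_path_iff: "tree_has_path (strategy_tree F p) \<longleftrightarrow> (\<exists>f. \<forall>j. strategy_ok F p f j)"
proof -
  have "(\<forall>n. strategy_tree F p (map f [0..<n])) \<longleftrightarrow> (\<forall>j. strategy_ok F p f j)" for f
  proof -
    have "strategy_ok F p (nth (map f [0..<n])) j = strategy_ok F p f j" if "j < n" for n j
      using that by (intro strategy_ok_cong) simp
    then have "strategy_tree F p (map f [0..<n]) \<longleftrightarrow> (\<forall>j<n. strategy_ok F p f j)" for n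
      by (simp add: strategy_tree_def)
    then show ?thesis
      by blast
  qed
  then show ?thesis
    by (simp add: tree_has_path_def)
qed

lemma decidable_pred_strategy_tree:
  assumes F: "decidable_pred x 3 (\<lambda>ns. F (ns ! 0) (ns ! 1) (ns ! 2))"
  shows "decidable_pred x 1 (\<lambda>ns. strategy_tree F p (list_decode (ns ! 0)))"
proof -
  have "decidable_pred x 1 (\<lambda>ns. \<forall>j<seq_len (ns ! 0). strategy_ok F p (seq_nth (ns ! 0)) j)"
    unfolding strategy_ok_def
    by (intro computability_intros computability_leaf_intros computable_fun_seq_len
        computable_fun_seq_nth computable_fun_pfst computable_fun_psnd decidable_pred_cext
        decidable_pred_lift3[OF F]) auto
  moreover have "strategy_ok F p (seq_nth n) j = strategy_ok F p (nth (list_decode n)) j"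
    if "j < seq_len n" for j n
    using that by (intro strategy_ok_cong) (simp add: seq_nth_def)
  ultimately show ?thesis
    by (simp add: strategy_tree_def seq_len_def)
qed

text \<open>\<open>forced_rank F lt a q n\<close>: the condition \<open>q\<close> forces the rank of \<open>n\<close> to be at most \<open>a\<close>.\<close>

inductive forced_rank ::
  "(nat \<Rightarrow> nat \<Rightarrow> nat \<Rightarrow> bool) \<Rightarrow> ('i \<Rightarrow> 'i \<Rightarrow> bool) \<Rightarrow> 'i \<Rightarrow> nat \<Rightarrow> nat \<Rightarrow> bool"
  for F lt where
  "(\<And>r m. cext r q \<Longrightarrow> F r m n \<Longrightarrow> \<exists>s b. cext s r \<and> lt b a \<and> forced_rank F lt b s m) \<Longrightarrow>
     forced_rank F lt a q n"

lemma forced_rank_mono: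
  assumes "transp lt" "forced_rank F lt b q n" "lt b a"
  shows "forced_rank F lt a q n"
  using assms(2)
proof cases
  case 1
  show ?thesis
  proof (rule forced_rank.intros)
    fix r m
    assume "cext r q" "F r m n"
    then obtain s b' where "cext s r" "lt b' b" "forced_rank F lt b' s m"
      using 1 by blast
    then show "\<exists>s b. cext s r \<and> lt b a \<and> forced_rank F lt b s m"
      using transpD[OF assms(1) _ assms(3)] by blast
  qed
qed

section \<open>Forced ranks in the Kleene--Brouwer order of the strategy tree\<close>

definition kb_less :: "(nat list \<Rightarrow> bool) \<Rightarrow> nat list \<Rightarrow> nat list \<Rightarrow> bool" where
  "kb_less T s t \<longleftrightarrow> T s \<and> T t \<and> kb_le s t \<and> s \<noteq> t"

lemma transp_kb_less: "transp (kb_less T)"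
  by (rule transpI) (auto simp: kb_less_def intro: kb_le_trans dest: kb_le_antisym)

text \<open>If no position of \<open>s\<close> had such a bound, one more move could be added so
  that still none has, contradicting the induction along the tree. The move is dictated by the next
  position: where the opponent's condition \<open>e\<close> fails to force the bound
  \<open>s\<close> for the number of position \<open>i\<close>, this failure hands over a condition
  and a smaller number, which is precisely a legal answer. The partial strategies themselves are the
  bounds.\<close>

lemma strategy_tree_forced_rank:
  assumes no_path: "\<not> tree_has_path (strategy_tree F p)"
  defines "T \<equiv> strategy_tree F p"
  assumes "T s" "s \<noteq> []"
  shows "\<exists>j<length s. \<exists>q. cext q (pfst (s ! j)) \<and> forced_rank F (kb_less T) s q (psnd (s ! j))"
proof -
  have wf: "wf {(s @ [v], s) | s v. T (s @ [v])}"
    unfolding T_def using strategy_tree_closed no_path by (rule wf_tree_children)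
  show ?thesis
    using assms(3,4)
  proof (induction s rule: wf_induct_rule[OF wf])
    case (1 s)
    let ?B = "forced_rank F (kb_less T)"
    show ?case
    proof (rule ccontr)
      assume "\<not> ?case"
      then have fail: "\<not> ?B s q (psnd (s ! j))" if "j < length s" "cext q (pfst (s ! j))" for j q
        using that by blast
      \<comment> \<open>An extension precedes its prefix, so bounds found for \<open>s @ [v]\<close>
        are also bounds for \<open>s\<close>.\<close>
      have less: "kb_less T (s @ [v]) s" if "T (s @ [v])" for v
        using that 1(2) by (simp add: kb_less_def kb_le_append1)
      have IH: "\<exists>j<Suc (length s). \<exists>q. cext q (pfst ((s @ [v]) ! j)) \<and> ?B (s @ [v]) q (psnd ((s @ [v]) ! j))"
        if "T (s @ [v])" for v
        using 1(1)[of "s @ [v]"] that by (auto simp: T_def)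
      \<comment> \<open>The bound supplied by the induction must sit at the new position, the old
        ones having none.\<close>
      have last: "\<exists>q. cext q (pfst v) \<and> ?B (s @ [v]) q (psnd v)" if v: "T (s @ [v])" for v
      proof -
        obtain j q where jq: "j < Suc (length s)" "cext q (pfst ((s @ [v]) ! j))"
          "?B (s @ [v]) q (psnd ((s @ [v]) ! j))"
          using IH[OF v] by blast
        then have "?B s q (psnd ((s @ [v]) ! j))"
          using forced_rank_mono[OF transp_kb_less _ less[OF v]] by blast
        then have "\<not> j < length s"
          using fail[of j q] jq(2) by (auto simp: nth_append)
        with jq show ?thesis
          by (auto simp: less_Suc_eq)
      qed
      define j where "j = length s"
      define i e where "i = pfst (j - 1)" and "e = psnd (j - 1)"
      \<comment> \<open>As \<open>s\<close> is nonempty, the next position is not the opening move,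
        and its parent is among the entries of \<open>s\<close>.\<close>
      have j: "j \<noteq> 0" "i < j"
        using 1(3) pfst_le[of "j - 1"] by (cases s; auto simp: j_def i_def less_Suc_eq_le)+
      show False
      proof (cases "cext e (pfst (s ! i))")
        case False
        \<comment> \<open>The opponent's answer is illegal, so any entry is allowed here; repeating
          \<open>s ! i\<close> moves the bound at the new position back to position
          \<open>i\<close>.\<close>
        have "T (s @ [s ! i])"
          using 1(2) j False unfolding T_def strategy_tree_append
          by (auto simp: strategy_ok_def nth_append j_def i_def e_def)
        then obtain q where "cext q (pfst (s ! i))" "?B (s @ [s ! i]) q (psnd (s ! i))"
          using last by blast
        then show False
          using fail[of i q] j forced_rank_mono[OF transp_kb_less _ less[OF \<open>T (s @ [s ! i])\<close>]]
          by (simp add: j_def)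
      next
        case True
        then have "\<not> ?B s e (psnd (s ! i))"
          using fail j by (simp add: j_def)
        \<comment> \<open>The failure unfolded: below \<open>r\<close> nothing smaller than
          \<open>s\<close> bounds \<open>m\<close>, yet \<open>r\<close> and \<open>m\<close> form a
          legal move.\<close>
        then obtain r m where r: "cext r e" "F r m (psnd (s ! i))"
          "\<And>q b. cext q r \<Longrightarrow> kb_less T b s \<Longrightarrow> \<not> ?B b q m"
          using forced_rank.intros[of e F "psnd (s ! i)" "kb_less T" s] by blast
        let ?v = "prod_encode (r, m)"
        have "T (s @ [?v])"
          using 1(2) j r(1,2) True unfolding T_def strategy_tree_append
          by (auto simp: strategy_ok_def nth_append j_def i_def e_def)
        then show False
          using last[of ?v] less r(3) by auto
      qed
    qed
qed
qed

section \<open>Cohen generic points\<close>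

definition cdense :: "nat set \<Rightarrow> bool" where
  "cdense D \<longleftrightarrow> (\<forall>q. \<exists>r\<in>D. cext r q)"

definition meets :: "cantor \<Rightarrow> nat set \<Rightarrow> bool" where
  "meets g D \<longleftrightarrow> (\<exists>q\<in>D. cmatch q g)"

text \<open>Comeagerness through dense sets of conditions, the form in which generic points are
  later constructed stage by stage.\<close>

definition comeagerly :: "(cantor \<Rightarrow> bool) \<Rightarrow> bool" where
  "comeagerly P \<longleftrightarrow>
     (\<exists>\<D>. countable \<D> \<and> (\<forall>D\<in>\<D>. cdense D) \<and> (\<forall>g. (\<forall>D\<in>\<D>. meets g D) \<longrightarrow> P g))"

lemma comeagerly_mono: "comeagerly P \<Longrightarrow> (\<And>g. P g \<Longrightarrow> Q g) \<Longrightarrow> comeagerly Q"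
  unfolding comeagerly_def by meson

lemma comeagerly_True [simp]: "comeagerly (\<lambda>g. True)"
  unfolding comeagerly_def by (intro exI[of _ "{}"]) auto

lemma comeagerly_all:
  assumes "\<And>i :: 'i :: countable. comeagerly (P i)"
  shows "comeagerly (\<lambda>g. \<forall>i. P i g)"
proof -
  have "\<forall>i. \<exists>\<D>. countable \<D> \<and> (\<forall>D\<in>\<D>. cdense D) \<and> (\<forall>g. (\<forall>D\<in>\<D>. meets g D) \<longrightarrow> P i g)"
    using assms unfolding comeagerly_def by blast
  then obtain \<D> where \<D>: "\<forall>i. countable (\<D> i) \<and> (\<forall>D\<in>\<D> i. cdense D) \<and>
      (\<forall>g. (\<forall>D\<in>\<D> i. meets g D) \<longrightarrow> P i g)"
    by (rule choice[THEN exE])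
  then have "countable (\<Union>i. \<D> i)"
    by simp
  moreover have "\<forall>D\<in>(\<Union>i. \<D> i). cdense D"
    using \<D> by blast
  moreover have "\<forall>i. P i g" if "\<forall>D\<in>(\<Union>i. \<D> i). meets g D" for g
    using \<D> that by simp
  ultimately show ?thesis
    unfolding comeagerly_def by blast
qed

lemma comeagerly_conj:
  assumes "comeagerly P" "comeagerly Q"
  shows "comeagerly (\<lambda>g. P g \<and> Q g)"
proof -
  have "comeagerly (\<lambda>g. \<forall>b. if b then P g else Q g)"
  proof (rule comeagerly_all)
    show "comeagerly (\<lambda>g. if b then P g else Q g)" for b
      using assms by (cases b) auto
  qed
  then show ?thesis
    by (rule comeagerly_mono) (metis (full_types))
qed

lemma comeagerly_imp: "(A \<Longrightarrow> comeagerly P) \<Longrightarrow> comeagerly (\<lambda>g. A \<longrightarrow> P g)"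
  by (cases A) auto

lemma comeagerly_meets: "cdense D \<Longrightarrow> comeagerly (\<lambda>g. meets g D)"
  unfolding comeagerly_def by (intro exI[of _ "{D}"]) auto

text \<open>Conditions incompatible with \<open>r\<close> are added to make the set dense
  everywhere; a point matching \<open>r\<close> cannot meet those.\<close>

lemma comeagerly_meets_below:
  assumes "\<And>q. cext q r \<Longrightarrow> \<exists>s\<in>D. cext s q"
  shows "comeagerly (\<lambda>g. cmatch r g \<longrightarrow> meets g D)"
proof -
  let ?D = "D \<union> {q. \<nexists>s. cext s q \<and> cext s r}"
  have "cdense ?D"
    unfolding cdense_def
  proof
    fix q
    show "\<exists>s\<in>?D. cext s q"
    proof (cases "\<exists>s. cext s q \<and> cext s r")
      case True
      then show ?thesis
        using assms cext_trans by blast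
    next
      case False
      then show ?thesis
        by (intro bexI[of _ q]) auto
    qed
  qed
  then have "comeagerly (\<lambda>g. meets g ?D)"
    by (rule comeagerly_meets)
  then show ?thesis
    by (rule comeagerly_mono) (metis (mono_tags, lifting) Un_iff common_cmatch meets_def mem_Collect_eq)
qed

section \<open>The Baire property of Borel sets and codes of functions\<close>

definition almost_open :: "cantor set \<Rightarrow> bool" where
  "almost_open A \<longleftrightarrow> (\<exists>V. comeagerly (\<lambda>g. g \<in> A \<longleftrightarrow> meets g V))"

lemma almost_open_open:
  assumes "open U"
  shows "almost_open U"
proof -
  have "g \<in> U \<longleftrightarrow> meets g {q. \<forall>h. cmatch q h \<longrightarrow> h \<in> U}" for g
  proof
    assume g: "g \<in> U"
    have "openin (product_topology (\<lambda>i. euclidean) UNIV) U"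
      using assms by (simp add: open_fun_def)
    from product_topology_open_contains_basis[OF this g] obtain X where
      X: "g \<in> (\<Pi>\<^sub>E i\<in>UNIV. X i)" "finite {i. X i \<noteq> topspace euclidean}" "(\<Pi>\<^sub>E i\<in>UNIV. X i) \<subseteq> U"
      by blast
    obtain k where k: "{i. X i \<noteq> UNIV} \<subseteq> {..<k}"
      using finite_nat_iff_bounded X(2) by auto
    obtain q where q: "cmatch q g" "clen q = k"
      using ex_cmatch by blast
    have "h \<in> U" if h: "cmatch q h" for h
    proof -
      have "h i \<in> X i" for i
      proof (cases "i < k")
        case True
        then have "h i = g i"
          using h q by (simp add: cmatch_def)
        then show ?thesis
          using X(1) by auto
      next
        case False
        then have "X i = UNIV"
          using k by auto
        then show ?thesis by simp
      qed
      then show ?thesis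
        using X(3) by auto
    qed
    with q show "meets g {q. \<forall>h. cmatch q h \<longrightarrow> h \<in> U}"
      by (auto simp: meets_def)
  qed (auto simp: meets_def)
  then have "comeagerly (\<lambda>g. g \<in> U \<longleftrightarrow> meets g {q. \<forall>h. cmatch q h \<longrightarrow> h \<in> U})"
    by (rule comeagerly_mono[OF comeagerly_True])
  then show ?thesis
    unfolding almost_open_def by (rule exI)
qed

text \<open>Off its boundary, the complement of an open set is its exterior, here given by the
  conditions incompatible with all of \<open>V\<close>; generic points avoid the boundary.\<close>

lemma almost_open_compl:
  assumes "almost_open A"
  shows "almost_open (- A)"
proof -
  obtain V where V: "comeagerly (\<lambda>g. g \<in> A \<longleftrightarrow> meets g V)"
    using assms by (auto simp: almost_open_def)
  let ?V = "{q. \<forall>r\<in>V. \<nexists>s. cext s q \<and> cext s r}"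
  have "cdense ({q. \<exists>r\<in>V. cext q r} \<union> ?V)"
    unfolding cdense_def
  proof
    fix q
    show "\<exists>s\<in>{q. \<exists>r\<in>V. cext q r} \<union> ?V. cext s q"
    proof (cases "q \<in> ?V")
      case False
      then show ?thesis by blast
    qed (auto intro: bexI[of _ q])
  qed
  then have "comeagerly (\<lambda>g. (g \<in> A \<longleftrightarrow> meets g V) \<and> meets g ({q. \<exists>r\<in>V. cext q r} \<union> ?V))"
    by (intro comeagerly_conj V comeagerly_meets)
  then have "comeagerly (\<lambda>g. g \<in> - A \<longleftrightarrow> meets g ?V)"
  proof (rule comeagerly_mono)
    fix g
    assume *: "(g \<in> A \<longleftrightarrow> meets g V) \<and> meets g ({q. \<exists>r\<in>V. cext q r} \<union> ?V)"
    have "\<not> (meets g V \<and> meets g ?V)"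
    proof
      assume "meets g V \<and> meets g ?V"
      then obtain q r where qr: "q \<in> V" "r \<in> ?V" "cmatch q g" "cmatch r g"
        by (auto simp: meets_def)
      obtain s where "cext s q" "cext s r"
        using common_cmatch[OF qr(3,4)] by blast
      with qr show False by blast
    qed
    moreover have "meets g V \<or> meets g ?V"
      using * by (auto simp: meets_def intro: cmatch_cext)
    ultimately show "g \<in> - A \<longleftrightarrow> meets g ?V"
      using * by auto
  qed
  then show ?thesis
    unfolding almost_open_def by blast
qed

lemma almost_open_UN:
  assumes "\<And>i :: nat. almost_open (A i)"
  shows "almost_open (\<Union>i. A i)"
proof -
  obtain V where V: "\<And>i. comeagerly (\<lambda>g. g \<in> A i \<longleftrightarrow> meets g (V i))"
    using assms unfolding almost_open_def by metis
  have "comeagerly (\<lambda>g. \<forall>i. g \<in> A i \<longleftrightarrow> meets g (V i))"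
    by (rule comeagerly_all) (rule V)
  then have "comeagerly (\<lambda>g. g \<in> (\<Union>i. A i) \<longleftrightarrow> meets g (\<Union>i. V i))"
    by (rule comeagerly_mono) (auto simp: meets_def)
  then show ?thesis
    unfolding almost_open_def by blast
qed

lemma almost_open_borel:
  assumes "A \<in> sets borel"
  shows "almost_open A"
proof -
  have "A \<in> sigma_sets UNIV {S. open S}"
    using assms by (simp add: borel_def)
  then show ?thesis
  proof (induction rule: sigma_sets.induct)
    case Empty
    then show ?case using almost_open_open[of "{}"] by simp
  next
    case (Compl a)
    then show ?case using almost_open_compl by (simp add: Compl_eq_Diff_UNIV)
  qed (auto intro: almost_open_open almost_open_UN)
qed

text \<open>
  A set \<open>t\<close> of triples (condition, argument, value) codes a partial function of \<open>g\<close>; outside its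
  domain the value is the junk value of \<open>LEAST\<close>.
\<close>

definition decode_fun :: "cantor \<Rightarrow> cantor \<Rightarrow> nat \<Rightarrow> nat" where
  "decode_fun t g n = (LEAST v. \<exists>q. cmatch q g \<and> t (prod_encode (q, prod_encode (n, v))))"

text \<open>Serves the witnesses that do not depend on a generic point, so that all four witnesses
  of an edge have one format.\<close>

lemma ex_decode_fun_const: "\<exists>t. \<forall>g. decode_fun t g = u"
proof (intro exI allI ext)
  fix g n
  show "decode_fun (\<lambda>m. psnd (psnd m) = u (pfst (psnd m))) g n = u n"
    unfolding decode_fun_def using ex_cmatch by (intro Least_equality) auto
qed

text \<open>A function with the Baire property is continuous on a comeager set; the code lists the
  conditions that enforce each value.\<close>

lemma ex_decode_fun:
  fixes H :: "cantor \<Rightarrow> nat \<Rightarrow> nat"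
  assumes "\<And>n v. almost_open {g. H g n = v}"
  shows "\<exists>t. comeagerly (\<lambda>g. decode_fun t g = H g)"
proof -
  have "\<forall>n v. \<exists>V. comeagerly (\<lambda>g. H g n = v \<longleftrightarrow> meets g V)"
    using assms by (auto simp: almost_open_def)
  then obtain V where V: "\<And>n v. comeagerly (\<lambda>g. H g n = v \<longleftrightarrow> meets g (V n v))"
    by metis
  define t where "t m \<longleftrightarrow> pfst m \<in> V (pfst (psnd m)) (psnd (psnd m))" for m
  have "comeagerly (\<lambda>g. \<forall>n v. H g n = v \<longleftrightarrow> meets g (V n v))"
    by (intro comeagerly_all V)
  then have "comeagerly (\<lambda>g. decode_fun t g = H g)"
  proof (rule comeagerly_mono)
    fix g
    assume g: "\<forall>n v. H g n = v \<longleftrightarrow> meets g (V n v)"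
    show "decode_fun t g = H g"
    proof
      fix n
      have "(\<exists>q. cmatch q g \<and> t (prod_encode (q, prod_encode (n, v)))) \<longleftrightarrow> H g n = v" for v
        using g by (auto simp: t_def meets_def)
      then show "decode_fun t g n = H g n"
        unfolding decode_fun_def by (auto intro: Least_equality)
    qed
  qed
  then show ?thesis by blast
qed

section \<open>Coding into a pair of generic points\<close>

text \<open>Common places of the two points act as markers: marker number \<open>k\<close>, counted
  from 0, is followed in \<open>g\<close> by bit \<open>k\<close>.\<close>

definition pair_decode :: "cantor \<Rightarrow> cantor \<Rightarrow> cantor" where
  "pair_decode g h k \<longleftrightarrow> (\<exists>i. g i \<and> h i \<and> card {j. j < i \<and> g j \<and> h j} = k \<and> g (Suc i))"

text \<open>
  First \<open>g\<close> meets \<open>D\<close> while \<open>h\<close> is constantly \<open>False\<close>, then the roles are exchanged, so the only place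
  where both are \<open>True\<close> is the marker \<open>l'\<close>, after which \<open>g\<close> records the bit \<open>b\<close>.
\<close>

lemma pair_code_step:
  assumes "cdense D" "cdense E"
  shows "\<exists>l' g' h'. l \<le> l' \<and> (\<forall>i<l. g' i = g i \<and> h' i = h i) \<and>
    (\<forall>i. l \<le> i \<and> i < l' \<longrightarrow> \<not> (g' i \<and> h' i)) \<and> g' l' \<and> h' l' \<and> g' (Suc l') = b \<and> \<not> h' (Suc l') \<and>
    (\<exists>q\<in>D. clen q \<le> l' \<and> cmatch q g') \<and> (\<exists>q\<in>E. clen q \<le> l' \<and> cmatch q h')"
proof -
  obtain q0 where q0: "clen q0 = l" "\<And>i. i < l \<Longrightarrow> cbit q0 i = g i"
    using ex_condition[of l g] by blast
  obtain q where q: "q \<in> D" "cext q q0"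
    using assms(1) by (auto simp: cdense_def)
  define l1 where "l1 = clen q"
  have l1: "l \<le> l1" "\<And>i. i < l \<Longrightarrow> cbit q i = g i"
    using q q0 by (auto simp: cext_def l1_def)
  \<comment> \<open>Padding with \<open>False\<close> up to \<open>l1\<close> keeps the part where
    \<open>g\<close> meets \<open>D\<close> free of markers.\<close>
  define h1 where "h1 i = (if i < l then h i else False)" for i
  obtain r0 where r0: "clen r0 = l1" "\<And>i. i < l1 \<Longrightarrow> cbit r0 i = h1 i"
    using ex_condition[of l1 h1] by blast
  obtain r where r: "r \<in> E" "cext r r0"
    using assms(2) by (auto simp: cdense_def)
  define l2 where "l2 = clen r"
  have l2: "l1 \<le> l2" "\<And>i. i < l1 \<Longrightarrow> cbit r i = h1 i"
    using r r0 by (auto simp: cext_def l2_def)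
  define g' where "g' i = (if i < l1 then cbit q i else if i < l2 then False else if i = l2 then True else b)" for i
  \<comment> \<open>False directly after the marker, so the bit recorded by \<open>g'\<close> is not
    read as another marker.\<close>
  define h' where "h' i = (if i < l2 then cbit r i else i = l2)" for i
  have "\<forall>i<l. g' i = g i \<and> h' i = h i"
    using l1 l2 by (auto simp: g'_def h'_def h1_def)
  moreover have "\<forall>i. l \<le> i \<and> i < l2 \<longrightarrow> \<not> (g' i \<and> h' i)"
    using l1 l2 by (auto simp: g'_def h'_def h1_def)
  moreover have "cmatch q g'" "cmatch r h'"
    by (auto simp: cmatch_def g'_def h'_def l1_def l2_def)
  ultimately show ?thesis
    using l1(1) l2(1) q(1) r(1) by (intro exI[of _ l2] exI[of _ g'] exI[of _ h']) (auto simp: g'_def h'_def l1_def l2_def)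
qed

lemma ex_pair_code:
  fixes D E :: "nat \<Rightarrow> nat set"
  assumes D: "\<And>k. cdense (D k)" and E: "\<And>k. cdense (E k)"
  shows "\<exists>g h. (\<forall>k. meets g (D k)) \<and> (\<forall>k. meets h (E k)) \<and> pair_decode g h = t"
proof -
  \<comment> \<open>A state is a length with two points that count only below it; a stage ends with
    a marker at \<open>m\<close> and a bit at \<open>Suc m\<close>, hence the new length.\<close>
  define Q where "Q k s s' \<longleftrightarrow> (case s of (l, g, h) \<Rightarrow> case s' of (l', g', h') \<Rightarrow>
    \<exists>m. l' = Suc (Suc m) \<and> l \<le> m \<and> (\<forall>i<l. g' i = g i \<and> h' i = h i) \<and>
    (\<forall>i. l \<le> i \<and> i < m \<longrightarrow> \<not> (g' i \<and> h' i)) \<and> g' m \<and> h' m \<and> g' (Suc m) = t k \<and> \<not> h' (Suc m) \<and>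
    (\<exists>q\<in>D k. clen q \<le> m \<and> cmatch q g') \<and> (\<exists>q\<in>E k. clen q \<le> m \<and> cmatch q h'))"
    for k and s s' :: "nat \<times> cantor \<times> cantor"
  have "\<exists>s'. Q k s s'" for k s
  proof -
    obtain l g h where s: "s = (l, g, h)"
      using prod_cases3 by blast
    show ?thesis
      using pair_code_step[OF D[of k] E[of k], of l g h "t k"] unfolding Q_def s by auto
  qed
  then have "\<exists>S. \<forall>k. (k = 0 \<longrightarrow> fst (S k) = 0) \<and> Q k (S k) (S (Suc k))"
    by (intro dependent_nat_choice) auto
  then obtain S where S0: "fst (S 0) = 0" and "\<And>k. Q k (S k) (S (Suc k))"
    by blast
  moreover define l g h where "l k = fst (S k)" and "g k = fst (snd (S k))" and "h k = snd (snd (S k))" for k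
  ultimately have "\<exists>m. l (Suc k) = Suc (Suc m) \<and> l k \<le> m \<and>
    (\<forall>i<l k. g (Suc k) i = g k i \<and> h (Suc k) i = h k i) \<and>
    (\<forall>i. l k \<le> i \<and> i < m \<longrightarrow> \<not> (g (Suc k) i \<and> h (Suc k) i)) \<and> g (Suc k) m \<and> h (Suc k) m \<and>
    g (Suc k) (Suc m) = t k \<and> \<not> h (Suc k) (Suc m) \<and>
    (\<exists>q\<in>D k. clen q \<le> m \<and> cmatch q (g (Suc k))) \<and> (\<exists>q\<in>E k. clen q \<le> m \<and> cmatch q (h (Suc k)))" for k
    unfolding Q_def by (auto simp: case_prod_beta')
  then obtain m where m: "\<And>k. l (Suc k) = Suc (Suc (m k))" "\<And>k. l k \<le> m k"
    and eq: "\<And>k i. i < l k \<Longrightarrow> g (Suc k) i = g k i \<and> h (Suc k) i = h k i"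
    and no: "\<And>k i. l k \<le> i \<Longrightarrow> i < m k \<Longrightarrow> \<not> (g (Suc k) i \<and> h (Suc k) i)"
    and yes: "\<And>k. g (Suc k) (m k) \<and> h (Suc k) (m k)" "\<And>k. g (Suc k) (Suc (m k)) = t k"
      "\<And>k. \<not> h (Suc k) (Suc (m k))"
    and DE: "\<And>k. \<exists>q\<in>D k. clen q \<le> m k \<and> cmatch q (g (Suc k))"
      "\<And>k. \<exists>q\<in>E k. clen q \<le> m k \<and> cmatch q (h (Suc k))"
    by metis
  have mono_l: "l k < l (Suc k)" for k
    using m[of k] by (metis Suc_le_eq le_SucI le_imp_less_Suc)
  then have smono: "strict_mono l"
    by (simp add: strict_mono_Suc_iff)
  have stable: "g j i = g k i \<and> h j i = h k i" if "k \<le> j" "i < l k" for k j i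
    using that(1)
  proof (induction j rule: dec_induct)
    case (step j)
    have "i < l j"
      using that(2) step(1) smono by (metis less_le_trans strict_mono_less_eq)
    with step eq show ?case by simp
  qed simp
  \<comment> \<open>Lengths grow strictly, so place \<open>i\<close> is final from stage
    \<open>Suc i\<close> on.\<close>
  define G H where "G i = g (Suc i) i" and "H i = h (Suc i) i" for i
  have lge: "k \<le> l k" for k
    using smono by (rule strict_mono_imp_increasing)
  have GH: "G i = g k i \<and> H i = h k i" if "i < l k" for i k
  proof (cases "k \<le> Suc i")
    case True
    then show ?thesis using stable[OF True that] by (simp add: G_def H_def)
  next
    case False
    then show ?thesis
      using stable[of "Suc i" k i] lge[of "Suc i"] by (simp add: G_def H_def)
  qed
  have "meets G (D k)" for k
  proof -
    obtain q where q: "q \<in> D k" "clen q \<le> m k" "cmatch q (g (Suc k))"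
      using DE by blast
    have "G i = g (Suc k) i" if "i < m k" for i
      using GH[of i "Suc k"] that m(1)[of k] by simp
    then have "cmatch q G"
      using q by (simp add: cmatch_def)
    with q(1) show ?thesis
      by (auto simp: meets_def)
  qed
  moreover have "meets H (E k)" for k
  proof -
    obtain q where q: "q \<in> E k" "clen q \<le> m k" "cmatch q (h (Suc k))"
      using DE by blast
    have "H i = h (Suc k) i" if "i < m k" for i
      using GH[of i "Suc k"] that m(1)[of k] by simp
    then have "cmatch q H"
      using q by (simp add: cmatch_def)
    with q(1) show ?thesis
      by (auto simp: meets_def)
  qed
  moreover have "pair_decode G H = t"
  proof
    have marker: "G (m k) \<and> H (m k)" "G (Suc (m k)) = t k" "\<not> H (Suc (m k))"
      "\<And>i. l k \<le> i \<Longrightarrow> i < m k \<Longrightarrow> \<not> (G i \<and> H i)" for k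
      using GH[of _ "Suc k"] yes[of k] no[of k] m(1)[of k] by (simp_all add: less_Suc_eq)
    have both: "G i \<and> H i \<longleftrightarrow> i \<in> range m" for i
    proof
      assume i: "G i \<and> H i"
      \<comment> \<open>The stage during which place \<open>i\<close> is fixed; its only marker is
        \<open>m k\<close>.\<close>
      define k where "k = (LEAST k. i < l (Suc k))"
      have k: "i < l (Suc k)"
        unfolding k_def by (rule LeastI[of _ i]) (use lge[of "Suc i"] in simp)
      have "l k \<le> i"
      proof (cases k)
        case 0
        then show ?thesis using S0 by (simp add: l_def)
      next
        case (Suc k')
        then show ?thesis
          using not_less_Least[of k' "\<lambda>k. i < l (Suc k)"] by (simp flip: k_def)
      qed
      then have "i = m k"
        using k i marker[of k] m(1)[of k] by (auto simp: less_Suc_eq)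
      then show "i \<in> range m" by simp
    qed (use marker(1) in auto)
    have "m k < m (Suc k)" for k
      using m(1)[of k] m(2)[of "Suc k"] by simp
    then have sm: "strict_mono m"
      by (simp add: strict_mono_Suc_iff)
    have card: "card {j. j < m i \<and> G j \<and> H j} = i" for i
    proof -
      have "{j. j < m i \<and> G j \<and> H j} = m ` {..<i}"
        unfolding both using sm by (auto simp: strict_mono_less)
      then show ?thesis
        using sm by (simp add: card_image strict_mono_on_imp_inj_on strict_mono_imp_inj_on)
    qed
    fix k
    show "pair_decode G H k = t k"
    proof
      assume "pair_decode G H k"
      then obtain i where i: "G i \<and> H i" "card {j. j < i \<and> G j \<and> H j} = k" "G (Suc i)"
        by (auto simp: pair_decode_def)
      then obtain k' where "i = m k'"
        using both by blast
      with i card marker(2) show "t k" by auto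
    next
      assume "t k"
      then show "pair_decode G H k"
        unfolding pair_decode_def using card marker by (intro exI[of _ "m k"]) auto
    qed
  qed
  ultimately show ?thesis by blast
qed

section \<open>Borel witnesses for comparing \<open>omega1\<close>\<close>

text \<open>Second countability matches the Borel sets of a sequence space with the product
  sigma-algebra, so that measurability can be checked coordinatewise.\<close>

instance bool :: second_countable_topology
proof
  show "\<exists>B::bool set set. countable B \<and> open = generate_topology B"
    by (intro exI[of _ "range lessThan \<union> range greaterThan"]) (auto simp: open_bool_def)
qed

lemma borel_measurable_discrete_iff:
  fixes f :: "'w \<Rightarrow> 'b::{countable, t2_space}"
  shows "f \<in> borel_measurable M \<longleftrightarrow> f \<in> measurable M (count_space UNIV)"
proof -
  have "borel_measurable M = (measurable M (count_space UNIV) :: ('w \<Rightarrow> 'b) set)"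
    by (rule measurable_cong_sets) (simp_all add: sets_borel_eq_count_space)
  then show ?thesis by simp
qed

lemma borel_measurable_sequence_iff:
  fixes f :: "'w \<Rightarrow> nat \<Rightarrow> 'b::{countable, t2_space, second_countable_topology}"
  shows "f \<in> borel_measurable M \<longleftrightarrow> (\<forall>n. (\<lambda>w. f w n) \<in> measurable M (count_space UNIV))"
proof
  assume "f \<in> borel_measurable M"
  then have "(\<lambda>w. f w n) \<in> borel_measurable M" for n
    by (rule measurable_product_then_coordinatewise)
  then show "\<forall>n. (\<lambda>w. f w n) \<in> measurable M (count_space UNIV)"
    by (simp add: borel_measurable_discrete_iff)
next
  assume "\<forall>n. (\<lambda>w. f w n) \<in> measurable M (count_space UNIV)"
  then have "(\<lambda>w. f w n) \<in> borel_measurable M" for n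
    by (simp add: borel_measurable_discrete_iff)
  then show "f \<in> borel_measurable M"
    by (rule measurable_coordinatewise_then_product)
qed

lemma eval_Comp_iff:
  "eval x (Comp c ds) ns v \<longleftrightarrow>
     (\<exists>vs. length vs = length ds \<and> (\<forall>i\<in>{..<length ds}. eval x (ds ! i) ns (vs ! i)) \<and> eval x c vs v)"
proof
  assume "eval x (Comp c ds) ns v"
  then show "\<exists>vs. length vs = length ds \<and> (\<forall>i\<in>{..<length ds}. eval x (ds ! i) ns (vs ! i)) \<and> eval x c vs v"
    by (rule eval_CompE) (auto simp: list_all2_conv_all_nth)
qed (auto intro!: eval.intros(5) simp: list_all2_conv_all_nth)

lemma eval_Mu_iff:
  "eval x (Mu c) ns n \<longleftrightarrow>
     eval x c (n # ns) 0 \<and> (\<forall>m\<in>{..<n}. \<exists>v. 0 < v \<and> eval x c (m # ns) v)"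
  by (auto intro!: eval.intros(8) elim!: eval_MuE)

text \<open>Evaluation is an inductive predicate, so it is unfolded along the code instead of the
  derivation: each clause then adds only countable quantifiers, with an inner induction on the
  recursion argument.\<close>

lemma measurable_eval:
  assumes "f \<in> borel_measurable M"
  shows "Measurable.pred M (\<lambda>w. eval (f w) c ns v)"
proof (induction c arbitrary: ns v)
  case Zero
  have "eval x Zero ns v \<longleftrightarrow> v = 0" for x
    by (auto intro: eval.intros elim: eval_ZeroE)
  then show ?case by simp
next
  case Succ
  have "eval x Succ ns v \<longleftrightarrow> (\<exists>n. ns = [n] \<and> v = Suc n)" for x
    by (auto intro: eval.intros elim: eval_SuccE)
  then show ?case by simp
next
  case Query
  have "eval x Query ns v \<longleftrightarrow> (\<exists>n. ns = [n] \<and> v = of_bool (x n))" for x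
    using eval.intros(3)[of x] by (blast elim: eval_QueryE)
  moreover have [measurable]: "Measurable.pred M (\<lambda>w. f w n)" for n
    using assms by (simp add: borel_measurable_sequence_iff)
  have "Measurable.pred M (\<lambda>w. \<exists>n. ns = [n] \<and> v = of_bool (f w n))"
    unfolding of_bool_def by measurable
  ultimately show ?case by simp
next
  case (Proj i)
  have "eval x (Proj i) ns v \<longleftrightarrow> i < length ns \<and> v = ns ! i" for x
    by (auto intro: eval.intros elim: eval_ProjE)
  then show ?case by simp
next
  case (Comp c ds)
  have [measurable]: "Measurable.pred M (\<lambda>w. eval (f w) (ds ! i) ns v)" if "i \<in> {..<length ds}" for i ns v
    using Comp(2) that by simp
  note [measurable] = Comp(1)
  show ?case
    unfolding eval_Comp_iff by measurable
next
  case (PrimRec c d)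
  note [measurable] = PrimRec
  show ?case
  proof (cases ns)
    case Nil
    then have "\<not> eval x (PrimRec c d) ns v" for x
      by (auto elim: eval_PrimRecE)
    then show ?thesis by simp
  next
    case (Cons n ms)
    have "Measurable.pred M (\<lambda>w. eval (f w) (PrimRec c d) (n # ms) v)"
    proof (induction n arbitrary: v)
      case 0
      have "eval x (PrimRec c d) (0 # ms) v \<longleftrightarrow> eval x c ms v" for x
        by (auto intro: eval.intros elim: eval_PrimRec0E)
      then show ?case by simp
    next
      case (Suc n)
      note [measurable] = Suc
      have "eval x (PrimRec c d) (Suc n # ms) v \<longleftrightarrow>
          (\<exists>u. eval x (PrimRec c d) (n # ms) u \<and> eval x d (n # u # ms) v)" for x
        by (auto intro: eval.intros elim: eval_PrimRecSucE)
      then show ?case by simp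
    qed
    then show ?thesis
      by (simp add: Cons)
  qed
next
  case (Mu c)
  note [measurable] = Mu
  show ?case
    unfolding eval_Mu_iff by measurable
qed

section \<open>Codes of relations and witnesses for comparisons\<close>

definition total_code :: "cantor \<Rightarrow> code \<Rightarrow> bool" where
  "total_code x c \<longleftrightarrow> (\<forall>m n. eval x c [m, n] 0 \<or> eval x c [m, n] 1)"

definition code_rel :: "cantor \<Rightarrow> code \<Rightarrow> nat rel" where
  "code_rel x c = {(m, n). eval x c [m, n] 1}"

lemma computable_rel_from_code_rel:
  assumes "total_code x c"
  shows "computable_rel_from x (code_rel x c)"
  unfolding computable_rel_from_def
proof (intro exI allI)
  fix m n
  show "eval x c [m, n] (of_bool ((m, n) \<in> code_rel x c))"
    using assms by (cases "eval x c [m, n] 1") (auto simp: code_rel_def total_code_def)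
qed

lemma computable_rel_from_iff_code_rel:
  "computable_rel_from x R \<longleftrightarrow> (\<exists>c. total_code x c \<and> R = code_rel x c)"
proof
  assume "computable_rel_from x R"
  then obtain c where c: "\<And>m n. eval x c [m, n] (of_bool ((m, n) \<in> R))"
    by (auto simp: computable_rel_from_def)
  have "total_code x c"
    unfolding total_code_def
  proof (intro allI)
    show "eval x c [m, n] 0 \<or> eval x c [m, n] 1" for m n
      using c[of m n] by (cases "(m, n) \<in> R") auto
  qed
  moreover have "(m, n) \<in> R \<longleftrightarrow> eval x c [m, n] 1" for m n
    using c[of m n] eval_deterministic[of x c "[m, n]" 1 0] by (cases "(m, n) \<in> R") auto
  then have "R = code_rel x c"
    by (auto simp: code_rel_def)
  ultimately show "\<exists>c. total_code x c \<and> R = code_rel x c" by blast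
qed (auto intro: computable_rel_from_code_rel)

text \<open>
  No relation is required to be a well-order, which keeps the condition Borel; this loses nothing,
  because the isomorphism transports well-orderedness.
\<close>

definition witness1 :: "cantor \<Rightarrow> cantor \<Rightarrow> code \<Rightarrow> (nat \<Rightarrow> nat) \<Rightarrow> bool" where
  "witness1 x y c d \<longleftrightarrow> (total_code x c \<and> Linear_order (code_rel x c) \<longrightarrow>
     (\<forall>k. (d (Suc k), d k) \<in> code_rel x c \<and> d (Suc k) \<noteq> d k) \<or>
     (\<exists>c'. total_code y c' \<and> iso (code_rel x c) (code_rel y c') d))"

definition le_witness :: "cantor \<Rightarrow> cantor \<Rightarrow> (nat \<Rightarrow> nat) \<Rightarrow> bool" where
  "le_witness x y u \<longleftrightarrow> (\<forall>c. witness1 x y c (\<lambda>n. u (prod_encode (to_nat c, n))))"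

text \<open>Membership in the field is replaced by reflexivity, leaving only quantifiers over
  elements, which here are numbers.\<close>

lemma Linear_order_iff:
  "Linear_order R \<longleftrightarrow> (\<forall>a b. (a, b) \<in> R \<longrightarrow> (a, a) \<in> R \<and> (b, b) \<in> R) \<and>
     (\<forall>a b c. (a, b) \<in> R \<longrightarrow> (b, c) \<in> R \<longrightarrow> (a, c) \<in> R) \<and>
     (\<forall>a b. (a, b) \<in> R \<longrightarrow> (b, a) \<in> R \<longrightarrow> a = b) \<and>
     (\<forall>a b. (a, a) \<in> R \<longrightarrow> (b, b) \<in> R \<longrightarrow> a \<noteq> b \<longrightarrow> (a, b) \<in> R \<or> (b, a) \<in> R)" (is "_ \<longleftrightarrow> ?r")
proof -
  have F: "Field R = {a. (a, a) \<in> R}" if "\<forall>a b. (a, b) \<in> R \<longrightarrow> (a, a) \<in> R \<and> (b, b) \<in> R"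
    using that by (auto simp: Field_def)
  show ?thesis
  proof
    assume l: "Linear_order R"
    then have 1: "\<forall>a b. (a, b) \<in> R \<longrightarrow> (a, a) \<in> R \<and> (b, b) \<in> R"
      by (auto simp: order_on_defs refl_on_def Field_def)
    show ?r
      using l 1 unfolding order_on_defs F[OF 1] trans_def antisym_def total_on_def by blast
  next
    assume r: ?r
    show "Linear_order R"
      unfolding order_on_defs F[OF r[THEN conjunct1]] trans_def antisym_def total_on_def refl_on_def
    proof (intro conjI)
      show "R \<subseteq> {a. (a, a) \<in> R} \<times> {a. (a, a) \<in> R}"
        using r[THEN conjunct1] by auto
      show "\<forall>x y z. (x, y) \<in> R \<longrightarrow> (y, z) \<in> R \<longrightarrow> (x, z) \<in> R"
        using r[THEN conjunct2, THEN conjunct1] .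
      show "\<forall>x y. (x, y) \<in> R \<longrightarrow> (y, x) \<in> R \<longrightarrow> x = y"
        using r[THEN conjunct2, THEN conjunct2, THEN conjunct1] .
      show "\<forall>x\<in>{a. (a, a) \<in> R}. \<forall>y\<in>{a. (a, a) \<in> R}. x \<noteq> y \<longrightarrow> (x, y) \<in> R \<or> (y, x) \<in> R"
        using r[THEN conjunct2, THEN conjunct2, THEN conjunct2] by simp
    qed simp
  qed
qed

text \<open>Values \<open>d a\<close> are named by bound variables, because in the application
  \<open>d\<close> varies with the point while membership is known to be measurable for fixed pairs
  only.\<close>

lemma iso_iff_elementary:
  "iso R S d \<longleftrightarrow> (\<forall>a i. a \<in> Field R \<longrightarrow> d a = i \<longrightarrow> i \<in> Field S) \<and>
     (\<forall>i. i \<in> Field S \<longrightarrow> (\<exists>a. a \<in> Field R \<and> d a = i)) \<and>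
     (\<forall>a b i j. a \<in> Field R \<longrightarrow> b \<in> Field R \<longrightarrow> d a = i \<longrightarrow> d b = j \<longrightarrow>
       (i = j \<longrightarrow> a = b) \<and> ((a, b) \<in> R \<longleftrightarrow> (i, j) \<in> S))"
  unfolding iso_iff2 bij_betw_def inj_on_def by auto (metis imageE)

lemma measurable_Field:
  fixes R :: "'w \<Rightarrow> nat rel"
  assumes [measurable]: "\<And>m n. Measurable.pred M (\<lambda>w. (m, n) \<in> R w)"
  shows "Measurable.pred M (\<lambda>w. n \<in> Field (R w))"
proof -
  have "n \<in> Field (R w) \<longleftrightarrow> (\<exists>m. (m, n) \<in> R w \<or> (n, m) \<in> R w)" for w
    by (auto simp: Field_def)
  then show ?thesis by simp
qed

lemma measurable_le_witness:
  assumes f: "f \<in> borel_measurable M" and g: "g \<in> borel_measurable M" and u: "u \<in> borel_measurable M"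
  shows "Measurable.pred M (\<lambda>w. le_witness (f w) (g w) (u w))"
proof -
  note [measurable] = measurable_eval[OF f] measurable_eval[OF g]
  have [measurable]: "(\<lambda>w. u w n) \<in> measurable M (count_space UNIV)" for n
    using u by (simp add: borel_measurable_sequence_iff)
  have [measurable]: "Measurable.pred M (\<lambda>w. total_code (f w) c)"
    "Measurable.pred M (\<lambda>w. total_code (g w) c)" for c
    unfolding total_code_def by measurable
  have [measurable]: "Measurable.pred M (\<lambda>w. (m, n) \<in> code_rel (f w) c)"
    "Measurable.pred M (\<lambda>w. (m, n) \<in> code_rel (g w) c)" for m n c
    unfolding code_rel_def by simp_all
  have [measurable]: "Measurable.pred M (\<lambda>w. n \<in> Field (code_rel (f w) c))"
    "Measurable.pred M (\<lambda>w. n \<in> Field (code_rel (g w) c))" for n c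
    by (rule measurable_Field; measurable)+
  have [measurable]: "Measurable.pred M (\<lambda>w. Linear_order (code_rel (f w) c))" for c
    unfolding Linear_order_iff by measurable
  have [measurable]: "Measurable.pred M
      (\<lambda>w. iso (code_rel (f w) c) (code_rel (g w) c') (\<lambda>n. u w (prod_encode (to_nat c, n))))" for c c'
    unfolding iso_iff_elementary by measurable
  have [measurable]: "Measurable.pred M (\<lambda>w. (u w i, u w j) \<in> code_rel (f w) c \<and> u w i \<noteq> u w j)" for i j c
  proof -
    have "Measurable.pred M (\<lambda>w. \<exists>m n. u w i = m \<and> u w j = n \<and> (m, n) \<in> code_rel (f w) c \<and> m \<noteq> n)"
      by measurable
    moreover have "(\<lambda>w. \<exists>m n. u w i = m \<and> u w j = n \<and> (m, n) \<in> code_rel (f w) c \<and> m \<noteq> n) =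
        (\<lambda>w. (u w i, u w j) \<in> code_rel (f w) c \<and> u w i \<noteq> u w j)"
      by blast
    ultimately show ?thesis by (simp only:)
  qed
  show ?thesis
    unfolding le_witness_def witness1_def by measurable
qed

lemma Linear_order_not_Well_order:
  assumes "Linear_order R" "\<not> Well_order R"
  shows "\<exists>d. \<forall>k. (d (Suc k), d k) \<in> R \<and> d (Suc k) \<noteq> d k"
proof -
  have "\<not> wf (R - Id)"
    using assms by (simp add: well_order_on_def)
  then show ?thesis
    unfolding wf_iff_no_infinite_down_chain by auto
qed

lemma Well_order_no_descending:
  assumes "Well_order R"
  shows "\<not> (\<forall>k. (d (Suc k), d k) \<in> R \<and> d (Suc k) \<noteq> d k)"
proof -
  have "wf (R - Id)"
    using assms by (simp add: well_order_on_def)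
  then show ?thesis
    unfolding wf_iff_no_infinite_down_chain by auto
qed

text \<open>\<open>S\<close> is not assumed to be a well-order; recognising it as the image of
  \<open>R\<close> supplies this.\<close>

lemma iso_ordIso:
  assumes R: "Well_order R" and d: "iso R S d"
  shows "R =o S"
proof -
  have bij: "bij_betw d (Field R) (Field S)"
    and eq: "\<And>a b. a \<in> Field R \<Longrightarrow> b \<in> Field R \<Longrightarrow> (a, b) \<in> R \<longleftrightarrow> (d a, d b) \<in> S"
    using d by (auto simp: iso_iff2)
  have "S = dir_image R d"
  proof (intro set_eqI iffI; clarify)
    fix i j
    assume ij: "(i, j) \<in> S"
    then obtain a b where "a \<in> Field R" "b \<in> Field R" "i = d a" "j = d b"
      using bij FieldI1[OF ij] FieldI2[OF ij] unfolding bij_betw_def by blast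
    with ij eq show "(i, j) \<in> dir_image R d"
      by (auto simp: dir_image_def)
  next
    fix i j
    assume "(i, j) \<in> dir_image R d"
    then show "(i, j) \<in> S"
      using eq by (auto simp: dir_image_def intro: FieldI1 FieldI2)
  qed
  then show ?thesis
    using dir_image_ordIso[OF R, of d] bij by (simp add: bij_betw_def)
qed

text \<open>A well-order has no descending sequence, so the witness for its code must be an
  isomorphism.\<close>

lemma le_witness_sound:
  assumes u: "le_witness x y u"
  shows "omega1 x \<le> omega1 y"
  unfolding omega1_le_iff
proof (intro allI impI)
  fix \<alpha>
  assume "has_computable_presentation x \<alpha>"
  then obtain c where c: "Well_order (code_rel x c)" "order_type (code_rel x c) = \<alpha>" "total_code x c"
    unfolding has_computable_presentation_def computable_rel_from_iff_code_rel by blast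
  have "Linear_order (code_rel x c)"
    using c(1) by (simp add: well_order_on_def)
  then obtain c' d where c': "total_code y c'" "iso (code_rel x c) (code_rel y c') d"
    using u c(3) Well_order_no_descending[OF c(1), of "\<lambda>n. u (prod_encode (to_nat c, n))"]
    unfolding le_witness_def witness1_def by (auto dest!: spec[of _ c])
  have o: "code_rel x c =o code_rel y c'"
    by (rule iso_ordIso[OF c(1) c'(2)])
  then have "Well_order (code_rel y c')"
    by (simp add: ordIso_def)
  moreover have "order_type (code_rel y c') = \<alpha>"
    using c o calculation by (metis order_type_eq_iff)
  ultimately show "has_computable_presentation y \<alpha>"
    unfolding has_computable_presentation_def using computable_rel_from_code_rel[OF c'(1)] by blast
qed

lemma ex_le_witness:
  assumes le: "omega1 x \<le> omega1 y"
  shows "\<exists>u. le_witness x y u"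
proof -
  have "\<exists>d. witness1 x y c d" for c
  proof (cases "total_code x c \<and> Linear_order (code_rel x c)")
    case True
    show ?thesis
    proof (cases "Well_order (code_rel x c)")
      case wo: True
      then have "has_computable_presentation x (order_type (code_rel x c))"
        unfolding has_computable_presentation_def computable_rel_from_iff_code_rel using True by blast
      then have "has_computable_presentation y (order_type (code_rel x c))"
        using le omega1_le_iff by blast
      then obtain c' where c': "Well_order (code_rel y c')" "total_code y c'"
        "order_type (code_rel y c') = order_type (code_rel x c)"
        unfolding has_computable_presentation_def computable_rel_from_iff_code_rel by blast
      then have "code_rel x c =o code_rel y c'"
        using wo by (metis order_type_eq_iff)
      then obtain d where "iso (code_rel x c) (code_rel y c') d"
        by (auto simp: ordIso_def)
      then show ?thesis
        using c'(2) unfolding witness1_def by blast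
    next
      case False
      then show ?thesis
        using Linear_order_not_Well_order True unfolding witness1_def by blast
    qed
  qed (auto simp: witness1_def)
  then obtain d where d: "\<And>c. witness1 x y c (d c)"
    by metis
  have "le_witness x y (\<lambda>m. d (from_nat (pfst m)) (psnd m))"
    unfolding le_witness_def using d by simp
  then show ?thesis by blast
qed

section \<open>Cohen generic points preserve \<open>omega1\<close>\<close>

text \<open>Were \<open>L\<close> shorter, it would be isomorphic to the part of \<open>R\<close>
  below some \<open>b\<close>, and \<open>f\<close> would yield a strictly increasing map of
  \<open>R\<close> into itself sending \<open>b\<close> below itself.\<close>

lemma strict_mono_ordLeq:
  assumes R: "Well_order R" and L: "Well_order L"
    and f: "\<And>a. a \<in> Field R \<Longrightarrow> f a \<in> Field L"
    and mono: "\<And>a b. (a, b) \<in> R \<Longrightarrow> a \<noteq> b \<Longrightarrow> (f a, f b) \<in> L \<and> f a \<noteq> f b"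
  shows "R \<le>o L"
proof (rule ccontr)
  assume "\<not> R \<le>o L"
  then have "L <o R"
    using R L by (simp add: not_ordLeq_iff_ordLess)
  then obtain b where b: "b \<in> Field R" "L =o Restr R (underS R b)"
    using ordLess_iff_ordIso_Restr[OF R L] by blast
  then obtain h where h: "iso L (Restr R (underS R b)) h"
    by (auto simp: ordIso_def)
  have inj: "inj_on h (Field L)" and img: "h ` Field L = Field (Restr R (underS R b))"
    and iff: "\<And>i j. i \<in> Field L \<Longrightarrow> j \<in> Field L \<Longrightarrow> (i, j) \<in> L \<longleftrightarrow> (h i, h j) \<in> Restr R (underS R b)"
    using h by (auto simp: iso_iff2 bij_betw_def)
  define k where "k a = h (f a)" for a
  have k1: "(k a, k c) \<in> R \<and> k a \<noteq> k c" if "(a, c) \<in> R" "a \<noteq> c" for a c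
  proof -
    have "f a \<in> Field L" "f c \<in> Field L" "(f a, f c) \<in> L" "f a \<noteq> f c"
      using f that mono by (auto intro: FieldI1 FieldI2)
    then show ?thesis
      using iff inj unfolding k_def inj_on_def by blast
  qed
  have k2: "k a \<in> underS R b" if "a \<in> Field R" for a
    using img f[OF that] unfolding k_def Field_def by blast
  have "wf (R - Id)"
    using R by (simp add: well_order_on_def)
  \<comment> \<open>A strictly increasing self-map of a well-order moves no point down, as iterating
    it would descend forever.\<close>
  then have "\<not> (k a, a) \<in> R - Id" for a
  proof (induction a rule: wf_induct_rule)
    case (less a)
    show ?case
    proof
      assume a: "(k a, a) \<in> R - Id"
      then have "(k (k a), k a) \<in> R - Id"
        using k1 by blast
      with less[OF a] show False by blast
    qed
  qed
  moreover have "(k b, b) \<in> R - Id"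
    using k2[OF b(1)] by (auto simp: underS_def)
  ultimately show False by blast
qed

text \<open>The predecessors of \<open>a\<close> in \<open>L\<close> are the ranks of the
  \<open>lt\<close>-predecessors of \<open>n\<close>. The recursion is along \<open>L\<close>, so
  the notion makes sense for every relation \<open>lt\<close>, well-founded or not.\<close>

inductive has_rank :: "('n \<Rightarrow> 'n \<Rightarrow> bool) \<Rightarrow> 'a rel \<Rightarrow> 'a \<Rightarrow> 'n \<Rightarrow> bool" for lt L where
  "(\<And>m. lt m n \<Longrightarrow> \<exists>b. (b, a) \<in> L - Id \<and> has_rank lt L b m) \<Longrightarrow>
   (\<And>b. (b, a) \<in> L - Id \<Longrightarrow> \<exists>m. lt m n \<and> has_rank lt L b m) \<Longrightarrow> has_rank lt L a n"

lemma has_rank_iff: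
  "has_rank lt L a n \<longleftrightarrow> (\<forall>m. lt m n \<longrightarrow> (\<exists>b. (b, a) \<in> L - Id \<and> has_rank lt L b m)) \<and>
     (\<forall>b. (b, a) \<in> L - Id \<longrightarrow> (\<exists>m. lt m n \<and> has_rank lt L b m))"
  by (subst has_rank.simps) simp

text \<open>\<open>L\<close> is the same for all \<open>w\<close>; induction along it adds only
  countable operations at each point, so the set stays measurable at every rank.\<close>

lemma measurable_has_rank:
  fixes lt :: "'w \<Rightarrow> nat \<Rightarrow> nat \<Rightarrow> bool" and L :: "nat rel"
  assumes [measurable]: "\<And>m n. Measurable.pred M (\<lambda>w. lt w m n)" and wf: "wf (L - Id)"
  shows "Measurable.pred M (\<lambda>w. has_rank (lt w) L a n)"
  using wf
proof (induction a arbitrary: n rule: wf_induct_rule)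
  case (less a)
  have [measurable]: "Measurable.pred M (\<lambda>w. (b, a) \<in> L - Id \<and> has_rank (lt w) L b m)" for b m
    using less[of b m] by (rule pred_intros_conj1')
  have [measurable]: "Measurable.pred M (\<lambda>w. (b, a) \<in> L - Id \<longrightarrow> (\<exists>m. lt w m n \<and> has_rank (lt w) L b m))" for b
  proof (rule pred_intros_imp')
    assume "(b, a) \<in> L - Id"
    then have [measurable]: "Measurable.pred M (\<lambda>w. has_rank (lt w) L b m)" for m
      by (rule less)
    show "Measurable.pred M (\<lambda>w. \<exists>m. lt w m n \<and> has_rank (lt w) L b m)"
      by measurable
  qed
  show ?case
    by (subst has_rank_iff) measurable
qed

lemma underS_inj:
  assumes L: "Well_order L" and "a \<in> Field L" "b \<in> Field L" "underS L a = underS L b"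
  shows "a = b"
proof (rule ccontr)
  assume "a \<noteq> b"
  then have "a \<in> underS L b \<or> b \<in> underS L a"
    using assms by (auto simp: underS_def order_on_defs total_on_def)
  with assms(4) show False
    by (auto simp: underS_def)
qed

text \<open>An embedding maps the predecessors of \<open>n\<close> onto those of \<open>f n\<close>,
  and a point of a well-order is determined by its predecessors; so ranks define the graph of the
  embedding.\<close>

lemma has_rank_embed:
  assumes R: "Well_order R" and L: "Well_order L" and f: "embed R L f"
    and a: "a \<in> Field L" and n: "n \<in> Field R"
  shows "has_rank (\<lambda>m n. (m, n) \<in> R - Id) L a n \<longleftrightarrow> a = f n"
proof -
  have "wf (L - Id)"
    using L by (simp add: well_order_on_def)
  then have "a \<in> Field L \<Longrightarrow> n \<in> Field R \<Longrightarrow>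
      has_rank (\<lambda>m n. (m, n) \<in> R - Id) L a n \<longleftrightarrow> a = f n"
  proof (induction a arbitrary: n rule: wf_induct_rule)
    case (less a)
    let ?P = "has_rank (\<lambda>m n. (m, n) \<in> R - Id) L"
    have IH: "?P b m \<longleftrightarrow> b = f m" if "(b, a) \<in> L - Id" "(m, n) \<in> R - Id" for b m
      using less.IH[of b m] that by (auto intro: FieldI1)
    have U: "underS L c = {b. (b, c) \<in> L - Id}" "underS R m = {b. (b, m) \<in> R - Id}" for c m
      by (auto simp: underS_def)
    have img: "f ` underS R n = underS L (f n)"
      using embed_underS[OF R f less.prems(2)] by (simp add: bij_betw_def)
    have fn: "f n \<in> Field L"
      using embed_in_Field[OF f less.prems(2)] .
    have "?P a n \<longleftrightarrow> (\<forall>m. (m, n) \<in> R - Id \<longrightarrow> (f m, a) \<in> L - Id) \<and>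
        (\<forall>b. (b, a) \<in> L - Id \<longrightarrow> (\<exists>m. (m, n) \<in> R - Id \<and> b = f m))"
      by (subst has_rank_iff) (use IH in blast)
    also have "\<dots> \<longleftrightarrow> f ` underS R n = underS L a"
      unfolding U by blast
    also have "\<dots> \<longleftrightarrow> a = f n"
      unfolding img using underS_inj[OF L less.prems(1) fn] by auto
    finally show ?case .
  qed
  with a n show ?thesis by blast
qed

text \<open>The range of an embedding is all of \<open>L\<close> or the part below one point, and
  both are computable. Agreement of \<open>h\<close> with \<open>f\<close> is asked on the field
  only, since a map defined by \<open>LEAST\<close> is arbitrary elsewhere.\<close>

lemma iso_initial_segment_computable:
  assumes R: "Well_order R" and L: "Well_order L" and f: "embed R L f"
    and comp: "computable_rel_from x L" and h: "\<And>n. n \<in> Field R \<Longrightarrow> h n = f n"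
  shows "\<exists>c'. total_code x c' \<and> iso R (code_rel x c') h"
proof -
  let ?S = "Restr L (f ` Field R)"
  have wo: "wo_rel L"
    using L by (simp add: wo_rel_def)
  have "(\<exists>a\<in>Field L. f ` Field R = underS L a) \<or> f ` Field R = Field L"
    using embed_Field_ofilter[OF R L f] by (rule wo_rel.ofilter_underS_Field[OF wo, THEN iffD1])
  then have "f ` Field R = Field L \<or> (\<exists>a. f ` Field R = underS L a)"
    by fast
  then have "computable_rel_from x ?S"
  proof
    assume "f ` Field R = Field L"
    then have "?S = L"
      by (auto intro: FieldI1 FieldI2)
    then show ?thesis using comp by simp
  qed (auto simp: computable_rel_from_underS[OF comp])
  then obtain c' where c': "total_code x c'" "?S = code_rel x c'"
    by (auto simp: computable_rel_from_iff_code_rel)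
  have "iso R ?S f"
    by (rule embed_implies_iso_Restr[OF L R f])
  note iso = this[unfolded iso_iff2, THEN conjunct1]
    this[unfolded iso_iff2, THEN conjunct2, rule_format]
  have "bij_betw h (Field R) (Field ?S)"
    using iso(1) bij_betw_cong[of "Field R" h f, OF h] by blast
  moreover have "(a, b) \<in> R \<longleftrightarrow> (h a, h b) \<in> ?S" if "a \<in> Field R" "b \<in> Field R" for a b
    unfolding h[OF that(1)] h[OF that(2)] using that by (rule iso(2))
  ultimately have "iso R ?S h"
    unfolding iso_iff2 by blast
  with c' show ?thesis by auto
qed

section \<open>Descending sequences and ranks for generic points\<close>

lemma measurable_cmatch [measurable]: "Measurable.pred borel (\<lambda>g. cmatch q g)"
proof -
  have [measurable]: "Measurable.pred borel (\<lambda>g::cantor. g i)" for i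
    using borel_measurable_sequence_iff[of "\<lambda>g::cantor. g" borel] by simp
  show ?thesis
    unfolding cmatch_def by measurable
qed

text \<open>The opponent may play any extension and is answered by a further one; hence the answers
  to a position are dense below it, and a generic point matching the position matches one of them.
  Following such answers yields the descent, and choosing the least one keeps it Borel in
  \<open>g\<close>.\<close>

lemma strategy_generic_descending:
  assumes f: "\<And>j. strategy_ok F p f j"
  shows "\<exists>H. (\<forall>k. (\<lambda>g. H g k) \<in> measurable borel (count_space UNIV)) \<and>
    comeagerly (\<lambda>g. cmatch (pfst (f 0)) g \<longrightarrow>
      (\<forall>k. \<exists>q. cmatch q g \<and> F q (H g (Suc k)) (H g k)))"
proof -
  \<comment> \<open>At position \<open>j\<close> the opponent has legally answered position
    \<open>i\<close>.\<close>
  define child where "child i j \<longleftrightarrow> j \<noteq> 0 \<and> pfst (j - 1) = i \<and> cext (psnd (j - 1)) (pfst (f i))" for i j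
  define pos where "pos g = rec_nat 0 (\<lambda>_ i. LEAST j. child i j \<and> cmatch (pfst (f j)) g)" for g
  have pos0: "pos g 0 = 0" and posSuc: "pos g (Suc k) = (LEAST j. child (pos g k) j \<and> cmatch (pfst (f j)) g)" for g k
    by (simp_all add: pos_def)
  have pos_meas: "(\<lambda>g. pos g k) \<in> measurable borel (count_space UNIV)" for k
  proof (induction k)
    case (Suc k)
    note [measurable] = Suc
    have "Measurable.pred borel (\<lambda>g. \<exists>i. pos g k = i \<and> child i j \<and> cmatch (pfst (f j)) g)" for j
      by measurable
    then have [measurable]: "Measurable.pred borel (\<lambda>g. child (pos g k) j \<and> cmatch (pfst (f j)) g)" for j
      by simp
    show ?case
      unfolding posSuc by measurable
  qed (simp add: pos0)
  have "comeagerly (\<lambda>g. \<forall>i. cmatch (pfst (f i)) g \<longrightarrow> meets g {pfst (f j) | j. child i j})"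
  proof (intro comeagerly_all comeagerly_meets_below)
    fix i q
    assume q: "cext q (pfst (f i))"
    let ?j = "Suc (prod_encode (i, q))"
    have "child i ?j"
      using q by (simp add: child_def)
    moreover have "cext (pfst (f ?j)) q"
      using f[of ?j] q by (simp add: strategy_ok_def)
    ultimately show "\<exists>s\<in>{pfst (f j) | j. child i j}. cext s q"
      by blast
  qed
  then have "comeagerly (\<lambda>g. cmatch (pfst (f 0)) g \<longrightarrow>
      (\<forall>k. \<exists>q. cmatch q g \<and> F q (psnd (f (pos g (Suc k)))) (psnd (f (pos g k)))))"
  proof (rule comeagerly_mono, intro impI allI)
    fix g k
    assume g: "\<forall>i. cmatch (pfst (f i)) g \<longrightarrow> meets g {pfst (f j) | j. child i j}"
      and g0: "cmatch (pfst (f 0)) g"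
    have step: "child (pos g k) (pos g (Suc k)) \<and> cmatch (pfst (f (pos g (Suc k)))) g"
      if "cmatch (pfst (f (pos g k))) g" for k
    proof -
      have "\<exists>j. child (pos g k) j \<and> cmatch (pfst (f j)) g"
        using g that by (auto simp: meets_def)
      then show ?thesis
        unfolding posSuc by (rule LeastI_ex)
    qed
    have "cmatch (pfst (f (pos g k))) g" for k
      by (induction k) (use g0 step in \<open>auto simp: pos0\<close>)
    then have c: "child (pos g k) (pos g (Suc k))" "cmatch (pfst (f (pos g (Suc k)))) g"
      using step by blast+
    then have "F (pfst (f (pos g (Suc k)))) (psnd (f (pos g (Suc k)))) (psnd (f (pos g k)))"
      using f[of "pos g (Suc k)"] by (auto simp: strategy_ok_def child_def)
    with c(2) show "\<exists>q. cmatch q g \<and> F q (psnd (f (pos g (Suc k)))) (psnd (f (pos g k)))"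
      by blast
  qed
  moreover have "(\<lambda>g. psnd (f (pos g k))) \<in> measurable borel (count_space UNIV)" for k
    using pos_meas by (rule measurable_compose) simp
  ultimately show ?thesis
    by (intro exI[of _ "\<lambda>g k. psnd (f (pos g k))"]) simp
qed

text \<open>Each \<open>n\<close> has forced bounds densely below \<open>p\<close>, so a generic
  point finds one; \<open>rk n\<close> is the least bound forced by a condition of \<open>g\<close>.
  If \<open>m\<close> lies below \<open>n\<close>, some condition of \<open>g\<close> forces a
  smaller bound for \<open>m\<close>, and \<open>rk m\<close> is at most that.\<close>

lemma no_strategy_generic_rank:
  assumes mono: "\<And>q r m n. F q m n \<Longrightarrow> cext r q \<Longrightarrow> F r m n"
    and no_path: "\<not> tree_has_path (strategy_tree F p)"
  shows "comeagerly (\<lambda>g. cmatch p g \<longrightarrow> (\<exists>rk. \<forall>n. rk n \<in> Field (kb_rel (strategy_tree F p)) \<and>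
     (\<forall>m. (\<exists>q. cmatch q g \<and> F q m n) \<longrightarrow> (rk m, rk n) \<in> kb_rel (strategy_tree F p) - Id)))"
proof -
  define T where "T = strategy_tree F p"
  define B where "B = forced_rank F (kb_less T)"
  have "comeagerly (\<lambda>g. \<forall>n. cmatch p g \<longrightarrow> meets g {q. \<exists>a. T a \<and> B a q n})"
  proof (intro comeagerly_all comeagerly_meets_below)
    fix n q
    assume q: "cext q p"
    \<comment> \<open>The strategy that only opens, with \<open>q\<close> and \<open>n\<close>; its
      single position is the one that must receive a bound.\<close>
    let ?s = "[prod_encode (q, n)]"
    have "T ?s"
      using q by (simp add: T_def strategy_tree_def strategy_ok_def)
    moreover from this obtain q' where "cext q' q" "B ?s q' n"
      using strategy_tree_forced_rank[OF no_path, of ?s] unfolding T_def B_def by auto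
    ultimately show "\<exists>s\<in>{q. \<exists>a. T a \<and> B a q n}. cext s q"
      by blast
  qed
  moreover have "comeagerly (\<lambda>g. \<forall>a q n r m. B a q n \<longrightarrow> cext r q \<longrightarrow> F r m n \<longrightarrow> cmatch r g \<longrightarrow>
      meets g {s. \<exists>b. kb_less T b a \<and> B b s m})"
  proof (intro comeagerly_all comeagerly_imp comeagerly_meets_below)
    fix a q n r m q'
    assume B: "B a q n" and r: "cext r q" "F r m n" and q': "cext q' r"
    have "cext q' q" "F q' m n"
      using r q' mono cext_trans by blast+
    moreover have "\<exists>s b. cext s r \<and> kb_less T b a \<and> B b s m" if "cext r q" "F r m n" for r m
      using B that unfolding B_def by (cases rule: forced_rank.cases) blast
    ultimately show "\<exists>s\<in>{s. \<exists>b. kb_less T b a \<and> B b s m}. cext s q'"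
      by blast
  qed
  ultimately have "comeagerly (\<lambda>g. (\<forall>n. cmatch p g \<longrightarrow> meets g {q. \<exists>a. T a \<and> B a q n}) \<and>
      (\<forall>a q n r m. B a q n \<longrightarrow> cext r q \<longrightarrow> F r m n \<longrightarrow> cmatch r g \<longrightarrow>
      meets g {s. \<exists>b. kb_less T b a \<and> B b s m}))"
    by (rule comeagerly_conj)
  then show ?thesis
    unfolding T_def[symmetric]
  proof (rule comeagerly_mono, intro impI)
    fix g
    assume "(\<forall>n. cmatch p g \<longrightarrow> meets g {q. \<exists>a. T a \<and> B a q n}) \<and>
      (\<forall>a q n r m. B a q n \<longrightarrow> cext r q \<longrightarrow> F r m n \<longrightarrow> cmatch r g \<longrightarrow>
      meets g {s. \<exists>b. kb_less T b a \<and> B b s m})"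
      and p: "cmatch p g"
    then have g1: "\<exists>q a. cmatch q g \<and> T a \<and> B a q n"
      and g2: "B a q n \<Longrightarrow> cext r q \<Longrightarrow> F r m n \<Longrightarrow> cmatch r g \<Longrightarrow>
        \<exists>s b. cmatch s g \<and> kb_less T b a \<and> B b s m" for a q n r m
      by (auto simp: meets_def) blast+
    have L: "Well_order (kb_rel T)"
      unfolding T_def using strategy_tree_closed no_path by (rule Well_order_kb_rel)
    then have wf: "wf (kb_rel T - Id)"
      by (simp add: well_order_on_def)
    define ranks where "ranks n = {a. T (list_decode a) \<and> (\<exists>q. cmatch q g \<and> B (list_decode a) q n)}" for n
    have "\<exists>a\<in>ranks n. \<forall>b. (b, a) \<in> kb_rel T - Id \<longrightarrow> b \<notin> ranks n" for n
    proof -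
      obtain q a where "cmatch q g" "T a" "B a q n"
        using g1 by blast
      then have "list_encode a \<in> ranks n"
        by (auto simp: ranks_def)
      then show ?thesis
        using wf by (meson wfE_min)
    qed
    then obtain rk where rk: "\<And>n. rk n \<in> ranks n" "\<And>n b. (b, rk n) \<in> kb_rel T - Id \<Longrightarrow> b \<notin> ranks n"
      by metis
    show "\<exists>rk. \<forall>n. rk n \<in> Field (kb_rel T) \<and>
        (\<forall>m. (\<exists>q. cmatch q g \<and> F q m n) \<longrightarrow> (rk m, rk n) \<in> kb_rel T - Id)"
    proof (intro exI[of _ rk] allI conjI impI)
      fix n
      show "rk n \<in> Field (kb_rel T)"
        using rk(1)[of n] by (simp add: Field_kb_rel ranks_def)
      fix m
      assume "\<exists>q. cmatch q g \<and> F q m n"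
      then obtain q1 where q1: "cmatch q1 g" "F q1 m n"
        by blast
      obtain q where q: "cmatch q g" "B (list_decode (rk n)) q n"
        using rk(1)[of n] by (auto simp: ranks_def)
      obtain r where r: "cmatch r g" "cext r q" "cext r q1"
        using common_cmatch[OF q(1) q1(1)] .
      obtain s b where b: "cmatch s g" "kb_less T b (list_decode (rk n))" "B b s m"
        using g2[OF q(2) r(2) mono[OF q1(2) r(3)] r(1)] by blast
      define b' where "b' = list_encode b"
      have b': "list_decode b' = b"
        by (simp add: b'_def)
      have b'1: "(b', rk n) \<in> kb_rel T - Id"
        using b(2) b' by (auto simp: kb_less_def kb_rel_def)
      have b'2: "b' \<in> ranks m"
        using b by (auto simp: b'_def ranks_def kb_less_def)
      then have "(b', rk m) \<notin> kb_rel T - Id"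
        using rk(2) by blast
      moreover have "b' \<in> Field (kb_rel T)" "rk m \<in> Field (kb_rel T)"
        using b'2 rk(1)[of m] by (simp_all add: Field_kb_rel ranks_def)
      moreover have "(c, d) \<in> kb_rel T - Id \<or> (d, c) \<in> kb_rel T"
        if "c \<in> Field (kb_rel T)" "d \<in> Field (kb_rel T)" for c d
        using that L by (cases "c = d") (auto simp: order_on_defs total_on_def refl_on_def)
      ultimately have "(rk m, b') \<in> kb_rel T"
        by blast
      moreover have "trans (kb_rel T)" "antisym (kb_rel T)"
        using L by (simp_all add: order_on_defs)
      ultimately show "(rk m, rk n) \<in> kb_rel T - Id"
        using b'1 by (metis Diff_iff antisymD pair_in_Id_conv transD)
    qed
  qed
qed

text \<open>The two cases of the tree give the two alternatives of a witness. In the second the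
  isomorphism is a rank function, determined by the order itself, which makes it a Borel function of
  \<open>g\<close> instead of an arbitrary choice.\<close>

lemma generic_witness1_below:
  assumes F: "decidable_pred x 3 (\<lambda>ns. F (ns ! 0) (ns ! 1) (ns ! 2))"
    and mono: "\<And>q r m n. F q m n \<Longrightarrow> cext r q \<Longrightarrow> F r m n"
    and ev: "\<And>g m n. eval (x \<oplus>\<^sub>T g) c [m, n] 1 \<and> m \<noteq> n \<longleftrightarrow> (\<exists>q. cmatch q g \<and> F q m n)"
  shows "\<exists>q H. cext q p \<and> (\<forall>k. (\<lambda>g. H g k) \<in> measurable borel (count_space UNIV)) \<and>
    comeagerly (\<lambda>g. cmatch q g \<longrightarrow> witness1 (x \<oplus>\<^sub>T g) x c (H g))"
proof (cases "tree_has_path (strategy_tree F p)")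
  case True
  then obtain f where f: "\<And>j. strategy_ok F p f j"
    by (auto simp: strategy_tree_path_iff)
  obtain H where H: "\<forall>k. (\<lambda>g. H g k) \<in> measurable borel (count_space UNIV)"
    "comeagerly (\<lambda>g. cmatch (pfst (f 0)) g \<longrightarrow>
      (\<forall>k. \<exists>q. cmatch q g \<and> F q (H g (Suc k)) (H g k)))"
    using strategy_generic_descending[OF f] by blast
  have "comeagerly (\<lambda>g. cmatch (pfst (f 0)) g \<longrightarrow> witness1 (x \<oplus>\<^sub>T g) x c (H g))"
    using H(2) by (rule comeagerly_mono) (simp add: witness1_def code_rel_def flip: ev)
  moreover have "cext (pfst (f 0)) p"
    using f[of 0] by (simp add: strategy_ok_def)
  ultimately show ?thesis
    using H(1) by blast
next
  case False
  define L where "L = kb_rel (strategy_tree F p)"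
  have L: "Well_order L"
    unfolding L_def using strategy_tree_closed False by (rule Well_order_kb_rel)
  then have wfL: "wf (L - Id)"
    by (simp add: well_order_on_def)
  have comp: "computable_rel_from x L"
    unfolding L_def by (intro computable_rel_from_kb_rel decidable_pred_strategy_tree F)
  define lt where "lt g m n \<longleftrightarrow> (\<exists>q. cmatch q g \<and> F q m n)" for g m n
  define H where "H g n = (LEAST a. a \<in> Field L \<and> has_rank (lt g) L a n)" for g n
  have lt_meas [measurable]: "Measurable.pred borel (\<lambda>g. lt g m n)" for m n
    unfolding lt_def by measurable
  have [measurable]: "Measurable.pred borel (\<lambda>g. has_rank (lt g) L a n)" for a n
    by (rule measurable_has_rank[OF lt_meas wfL])
  have H_meas: "(\<lambda>g. H g n) \<in> measurable borel (count_space UNIV)" for n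
    unfolding H_def by measurable
  have "comeagerly (\<lambda>g. cmatch p g \<longrightarrow> (\<exists>rk. \<forall>n. rk n \<in> Field L \<and>
     (\<forall>m. lt g m n \<longrightarrow> (rk m, rk n) \<in> L - Id)))"
    unfolding L_def lt_def by (rule no_strategy_generic_rank[OF mono False])
  then have "comeagerly (\<lambda>g. cmatch p g \<longrightarrow> witness1 (x \<oplus>\<^sub>T g) x c (H g))"
  proof (rule comeagerly_mono, intro impI)
    fix g
    assume "cmatch p g \<longrightarrow> (\<exists>rk. \<forall>n. rk n \<in> Field L \<and> (\<forall>m. lt g m n \<longrightarrow> (rk m, rk n) \<in> L - Id))"
      and "cmatch p g"
    then obtain rk where rk: "\<And>n. rk n \<in> Field L" "\<And>m n. lt g m n \<Longrightarrow> (rk m, rk n) \<in> L - Id"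
      by blast
    define R where "R = code_rel (x \<oplus>\<^sub>T g) c"
    have lt: "lt g = (\<lambda>m n. (m, n) \<in> R - Id)"
      by (intro ext) (auto simp: lt_def R_def code_rel_def simp flip: ev)
    have "\<exists>c'. total_code x c' \<and> iso R (code_rel x c') (H g)" if lin: "Linear_order R"
    proof -
      have "R - Id \<subseteq> inv_image (L - Id) rk"
        using rk(2) unfolding lt inv_image_def by blast
      then have "wf (R - Id)"
        using wf_inv_image[OF wfL] wf_subset by blast
      with lin have R: "Well_order R"
        by (simp add: well_order_on_def)
      have "R \<le>o L"
        by (rule strict_mono_ordLeq[OF R L, of rk]) (use rk in \<open>auto simp: lt\<close>)
      then obtain f where f: "embed R L f"
        by (auto simp: ordLeq_def)
      have "H g n = f n" if n: "n \<in> Field R" for n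
      proof -
        have "(a \<in> Field L \<and> has_rank (lt g) L a n) \<longleftrightarrow> a = f n" for a
          using has_rank_embed[OF R L f _ n] embed_in_Field[OF f n] unfolding lt by blast
        then show ?thesis
          unfolding H_def by (auto intro: Least_equality)
      qed
      then show ?thesis
        by (rule iso_initial_segment_computable[OF R L f comp])
    qed
    then show "witness1 (x \<oplus>\<^sub>T g) x c (H g)"
      by (auto simp: witness1_def R_def)
  qed
  with H_meas show ?thesis
    using cext_refl by blast
qed

text \<open>Solutions below densely many conditions are glued: \<open>g\<close> uses the least
  condition of the dense set that it matches, and this choice is Borel.\<close>

lemma generic_witness1:
  "\<exists>H. (\<forall>k. (\<lambda>g. H g k) \<in> measurable borel (count_space UNIV)) \<and>
    comeagerly (\<lambda>g. witness1 (x \<oplus>\<^sub>T g) x c (H g))"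
proof (rule ex_forcing_relation[of x c])
  fix F
  assume F: "decidable_pred x 3 (\<lambda>ns. F (ns ! 0) (ns ! 1) (ns ! 2))"
    "\<And>q r m n. F q m n \<Longrightarrow> cext r q \<Longrightarrow> F r m n"
    "\<And>g m n. eval (x \<oplus>\<^sub>T g) c [m, n] 1 \<and> m \<noteq> n \<longleftrightarrow> (\<exists>q. cmatch q g \<and> F q m n)"
  define good where "good q H \<longleftrightarrow> (\<forall>k. (\<lambda>g. H g k) \<in> measurable borel (count_space UNIV)) \<and>
    comeagerly (\<lambda>g. cmatch q g \<longrightarrow> witness1 (x \<oplus>\<^sub>T g) x c (H g))" for q H
  define D where "D = {q. \<exists>H. good q H}"
  have "cdense D"
    unfolding cdense_def
  proof
    fix p
    have "\<exists>q H. cext q p \<and> good q H"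
      unfolding good_def using F by (rule generic_witness1_below)
    then show "\<exists>q\<in>D. cext q p"
      by (auto simp: D_def)
  qed
  have "\<forall>q\<in>D. \<exists>H. good q H"
    by (simp add: D_def)
  then obtain H where H: "\<And>q. q \<in> D \<Longrightarrow> good q (H q)"
    by (meson bchoice)
  define sel where "sel g = (LEAST q. q \<in> D \<and> cmatch q g)" for g
  \<comment> \<open>\<open>H\<close> is chosen only on \<open>D\<close>, while \<open>sel g\<close>
    may leave \<open>D\<close> when \<open>g\<close> meets no condition there.\<close>
  define H' where "H' g k = (if sel g \<in> D then H (sel g) g k else 0)" for g k
  have [measurable]: "sel \<in> measurable borel (count_space UNIV)"
    unfolding sel_def by measurable
  have "(\<lambda>g. H' g k) \<in> measurable borel (count_space UNIV)" for k
  proof -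
    have [measurable]: "(\<lambda>g. if q \<in> D then H q g k else 0) \<in> measurable borel (count_space UNIV)" for q
      using H[of q] by (cases "q \<in> D") (auto simp: good_def)
    show ?thesis
      unfolding H'_def by (rule measurable_compose_countable[of "\<lambda>q g. if q \<in> D then H q g k else 0"]) measurable
  qed
  moreover have "comeagerly (\<lambda>g. meets g D \<and> (\<forall>q. q \<in> D \<longrightarrow> cmatch q g \<longrightarrow> witness1 (x \<oplus>\<^sub>T g) x c (H q g)))"
    by (intro comeagerly_conj comeagerly_all comeagerly_imp comeagerly_meets \<open>cdense D\<close>)
      (use H in \<open>simp add: good_def\<close>)
  then have "comeagerly (\<lambda>g. witness1 (x \<oplus>\<^sub>T g) x c (H' g))"
  proof (rule comeagerly_mono)
    fix g
    assume g: "meets g D \<and> (\<forall>q. q \<in> D \<longrightarrow> cmatch q g \<longrightarrow> witness1 (x \<oplus>\<^sub>T g) x c (H q g))"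
    then have "\<exists>q. q \<in> D \<and> cmatch q g"
      by (auto simp: meets_def)
    then have "sel g \<in> D \<and> cmatch (sel g) g"
      unfolding sel_def by (rule LeastI_ex)
    with g show "witness1 (x \<oplus>\<^sub>T g) x c (H' g)"
      by (auto simp: H'_def[abs_def])
  qed
  ultimately show ?thesis by blast
qed

lemma generic_le_witness: "\<exists>t. comeagerly (\<lambda>g. le_witness (x \<oplus>\<^sub>T g) x (decode_fun t g))"
proof -
  obtain H where H: "\<And>c k. (\<lambda>g. H c g k) \<in> measurable borel (count_space UNIV)"
    "\<And>c. comeagerly (\<lambda>g. witness1 (x \<oplus>\<^sub>T g) x c (H c g))"
  proof -
    have "\<forall>c. \<exists>H. (\<forall>k. (\<lambda>g. H g k) \<in> measurable borel (count_space UNIV)) \<and>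
        comeagerly (\<lambda>g. witness1 (x \<oplus>\<^sub>T g) x c (H g))"
      using generic_witness1 by blast
    then obtain H where "\<forall>c. (\<forall>k. (\<lambda>g. H c g k) \<in> measurable borel (count_space UNIV)) \<and>
        comeagerly (\<lambda>g. witness1 (x \<oplus>\<^sub>T g) x c (H c g))"
      by (rule choice[THEN exE])
    with that show thesis by blast
  qed
  define U where "U g m = H (from_nat (pfst m)) g (psnd m)" for g m
  have "almost_open {g. U g n = v}" for n v
  proof (rule almost_open_borel)
    have [measurable]: "(\<lambda>g. U g n) \<in> measurable borel (count_space UNIV)"
      unfolding U_def by (rule H(1))
    have "{g \<in> space borel. U g n = v} \<in> sets borel"
      by measurable
    then show "{g. U g n = v} \<in> sets borel" by simp
  qed
  then obtain t where t: "comeagerly (\<lambda>g. decode_fun t g = U g)"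
    using ex_decode_fun by blast
  have "comeagerly (\<lambda>g. \<forall>c. witness1 (x \<oplus>\<^sub>T g) x c (H c g))"
    by (rule comeagerly_all) (rule H(2))
  then have "comeagerly (\<lambda>g. le_witness (x \<oplus>\<^sub>T g) x (U g))"
    by (rule comeagerly_mono) (simp add: le_witness_def U_def)
  with t have "comeagerly (\<lambda>g. decode_fun t g = U g \<and> le_witness (x \<oplus>\<^sub>T g) x (U g))"
    by (rule comeagerly_conj)
  then have "comeagerly (\<lambda>g. le_witness (x \<oplus>\<^sub>T g) x (decode_fun t g))"
    by (rule comeagerly_mono) auto
  then show ?thesis by blast
qed

section \<open>The hypergraphs\<close>

definition even_half :: "cantor \<Rightarrow> cantor" where "even_half z n = z (2 * n)"
definition odd_half :: "cantor \<Rightarrow> cantor" where "odd_half z n = z (Suc (2 * n))"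

lemma join_halves [simp]: "even_half z \<oplus>\<^sub>T odd_half z = z"
  by (auto simp: join_def even_half_def odd_half_def elim!: oddE)

lemma halves_join [simp]: "even_half (x \<oplus>\<^sub>T y) = x" "odd_half (x \<oplus>\<^sub>T y) = y"
  by (auto simp: join_def even_half_def odd_half_def)

definition row :: "cantor \<Rightarrow> nat \<Rightarrow> cantor" where "row t i n = t (prod_encode (i, n))"

text \<open>
  The halves of \<open>z\<close> and \<open>w\<close> are the points \<open>y\<^sub>1, g\<close> and \<open>y\<^sub>2, h\<close>; the pair \<open>g, h\<close> codes witnesses that
  \<open>y\<^sub>1, y\<^sub>2, z, w\<close> have the same \<open>omega1\<close> relative to \<open>a\<close>.
\<close>

definition omega1_edge :: "cantor \<Rightarrow> cantor \<Rightarrow> cantor \<Rightarrow> cantor \<Rightarrow> bool" where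
  "omega1_edge a x z w \<longleftrightarrow>
     (x = even_half z \<or> x = even_half w) \<and>
     le_witness ((a \<oplus>\<^sub>T even_half z) \<oplus>\<^sub>T odd_half z) (a \<oplus>\<^sub>T even_half z)
       (decode_fun (row (pair_decode (odd_half z) (odd_half w)) 0) (odd_half z)) \<and>
     le_witness ((a \<oplus>\<^sub>T even_half w) \<oplus>\<^sub>T odd_half w) (a \<oplus>\<^sub>T even_half w)
       (decode_fun (row (pair_decode (odd_half z) (odd_half w)) 1) (odd_half w)) \<and>
     le_witness (a \<oplus>\<^sub>T even_half z) (a \<oplus>\<^sub>T even_half w)
       (decode_fun (row (pair_decode (odd_half z) (odd_half w)) 2) (odd_half z)) \<and>
     le_witness (a \<oplus>\<^sub>T even_half w) (a \<oplus>\<^sub>T even_half z)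
       (decode_fun (row (pair_decode (odd_half z) (odd_half w)) 3) (odd_half z))"

lemma omega1_edge_sound:
  assumes "omega1_edge a x z w"
  shows "omega1 (a \<oplus>\<^sub>T z) = omega1 (a \<oplus>\<^sub>T x)" "omega1 (a \<oplus>\<^sub>T w) = omega1 (a \<oplus>\<^sub>T x)"
proof -
  have *: "omega1 (a \<oplus>\<^sub>T v) = omega1 (a \<oplus>\<^sub>T even_half v)"
    if "omega1 ((a \<oplus>\<^sub>T even_half v) \<oplus>\<^sub>T odd_half v) \<le> omega1 (a \<oplus>\<^sub>T even_half v)" for v
  proof -
    have "omega1 (a \<oplus>\<^sub>T v) = omega1 ((a \<oplus>\<^sub>T even_half v) \<oplus>\<^sub>T odd_half v)"
      using omega1_join_assoc[of a "even_half v" "odd_half v"] by simp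
    also have "\<dots> = omega1 (a \<oplus>\<^sub>T even_half v)"
      using that omega1_le_join(1) by (rule antisym)
    finally show ?thesis .
  qed
  have "omega1 (a \<oplus>\<^sub>T z) = omega1 (a \<oplus>\<^sub>T even_half z)" "omega1 (a \<oplus>\<^sub>T w) = omega1 (a \<oplus>\<^sub>T even_half w)"
    "omega1 (a \<oplus>\<^sub>T even_half z) = omega1 (a \<oplus>\<^sub>T even_half w)"
    using assms unfolding omega1_edge_def by (blast intro: * le_witness_sound antisym)+
  then show "omega1 (a \<oplus>\<^sub>T z) = omega1 (a \<oplus>\<^sub>T x)" "omega1 (a \<oplus>\<^sub>T w) = omega1 (a \<oplus>\<^sub>T x)"
    using assms unfolding omega1_edge_def by auto
qed

lemma ex_pair_code_comeagerly:
  assumes P: "comeagerly P" and Q: "comeagerly Q"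
  shows "\<exists>g h. P g \<and> Q h \<and> pair_decode g h = t"
proof -
  have *: "\<exists>D. (\<forall>k::nat. cdense (D k)) \<and> (\<forall>g. (\<forall>k. meets g (D k)) \<longrightarrow> P g)" if P: "comeagerly P" for P
  proof -
    obtain \<D> where \<D>: "countable \<D>" "\<forall>D\<in>\<D>. cdense D" "\<forall>g. (\<forall>D\<in>\<D>. meets g D) \<longrightarrow> P g"
      using P unfolding comeagerly_def by blast
    have dense: "cdense UNIV"
      using cext_refl unfolding cdense_def by blast
    \<comment> \<open>\<open>UNIV\<close> is added because only a nonempty family can be
      enumerated.\<close>
    let ?D = "from_nat_into (insert UNIV \<D>)"
    have range: "range ?D = insert UNIV \<D>"
      using \<D>(1) by (intro range_from_nat_into) auto
    have "?D k \<in> insert UNIV \<D>" for k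
      by (rule subsetD[OF equalityD1[OF range] rangeI])
    then have "\<forall>k. cdense (?D k)"
      using \<D>(2) dense by (metis insertE)
    moreover have "P g" if g: "\<forall>k. meets g (?D k)" for g
    proof -
      have "meets g D" if "D \<in> \<D>" for D
      proof -
        have "D \<in> range ?D"
          by (rule subsetD[OF equalityD2[OF range]]) (use that in blast)
        then show ?thesis using g by blast
      qed
      then show ?thesis using \<D>(3) by blast
    qed
    ultimately show ?thesis by blast
  qed
  obtain D :: "nat \<Rightarrow> nat set" where D: "\<forall>k. cdense (D k)" "\<forall>g. (\<forall>k. meets g (D k)) \<longrightarrow> P g"
    using *[OF P] by blast
  obtain E :: "nat \<Rightarrow> nat set" where E: "\<forall>k. cdense (E k)" "\<forall>g. (\<forall>k. meets g (E k)) \<longrightarrow> Q g"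
    using *[OF Q] by blast
  have "\<exists>g h. (\<forall>k. meets g (D k)) \<and> (\<forall>k. meets h (E k)) \<and> pair_decode g h = t"
    by (rule ex_pair_code) (use D(1) E(1) in simp_all)
  with D(2) E(2) show ?thesis by blast
qed

lemma ex_omega1_edge:
  assumes eq: "omega1 (a \<oplus>\<^sub>T x) = omega1 (a \<oplus>\<^sub>T y)"
  shows "\<exists>z w. omega1_edge a x z w \<and> omega1_edge a y z w"
proof -
  obtain t0 where t0: "comeagerly (\<lambda>g. le_witness ((a \<oplus>\<^sub>T x) \<oplus>\<^sub>T g) (a \<oplus>\<^sub>T x) (decode_fun t0 g))"
    using generic_le_witness by blast
  obtain t1 where t1: "comeagerly (\<lambda>g. le_witness ((a \<oplus>\<^sub>T y) \<oplus>\<^sub>T g) (a \<oplus>\<^sub>T y) (decode_fun t1 g))"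
    using generic_le_witness by blast
  obtain u2 u3 where u: "le_witness (a \<oplus>\<^sub>T x) (a \<oplus>\<^sub>T y) u2" "le_witness (a \<oplus>\<^sub>T y) (a \<oplus>\<^sub>T x) u3"
    using ex_le_witness eq by (metis order_refl)
  obtain t2 t3 where t23: "\<And>g. decode_fun t2 g = u2" "\<And>g. decode_fun t3 g = u3"
    using ex_decode_fun_const by metis
  \<comment> \<open>Four rows, all fixed before the generic points: two codes valid on comeager sets
    and two constant ones.\<close>
  define t where "t m = (if pfst m = 0 then t0 (psnd m) else if pfst m = 1 then t1 (psnd m)
    else if pfst m = 2 then t2 (psnd m) else t3 (psnd m))" for m
  obtain g h where g: "le_witness ((a \<oplus>\<^sub>T x) \<oplus>\<^sub>T g) (a \<oplus>\<^sub>T x) (decode_fun t0 g)"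
    and h: "le_witness ((a \<oplus>\<^sub>T y) \<oplus>\<^sub>T h) (a \<oplus>\<^sub>T y) (decode_fun t1 h)" and gh: "pair_decode g h = t"
    using ex_pair_code_comeagerly[OF t0 t1] by blast
  have "row t 0 = t0" "row t 1 = t1" "row t 2 = t2" "row t 3 = t3"
    by (auto simp: row_def t_def)
  then have "omega1_edge a v (x \<oplus>\<^sub>T g) (y \<oplus>\<^sub>T h)" if "v = x \<or> v = y" for v
    unfolding omega1_edge_def using that g h gh u t23 by simp
  then show ?thesis by blast
qed

section \<open>Measurability of the edge predicate\<close>

lemma measurable_cantor_eq:
  fixes f g :: "'w \<Rightarrow> cantor"
  assumes "f \<in> borel_measurable M" "g \<in> borel_measurable M"
  shows "Measurable.pred M (\<lambda>w. f w = g w)"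
proof -
  have [measurable]: "Measurable.pred M (\<lambda>w. f w n)" "Measurable.pred M (\<lambda>w. g w n)" for n
    using assms by (simp_all add: borel_measurable_sequence_iff)
  show ?thesis
    unfolding fun_eq_iff by measurable
qed

lemma borel_measurable_join:
  assumes "f \<in> borel_measurable M" "g \<in> borel_measurable M"
  shows "(\<lambda>w. f w \<oplus>\<^sub>T g w) \<in> borel_measurable M"
proof -
  have [measurable]: "Measurable.pred M (\<lambda>w. f w n)" "Measurable.pred M (\<lambda>w. g w n)" for n
    using assms by (simp_all add: borel_measurable_sequence_iff)
  have "Measurable.pred M (\<lambda>w. (f w \<oplus>\<^sub>T g w) n)" for n
    by (cases "even n") (simp_all add: join_def)
  then show ?thesis
    by (simp add: borel_measurable_sequence_iff)
qed

lemma borel_measurable_halves: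
  assumes "f \<in> borel_measurable M"
  shows "(\<lambda>w. even_half (f w)) \<in> borel_measurable M" "(\<lambda>w. odd_half (f w)) \<in> borel_measurable M"
  using assms by (simp_all add: borel_measurable_sequence_iff even_half_def odd_half_def)

lemma borel_measurable_row:
  assumes "t \<in> borel_measurable M"
  shows "(\<lambda>w. row (t w) i) \<in> borel_measurable M"
  using assms by (simp add: borel_measurable_sequence_iff row_def)

lemma borel_measurable_pair_decode:
  assumes "f \<in> borel_measurable M" "g \<in> borel_measurable M"
  shows "(\<lambda>w. pair_decode (f w) (g w)) \<in> borel_measurable M"
proof -
  have [measurable]: "Measurable.pred M (\<lambda>w. f w n)" "Measurable.pred M (\<lambda>w. g w n)" for n
    using assms by (simp_all add: borel_measurable_sequence_iff)
  have "Measurable.pred M (\<lambda>w. pair_decode (f w) (g w) k)" for k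
    unfolding pair_decode_def by measurable
  then show ?thesis
    by (simp add: borel_measurable_sequence_iff)
qed

lemma borel_measurable_decode_fun:
  assumes "t \<in> borel_measurable M" "g \<in> borel_measurable M"
  shows "(\<lambda>w. decode_fun (t w) (g w)) \<in> borel_measurable M"
proof -
  have [measurable]: "Measurable.pred M (\<lambda>w. t w n)" for n
    using assms by (simp add: borel_measurable_sequence_iff)
  have [measurable]: "Measurable.pred M (\<lambda>w. cmatch q (g w))" for q
    using assms(2) measurable_cmatch by (rule measurable_compose)
  have "(\<lambda>w. decode_fun (t w) (g w) n) \<in> measurable M (count_space UNIV)" for n
    unfolding decode_fun_def by measurable
  then show ?thesis
    by (simp add: borel_measurable_sequence_iff)
qed

lemma measurable_omega1_edge:
  assumes "f \<in> borel_measurable M" "g \<in> borel_measurable M" "h \<in> borel_measurable M" "k \<in> borel_measurable M"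
  shows "Measurable.pred M (\<lambda>w. omega1_edge (f w) (g w) (h w) (k w))"
proof -
  note le = measurable_cantor_eq measurable_le_witness borel_measurable_join borel_measurable_halves borel_measurable_row
    borel_measurable_pair_decode borel_measurable_decode_fun
  show ?thesis
    unfolding omega1_edge_def by (intro pred_intros_logic le assms)
qed

section \<open>From edge predicates to hypergraphs\<close>

lemma subset_class_iff:
  assumes E: "equiv UNIV E"
  shows "(\<exists>C\<in>UNIV // E. e \<subseteq> C) \<longleftrightarrow> (\<forall>x\<in>e. \<forall>y\<in>e. (x, y) \<in> E)"
proof
  assume "\<exists>C\<in>UNIV // E. e \<subseteq> C"
  then show "\<forall>x\<in>e. \<forall>y\<in>e. (x, y) \<in> E"
    using quotient_eq_iff[OF E] by blast
next
  assume e: "\<forall>x\<in>e. \<forall>y\<in>e. (x, y) \<in> E"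
  \<comment> \<open>For empty \<open>e\<close> every class will do, so \<open>x\<close> is then
    arbitrary.\<close>
  obtain x where "e = {} \<or> x \<in> e"
    by blast
  then show "\<exists>C\<in>UNIV // E. e \<subseteq> C"
    using e by (intro bexI[of _ "E `` {x}"]) (auto intro: quotientI)
qed

text \<open>A tuple belongs to the preimage as soon as any tuple with the same range satisfies
  \<open>Q\<close>. Such a tuple is a rearrangement by one of finitely many \<open>\<sigma>\<close>,
  which turns a projection into a finite union.\<close>

lemma borel_hypergraph_image:
  fixes Q :: "(nat \<Rightarrow> 'a::second_countable_topology) \<Rightarrow> bool"
  assumes diag: "{p. fst p = snd p} \<in> sets (borel :: ('a \<times> 'a) measure)"
    and Q: "Measurable.pred (\<Pi>\<^sub>M i\<in>{..<n}. borel) Q"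
  shows "borel_hypergraph n {f ` {..<n} | f. f \<in> {..<n} \<rightarrow>\<^sub>E UNIV \<and> Q f}"
    (is "borel_hypergraph n ?G")
  unfolding borel_hypergraph_def
proof
  show "\<forall>e\<in>?G. finite e \<and> card e \<le> n"
    using card_image_le[of "{..<n}"] by fastforce
  let ?M = "\<Pi>\<^sub>M i\<in>{..<n}. (borel :: 'a measure)"
  let ?S = "{..<n} \<rightarrow>\<^sub>E {..<n}"
  have "f ` {..<n} \<in> ?G \<longleftrightarrow> (\<exists>\<sigma>\<in>?S. (\<forall>l\<in>{..<n}. \<exists>i\<in>{..<n}. f l = f (\<sigma> i)) \<and> Q (\<lambda>i\<in>{..<n}. f (\<sigma> i)))"
    (is "?l \<longleftrightarrow> ?r") for f
  proof
    assume ?l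
    then obtain f' where f': "f ` {..<n} = f' ` {..<n}" "f' \<in> {..<n} \<rightarrow>\<^sub>E UNIV" "Q f'"
      by blast
    then have "\<forall>i\<in>{..<n}. \<exists>j. j \<in> {..<n} \<and> f' i = f j"
      by (metis imageE imageI)
    then obtain s where s: "\<forall>i\<in>{..<n}. s i \<in> {..<n} \<and> f' i = f (s i)"
      by (rule bchoice[THEN exE])
    define \<sigma> where "\<sigma> = restrict s {..<n}"
    have \<sigma>: "\<sigma> \<in> ?S" "\<And>i. i \<in> {..<n} \<Longrightarrow> f (\<sigma> i) = f' i"
      using s by (auto simp: \<sigma>_def)
    have "(\<lambda>i\<in>{..<n}. f (\<sigma> i)) = f'"
      using \<sigma>(2) f'(2) by (intro ext) (auto simp: PiE_def extensional_def)
    moreover have "\<exists>i\<in>{..<n}. f l = f (\<sigma> i)" if l: "l \<in> {..<n}" for l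
    proof -
      have "f l \<in> f' ` {..<n}"
        using l f'(1) by blast
      then show ?thesis
        using \<sigma>(2) by auto
    qed
    ultimately show ?r
      using \<sigma>(1) f'(3) by auto
  next
    assume ?r
    then obtain \<sigma> where \<sigma>: "\<sigma> \<in> ?S" "\<forall>l\<in>{..<n}. \<exists>i\<in>{..<n}. f l = f (\<sigma> i)" "Q (\<lambda>i\<in>{..<n}. f (\<sigma> i))"
      by blast
    have "f ` {..<n} = (\<lambda>i\<in>{..<n}. f (\<sigma> i)) ` {..<n}"
      using \<sigma>(1,2) by (auto simp: image_iff PiE_iff)
    moreover have "(\<lambda>i\<in>{..<n}. f (\<sigma> i)) \<in> {..<n} \<rightarrow>\<^sub>E UNIV"
      by simp
    ultimately show ?l
      using \<sigma>(3) by blast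
  qed
  then have "{f \<in> {..<n} \<rightarrow>\<^sub>E UNIV. f ` {..<n} \<in> ?G} = {f \<in> space ?M. \<exists>\<sigma>\<in>?S.
      (\<forall>l\<in>{..<n}. \<exists>i\<in>{..<n}. f l = f (\<sigma> i)) \<and> Q (\<lambda>i\<in>{..<n}. f (\<sigma> i))}"
    by (simp add: space_PiM)
  also have "\<dots> \<in> sets ?M"
  proof -
    have fin: "finite ?S"
      by (intro finite_PiE) auto
    have [measurable]: "Measurable.pred ?M (\<lambda>f. Q (\<lambda>i\<in>{..<n}. f (\<sigma> i)))" if "\<sigma> \<in> ?S" for \<sigma>
    proof (rule measurable_compose[OF _ Q])
      show "(\<lambda>f. \<lambda>i\<in>{..<n}. f (\<sigma> i)) \<in> measurable ?M ?M"
        using that by (intro measurable_restrict measurable_component_singleton) auto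
    qed
    have [measurable]: "Measurable.pred ?M (\<lambda>f. f l = f (\<sigma> i))" if "\<sigma> \<in> ?S" "l \<in> {..<n}" "i \<in> {..<n}" for \<sigma> l i
    proof -
      have "(\<lambda>f. (f l, f (\<sigma> i))) \<in> measurable ?M borel"
        using that by (intro borel_measurable_Pair measurable_component_singleton) auto
      from measurable_sets[OF this diag] show ?thesis
        by (simp add: pred_def vimage_def Int_def conj_commute)
    qed
    have "Measurable.pred ?M (\<lambda>f. \<exists>\<sigma>\<in>?S. (\<forall>l\<in>{..<n}. \<exists>i\<in>{..<n}. f l = f (\<sigma> i)) \<and> Q (\<lambda>i\<in>{..<n}. f (\<sigma> i)))"
      by (intro pred_intros_finite[OF fin] pred_intros_finite pred_intros_logic) (simp_all, measurable)
    then show ?thesis by (simp add: pred_def)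
  qed
  finally show "{f \<in> {..<n} \<rightarrow>\<^sub>E UNIV. f ` {..<n} \<in> ?G} \<in> sets ?M" .
qed

text \<open>\<open>A\<close> is the parameter and \<open>X\<close> the point compared. The
  hypothesis \<open>ex\<close> places the auxiliary points in the fibre of the given one;
  \<open>inj\<close> yields a Borel diagonal, by which the ranges of tuples are compared.\<close>

lemma omega1_hypergraphable:
  fixes A X :: "'p::second_countable_topology \<Rightarrow> cantor"
  assumes A: "A \<in> borel_measurable borel" and X: "X \<in> borel_measurable borel"
    and ex: "\<And>p z. \<exists>q. A q = A p \<and> X q = z"
    and inj: "\<And>p q. A p = A q \<Longrightarrow> X p = X q \<Longrightarrow> p = q"
  defines "E \<equiv> {(p, q). A p = A q \<and> omega1 (A p \<oplus>\<^sub>T X p) = omega1 (A q \<oplus>\<^sub>T X q)}"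
  shows "borel_hypergraphable 3 E" "strongly_borel_hypergraphable 4 E"
proof -
  have equiv: "equiv UNIV E"
    by (auto simp: E_def equiv_def refl_on_def sym_def trans_def)
  have analytic: "analytic_equivalence E"
    unfolding analytic_equivalence_def analytic_set_def
  proof (intro conjI equiv bexI)
    \<comment> \<open>The Baire coordinate holds two witnesses, for the two inequalities, on its
      even and odd places.\<close>
    let ?P = "\<lambda>v :: ('p \<times> 'p) \<times> (nat \<Rightarrow> nat). A (fst (fst v)) = A (snd (fst v)) \<and>
      le_witness (A (fst (fst v)) \<oplus>\<^sub>T X (fst (fst v))) (A (snd (fst v)) \<oplus>\<^sub>T X (snd (fst v))) (\<lambda>n. snd v (2 * n)) \<and>
      le_witness (A (snd (fst v)) \<oplus>\<^sub>T X (snd (fst v))) (A (fst (fst v)) \<oplus>\<^sub>T X (fst (fst v))) (\<lambda>n. snd v (Suc (2 * n)))"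
    have 1: "(\<lambda>v :: ('p \<times> 'p) \<times> (nat \<Rightarrow> nat). fst (fst v)) \<in> borel_measurable borel"
      "(\<lambda>v :: ('p \<times> 'p) \<times> (nat \<Rightarrow> nat). snd (fst v)) \<in> borel_measurable borel"
      "(\<lambda>v :: ('p \<times> 'p) \<times> (nat \<Rightarrow> nat). snd v) \<in> borel_measurable borel"
      by (intro borel_measurable_continuous_onI continuous_intros)+
    note 2 = measurable_compose[OF 1(1) A] measurable_compose[OF 1(2) A]
      measurable_compose[OF 1(1) X] measurable_compose[OF 1(2) X]
    have 3: "(\<lambda>v :: ('p \<times> 'p) \<times> (nat \<Rightarrow> nat). \<lambda>n. snd v (2 * n)) \<in> borel_measurable borel"
      "(\<lambda>v :: ('p \<times> 'p) \<times> (nat \<Rightarrow> nat). \<lambda>n. snd v (Suc (2 * n))) \<in> borel_measurable borel"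
      using 1(3) by (simp_all add: borel_measurable_sequence_iff)
    have "Measurable.pred borel (\<lambda>v :: ('p \<times> 'p) \<times> (nat \<Rightarrow> nat). A (fst (fst v)) = A (snd (fst v)))"
      by (rule measurable_cantor_eq[OF 2(1,2)])
    then have "Measurable.pred borel ?P"
      by (intro pred_intros_logic measurable_le_witness borel_measurable_join 2 3)
    then show "{v. ?P v} \<in> sets borel"
      by (simp add: pred_def)
    show "E = fst ` {v. ?P v}"
    proof (intro set_eqI iffI)
      fix v
      assume "v \<in> E"
      then obtain p q where v: "v = (p, q)" "A p = A q" "omega1 (A p \<oplus>\<^sub>T X p) = omega1 (A q \<oplus>\<^sub>T X q)"
        by (auto simp: E_def)
      obtain u u' where "le_witness (A p \<oplus>\<^sub>T X p) (A q \<oplus>\<^sub>T X q) u" "le_witness (A q \<oplus>\<^sub>T X q) (A p \<oplus>\<^sub>T X p) u'"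
        using v(3) ex_le_witness by (metis order_refl)
      then have "?P ((p, q), \<lambda>n. if even n then u (n div 2) else u' (n div 2))"
        using v(2) by simp
      then show "v \<in> fst ` {v. ?P v}"
        unfolding v(1) by (intro image_eqI[rotated]) (rule CollectI, assumption, simp)
    next
      fix v
      assume "v \<in> fst ` {v. ?P v}"
      then show "v \<in> E"
        by (auto simp: E_def intro!: antisym dest: le_witness_sound)
    qed
  qed
  have comp: "(\<lambda>f. f i) \<in> measurable (\<Pi>\<^sub>M i\<in>{..<n}. (borel :: 'p measure)) borel" if "i < n" for i n :: nat
    using that by (intro measurable_component_singleton) simp
  note comp_A = measurable_compose[OF comp A] and comp_X = measurable_compose[OF comp X]
  have comp_eq: "Measurable.pred (\<Pi>\<^sub>M i\<in>{..<n}. (borel :: 'p measure)) (\<lambda>f. A (f i) = A (f j))"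
    if "i < n" "j < n" for i j n :: nat
    using that by (intro measurable_cantor_eq comp_A)
  have diag: "{v. fst v = snd v} \<in> sets (borel :: ('p \<times> 'p) measure)"
  proof -
    have fs: "fst \<in> borel_measurable (borel :: ('p \<times> 'p) measure)"
      "snd \<in> borel_measurable (borel :: ('p \<times> 'p) measure)"
      by (intro borel_measurable_continuous_onI continuous_intros)+
    have "Measurable.pred (borel :: ('p \<times> 'p) measure) (\<lambda>v. A (fst v) = A (snd v) \<and> X (fst v) = X (snd v))"
      by (intro pred_intros_logic measurable_cantor_eq measurable_compose[OF fs(1)]
          measurable_compose[OF fs(2)] A X)
    moreover have "(\<lambda>v. A (fst v) = A (snd v) \<and> X (fst v) = X (snd v)) = (\<lambda>v. fst v = snd v)"
      using inj by auto
    ultimately show ?thesis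
      by (simp add: pred_def)
  qed
  define edge where "edge p q r \<longleftrightarrow> A p = A q \<and> A p = A r \<and> omega1_edge (A p) (X p) (X q) (X r)" for p q r
  have edge_meas: "Measurable.pred (\<Pi>\<^sub>M i\<in>{..<n}. (borel :: 'p measure)) (\<lambda>f. edge (f i) (f j) (f k))"
    if "i < n" "j < n" "k < n" for i j k n :: nat
    unfolding edge_def using that
    by (intro pred_intros_logic comp_eq measurable_omega1_edge comp_A comp_X)
  have edge_sound: "(p, q) \<in> E" "(p, r) \<in> E" if "edge p q r" for p q r
    using that omega1_edge_sound[of "A p" "X p" "X q" "X r"] by (auto simp: edge_def E_def)
  have E_trans: "(p, r) \<in> E" if "(p, q) \<in> E" "(q, r) \<in> E" for p q r
    using that by (auto simp: E_def)
  have E_sym: "(q, p) \<in> E" if "(p, q) \<in> E" for p q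
    using that by (auto simp: E_def)
  have E_refl: "(p, p) \<in> E" for p
    by (auto simp: E_def)
  have edge_ex: "\<exists>r s. edge p r s \<and> edge q r s" if pq: "(p, q) \<in> E" for p q
  proof -
    have eq: "A p = A q" "omega1 (A p \<oplus>\<^sub>T X p) = omega1 (A p \<oplus>\<^sub>T X q)"
      using pq by (auto simp: E_def)
    obtain z w where zw: "omega1_edge (A p) (X p) z w" "omega1_edge (A p) (X q) z w"
      using ex_omega1_edge[OF eq(2)] by blast
    obtain r s where "A r = A p" "X r = z" "A s = A p" "X s = w"
      using ex by metis
    with zw eq(1) have "edge p r s \<and> edge q r s"
      by (simp add: edge_def)
    then show ?thesis by blast
  qed
  show "borel_hypergraphable 3 E"
    unfolding borel_hypergraphable_def
  proof (intro conjI analytic exI)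
    let ?Q = "\<lambda>f. edge (f 0) (f 1) (f 2)"
    let ?G = "{f ` {..<3::nat} | f. f \<in> {..<3} \<rightarrow>\<^sub>E UNIV \<and> ?Q f}"
    have lt3: "{..<3} = {0, 1, 2::nat}"
      by auto
    show "borel_hypergraph 3 ?G"
      by (intro borel_hypergraph_image diag edge_meas) auto
    have G: "{p, q, r} \<in> ?G" if "edge p q r" for p q r
      by (rule CollectI, rule exI[of _ "\<lambda>i\<in>{..<3}. if i = 0 then p else if i = 1 then q else r"])
        (use that in \<open>auto simp: lt3\<close>)
    show "\<forall>e\<in>?G. \<exists>C\<in>UNIV // E. e \<subseteq> C"
      unfolding subset_class_iff[OF equiv]
    proof
      fix e
      assume "e \<in> ?G"
      then obtain f :: "nat \<Rightarrow> 'p" where f: "edge (f 0) (f 1) (f 2)" and "e = f ` {..<3}"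
        by blast
      then have e: "e = {f 0, f 1, f 2}"
        by (simp add: lt3)
      have "(f 0, p) \<in> E" if "p \<in> e" for p
        using that edge_sound[OF f] E_refl unfolding e by blast
      then show "\<forall>x\<in>e. \<forall>y\<in>e. (x, y) \<in> E"
        using E_trans E_sym by blast
    qed
    show "\<forall>x y. (x, y) \<in> E \<longrightarrow> (\<exists>es. hyperedge_path ?G x y es)"
    proof (intro allI impI)
      fix p q
      assume "(p, q) \<in> E"
      then obtain r s where rs: "edge p r s" "edge q r s"
        using edge_ex by blast
      \<comment> \<open>The two edges meet in the auxiliary points \<open>r\<close> and
        \<open>s\<close>.\<close>
      have "hyperedge_path ?G p q [{p, r, s}, {q, r, s}]"
        using G[OF rs(1)] G[OF rs(2)] unfolding hyperedge_path_def by (auto simp: less_Suc_eq)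
      then show "\<exists>es. hyperedge_path ?G p q es" by blast
    qed
  qed
  show "strongly_borel_hypergraphable 4 E"
    unfolding strongly_borel_hypergraphable_def
  proof (intro conjI analytic exI)
    \<comment> \<open>Entries 0 and 1 are the two given points, 2 and 3 the auxiliary ones serving
      both.\<close>
    let ?Q = "\<lambda>f. edge (f 0) (f 2) (f 3) \<and> edge (f 1) (f 2) (f 3)"
    let ?G = "{f ` {..<4::nat} | f. f \<in> {..<4} \<rightarrow>\<^sub>E UNIV \<and> ?Q f}"
    have lt4: "{..<4} = {0, 1, 2, 3::nat}"
      by auto
    show "borel_hypergraph 4 ?G"
      by (intro borel_hypergraph_image diag pred_intros_logic edge_meas) auto
    show "\<forall>e\<in>?G. \<exists>C\<in>UNIV // E. e \<subseteq> C"
      unfolding subset_class_iff[OF equiv]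
    proof
      fix e
      assume "e \<in> ?G"
      then obtain f :: "nat \<Rightarrow> 'p" where f: "edge (f 0) (f 2) (f 3)" "edge (f 1) (f 2) (f 3)"
        and "e = f ` {..<4}"
        by blast
      then have e: "e = {f 0, f 1, f 2, f 3}"
        by (simp add: lt4)
      \<comment> \<open>Entry 2 lies in both triples and so links all four points.\<close>
      have "(f 2, p) \<in> E" if "p \<in> e" for p
        using that edge_sound[OF f(1)] edge_sound[OF f(2)] E_refl E_trans E_sym unfolding e by blast
      then show "\<forall>x\<in>e. \<forall>y\<in>e. (x, y) \<in> E"
        using E_trans E_sym by blast
    qed
    show "\<forall>x y. (x, y) \<in> E \<longrightarrow> (\<exists>e\<in>?G. x \<in> e \<and> y \<in> e)"
    proof (intro allI impI)
      fix p q
      assume "(p, q) \<in> E"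
      then obtain r s where rs: "edge p r s" "edge q r s"
        using edge_ex by blast
      have "{p, q, r, s} \<in> ?G"
        by (rule CollectI, rule exI[of _ "\<lambda>i\<in>{..<4}. if i = 0 then p else if i = 1 then q else if i = 2 then r else s"])
          (use rs in \<open>auto simp: lt4\<close>)
      then show "\<exists>e\<in>?G. p \<in> e \<and> q \<in> e" by blast
    qed
  qed
qed

theorem theorem6p5:
  shows "(borel_hypergraphable 3 F_omega1 \<and> strongly_borel_hypergraphable 4 F_omega1) \<and>
         (borel_hypergraphable 3 F_omega1_rel \<and> strongly_borel_hypergraphable 4 F_omega1_rel)"
proof -
  let ?z = "\<lambda>x::cantor. (\<lambda>n::nat. False)"
  have F: "F_omega1 = {(p, q). ?z p = ?z q \<and> omega1 (?z p \<oplus>\<^sub>T p) = omega1 (?z q \<oplus>\<^sub>T q)}"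
    by (simp add: F_omega1_def omega1_join_False)
  have 1: "borel_hypergraphable 3 F_omega1" "strongly_borel_hypergraphable 4 F_omega1"
    unfolding F by (rule omega1_hypergraphable[where A = ?z and X = "\<lambda>x. x"]; simp)+
  have Frel: "F_omega1_rel =
      {(p, q). fst p = fst q \<and> omega1 (fst p \<oplus>\<^sub>T snd p) = omega1 (fst q \<oplus>\<^sub>T snd q)}"
    by (auto simp: F_omega1_rel_def)
  have m: "fst \<in> borel_measurable (borel :: (cantor \<times> cantor) measure)"
    "snd \<in> borel_measurable (borel :: (cantor \<times> cantor) measure)"
    by (intro borel_measurable_continuous_onI continuous_intros)+
  have ex: "\<exists>q. fst q = fst p \<and> snd q = z" for p :: "cantor \<times> cantor" and z
    by (intro exI[of _ "(fst p, z)"]) simp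
  have inj: "p = q" if "fst p = fst q" "snd p = snd q" for p q :: "cantor \<times> cantor"
    using that by (rule prod_eqI)
  have 2: "borel_hypergraphable 3 F_omega1_rel"
    unfolding Frel by (rule omega1_hypergraphable(1)[OF m ex inj])
  have 3: "strongly_borel_hypergraphable 4 F_omega1_rel"
    unfolding Frel by (rule omega1_hypergraphable(2)[OF m ex inj])
  from 1 2 3 show ?thesis by blast
qed

end
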